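(* Let $\mathcal B=(B,X,p,F)$ and $\mathcal B'=(B',X',p',F)$ be definable fibre bundles with the same fibre $F$, where $F$ is locally definably compact, and let $f\colon\mathcal B\to\mathcal B'$ be a definable bundle map with induced map $\bar f\colon X\to X'$ on the base spaces. Let $\mathcal B''=\bar f^{-1}(\mathcal B')$ be the induced bundle, and $\hat{\bar f}\colon \mathcal B''\to\mathcal B'$ the induced map. Then $\mathcal B''$ is isomorphic to $\mathcal B$; moreover there is a definable bundle isomorphism $g\colon\mathcal B\to\mathcal B''$ such that $\hat{\bar f}\circ g=f$.
   Context: Fix an o-minimal expansion $\mathcal M$ of a real closed field $R$; "definable" means definable in $\mathcal M$ with parameters, with order/product/subspace topologies. A definable map is a continuous definable function. $F$ is locally definably compact if each point has a definably compact definable neighbourhood in $F$. A definable fibre bundle $(B,X,p,F)$ consists of definable sets $B,X,F$ and a surjective definable map $p\colon B\to X$ such that there is a finite covering of $X$ by open definable sets $U_i$ with definable homeomorphisms $\phi_i\colon U_i\times F\to p^{-1}(U_i)$. A definable bundle map $f\colon(B,X,p,F)\to(B',X',p',F)$ is a definable map $f\colon B\to B'$ for which there is a definable map $\bar f\colon X\to X'$ (the induced map on base spaces) with $p'\circ f=\bar f\circ p$ and such that for every $x\in X$, $f|_{p^{-1}(x)}$ is a homeomorphism onto $p'^{-1}(\bar f(x))$. A definable bundle isomorphism is a definable bundle map which is a homeomorphism of bundle spaces; two bundles are isomorphic if there is one between them. For a definable map $h\colon Y\to X'$, the induced bundle $h^{-1}(\mathcal B')$ is $(A,Y,q,F)$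 where $A=\{(x,y)\in B'\times Y: p'(x)=h(y)\}$, $q(x,y)=y$, and the induced map is $\hat h\colon A\to B'$, $(x,y)\mapsto x$. *)

theory Defs
  imports "HOL-Analysis.Analysis"
begin

section \<open>Real closed fields and their first-order expansions\<close>

text \<open>The superclass \<^class>\<open>linorder_topology\<close> makes \<^const>\<open>open\<close> the order topology.\<close>

class real_closed_field = linordered_field + linorder_topology +
  assumes nonneg_has_sqrt: "0 \<le> a \<Longrightarrow> \<exists>x. x * x = a"
    and odd_degree_has_root:
      "odd n \<Longrightarrow> c n \<noteq> 0 \<Longrightarrow> \<exists>x. (\<Sum>k\<le>n. c k * x ^ k) = 0"

text \<open>
  First-order formulas over the language of ordered rings extended by arbitrary function symbols
  \<open>'f\<close> and relation symbols \<open>'r\<close>. A symbol is interpreted on argument lists of every length, so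
  it stands for one symbol of each arity. The constants \<open>0\<close>, \<open>1\<close> and negation are omitted, since
  they are definable from the rest.
\<close>

datatype 'f fo_term =
    Var nat
  | Add "'f fo_term" "'f fo_term"
  | Mul "'f fo_term" "'f fo_term"
  | App 'f "'f fo_term list"

datatype ('f, 'r) fo_formula =
    Eq "'f fo_term" "'f fo_term"
  | Less "'f fo_term" "'f fo_term"
  | Rel 'r "'f fo_term list"
  | Neg "('f, 'r) fo_formula"
  | Conj "('f, 'r) fo_formula" "('f, 'r) fo_formula"
  | Ex nat "('f, 'r) fo_formula"

record ('a, 'f, 'r) expansion =
  fun_interp :: "'f \<Rightarrow> 'a list \<Rightarrow> 'a"
  rel_interp :: "'r \<Rightarrow> 'a list \<Rightarrow> bool"

primrec term_val ::
    "('a::real_closed_field, 'f, 'r) expansion \<Rightarrow> (nat \<Rightarrow> 'a) \<Rightarrow> 'f fo_term \<Rightarrow> 'a" where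
  "term_val M e (Var i) = e i"
| "term_val M e (Add s t) = term_val M e s + term_val M e t"
| "term_val M e (Mul s t) = term_val M e s * term_val M e t"
| "term_val M e (App g ts) = fun_interp M g (map (term_val M e) ts)"

primrec sat ::
    "('a::real_closed_field, 'f, 'r) expansion \<Rightarrow> (nat \<Rightarrow> 'a) \<Rightarrow> ('f, 'r) fo_formula \<Rightarrow> bool" where
  "sat M e (Eq s t) \<longleftrightarrow> term_val M e s = term_val M e t"
| "sat M e (Less s t) \<longleftrightarrow> term_val M e s < term_val M e t"
| "sat M e (Rel r ts) \<longleftrightarrow> rel_interp M r (map (term_val M e) ts)"
| "sat M e (Neg \<phi>) \<longleftrightarrow> \<not> sat M e \<phi>"
| "sat M e (Conj \<phi> \<psi>) \<longleftrightarrow> sat M e \<phi> \<and> sat M e \<psi>"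
| "sat M e (Ex i \<phi>) \<longleftrightarrow> (\<exists>a. sat M (e(i := a)) \<phi>)"

section \<open>Definable sets and definable maps\<close>

text \<open>
  A point of \<open>R^n\<close> is an extensional function on \<open>{..<n}\<close>, as in \<^const>\<open>product_topology\<close>.
\<close>

definition cart_top :: "nat \<Rightarrow> (nat \<Rightarrow> 'a::real_closed_field) topology" where
  "cart_top n = product_topology (\<lambda>_. euclidean) {..<n}"

definition cart_space :: "nat \<Rightarrow> (nat \<Rightarrow> 'a::real_closed_field) set" where
  "cart_space n = (\<Pi>\<^sub>E i\<in>{..<n}. UNIV)"

abbreviation sub_top :: "nat \<Rightarrow> (nat \<Rightarrow> 'a::real_closed_field) set \<Rightarrow> (nat \<Rightarrow> 'a) topology" where
  "sub_top n A \<equiv> subtopology (cart_top n) A"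

text \<open>
  The variables with index below \<open>n\<close> are the coordinates; the assignment \<open>e\<close> supplies the
  parameters through the remaining variables.
\<close>

definition definable ::
    "('a::real_closed_field, 'f, 'r) expansion \<Rightarrow> nat \<Rightarrow> (nat \<Rightarrow> 'a) set \<Rightarrow> bool" where
  "definable M n A \<longleftrightarrow>
     (\<exists>\<phi> e. A = {x \<in> cart_space n. sat M (\<lambda>i. if i < n then x i else e i) \<phi>})"

definition o_minimal :: "('a::real_closed_field, 'f, 'r) expansion \<Rightarrow> bool" where
  "o_minimal M \<longleftrightarrow>
     (\<forall>A. definable M 1 A \<longrightarrow>
        (\<exists>\<C>. finite \<C> \<and> (\<lambda>x. x 0) ` A = \<Union>\<C> \<and>
          (\<forall>I\<in>\<C>. I = UNIV \<or>
             (\<exists>a b. I = {a} \<or> I = {a<..<b} \<or> I = {a<..} \<or> I = {..<b}))))"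

text \<open>
  \<open>join m x y \<in> R^(m+n)\<close> is the pair \<open>(x, y) \<in> R^m \<times> R^n\<close>; \<open>left_part m\<close> and \<open>right_part m n\<close>
  are the two projections.
\<close>

definition join :: "nat \<Rightarrow> (nat \<Rightarrow> 'a) \<Rightarrow> (nat \<Rightarrow> 'a) \<Rightarrow> nat \<Rightarrow> 'a" where
  "join m x y = (\<lambda>i. if i < m then x i else y (i - m))"

definition left_part :: "nat \<Rightarrow> (nat \<Rightarrow> 'a) \<Rightarrow> nat \<Rightarrow> 'a" where
  "left_part m z = (\<lambda>i\<in>{..<m}. z i)"

definition right_part :: "nat \<Rightarrow> nat \<Rightarrow> (nat \<Rightarrow> 'a) \<Rightarrow> nat \<Rightarrow> 'a" where
  "right_part m n z = (\<lambda>i\<in>{..<n}. z (m + i))"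

definition join_prod :: "nat \<Rightarrow> (nat \<Rightarrow> 'a) set \<Rightarrow> (nat \<Rightarrow> 'a) set \<Rightarrow> (nat \<Rightarrow> 'a) set" where
  "join_prod m A B = {join m x y | x y. x \<in> A \<and> y \<in> B}"

definition definable_map ::
    "('a::real_closed_field, 'f, 'r) expansion \<Rightarrow> nat \<Rightarrow> (nat \<Rightarrow> 'a) set \<Rightarrow>
     nat \<Rightarrow> (nat \<Rightarrow> 'a) set \<Rightarrow> ((nat \<Rightarrow> 'a) \<Rightarrow> nat \<Rightarrow> 'a) \<Rightarrow> bool" where
  "definable_map M m A n B f \<longleftrightarrow>
     definable M m A \<and> definable M n B \<and>
     continuous_map (sub_top m A) (sub_top n B) f \<and>
     definable M (m + n) {join m x (f x) | x. x \<in> A}"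

definition definable_homeo ::
    "('a::real_closed_field, 'f, 'r) expansion \<Rightarrow> nat \<Rightarrow> (nat \<Rightarrow> 'a) set \<Rightarrow>
     nat \<Rightarrow> (nat \<Rightarrow> 'a) set \<Rightarrow> ((nat \<Rightarrow> 'a) \<Rightarrow> nat \<Rightarrow> 'a) \<Rightarrow> bool" where
  "definable_homeo M m A n B f \<longleftrightarrow>
     definable_map M m A n B f \<and> homeomorphic_map (sub_top m A) (sub_top n B) f"

text \<open>
  Definable compactness in the sense of Peterzil and Steinhorn: every definable curve has limits
  in the set at both ends. Bounded intervals suffice, as over a field every open interval is
  definably homeomorphic to a bounded one.
\<close>

definition point1 :: "'a \<Rightarrow> nat \<Rightarrow> 'a" where
  "point1 t = (\<lambda>i\<in>{..<1}. t)"

definition definably_compact ::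
    "('a::real_closed_field, 'f, 'r) expansion \<Rightarrow> nat \<Rightarrow> (nat \<Rightarrow> 'a) set \<Rightarrow> bool" where
  "definably_compact M n K \<longleftrightarrow>
     definable M n K \<and>
     (\<forall>a b \<sigma>. a < b \<and> definable_map M 1 (point1 ` {a<..<b}) n K \<sigma> \<longrightarrow>
        (\<exists>l. limitin (sub_top n K) (\<lambda>t. \<sigma> (point1 t)) l (at_right a)) \<and>
        (\<exists>l. limitin (sub_top n K) (\<lambda>t. \<sigma> (point1 t)) l (at_left b)))"

definition locally_definably_compact ::
    "('a::real_closed_field, 'f, 'r) expansion \<Rightarrow> nat \<Rightarrow> (nat \<Rightarrow> 'a) set \<Rightarrow> bool" where
  "locally_definably_compact M n F \<longleftrightarrow>
     (\<forall>v\<in>F. \<exists>K U. definably_compact M n K \<and> openin (sub_top n F) U \<and>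
        v \<in> U \<and> U \<subseteq> K \<and> K \<subseteq> F)"

section \<open>Definable fibre bundles\<close>

text \<open>
  \<open>tdim\<close>, \<open>bdim\<close> and \<open>fdim\<close> are the exponents \<open>n\<close> of the ambient spaces \<open>R^n\<close> of total
  space, base and fibre, not dimensions of these sets.
\<close>

record 'a fibre_bundle =
  tdim :: nat
  total :: "(nat \<Rightarrow> 'a) set"
  bdim :: nat
  base :: "(nat \<Rightarrow> 'a) set"
  proj :: "(nat \<Rightarrow> 'a) \<Rightarrow> nat \<Rightarrow> 'a"
  fdim :: nat
  fibre :: "(nat \<Rightarrow> 'a) set"

definition total_over :: "'a fibre_bundle \<Rightarrow> (nat \<Rightarrow> 'a) set \<Rightarrow> (nat \<Rightarrow> 'a) set" where
  "total_over E U = {b \<in> total E. proj E b \<in> U}"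

text \<open>As usual, local trivialisations commute with the projections to the base.\<close>

definition definable_fibre_bundle ::
    "('a::real_closed_field, 'f, 'r) expansion \<Rightarrow> 'a fibre_bundle \<Rightarrow> bool" where
  "definable_fibre_bundle M E \<longleftrightarrow>
     definable M (fdim E) (fibre E) \<and>
     definable_map M (tdim E) (total E) (bdim E) (base E) (proj E) \<and>
     proj E ` total E = base E \<and>
     (\<exists>\<U>. finite \<U> \<and> \<Union>\<U> = base E \<and>
        (\<forall>U\<in>\<U>. definable M (bdim E) U \<and> openin (sub_top (bdim E) (base E)) U \<and>
           (\<exists>\<phi>. definable_homeo M (bdim E + fdim E) (join_prod (bdim E) U (fibre E))
                  (tdim E) (total_over E U) \<phi> \<and>
                (\<forall>x\<in>U. \<forall>v\<in>fibre E. proj E (\<phi> (join (bdim E) x v)) = x))))"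

text \<open>
  \<open>f\<close> is a definable bundle map and \<open>fb\<close> is the map it induces on the bases.
  It is only defined between bundles with the same fibre.
\<close>

definition definable_bundle_map_over ::
    "('a::real_closed_field, 'f, 'r) expansion \<Rightarrow> 'a fibre_bundle \<Rightarrow> 'a fibre_bundle \<Rightarrow>
     ((nat \<Rightarrow> 'a) \<Rightarrow> nat \<Rightarrow> 'a) \<Rightarrow> ((nat \<Rightarrow> 'a) \<Rightarrow> nat \<Rightarrow> 'a) \<Rightarrow> bool" where
  "definable_bundle_map_over M E E' f fb \<longleftrightarrow>
     definable_fibre_bundle M E \<and> definable_fibre_bundle M E' \<and>
     fdim E = fdim E' \<and> fibre E = fibre E' \<and>
     definable_map M (tdim E) (total E) (tdim E') (total E') f \<and>
     definable_map M (bdim E) (base E) (bdim E') (base E') fb \<and>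
     (\<forall>b\<in>total E. proj E' (f b) = fb (proj E b)) \<and>
     (\<forall>x\<in>base E. homeomorphic_map (sub_top (tdim E) (total_over E {x}))
                    (sub_top (tdim E') (total_over E' {fb x})) f)"

definition definable_bundle_map ::
    "('a::real_closed_field, 'f, 'r) expansion \<Rightarrow> 'a fibre_bundle \<Rightarrow> 'a fibre_bundle \<Rightarrow>
     ((nat \<Rightarrow> 'a) \<Rightarrow> nat \<Rightarrow> 'a) \<Rightarrow> bool" where
  "definable_bundle_map M E E' f \<longleftrightarrow> (\<exists>fb. definable_bundle_map_over M E E' f fb)"

definition definable_bundle_iso ::
    "('a::real_closed_field, 'f, 'r) expansion \<Rightarrow> 'a fibre_bundle \<Rightarrow> 'a fibre_bundle \<Rightarrow>
     ((nat \<Rightarrow> 'a) \<Rightarrow> nat \<Rightarrow> 'a) \<Rightarrow> bool" where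
  "definable_bundle_iso M E E' f \<longleftrightarrow>
     definable_bundle_map M E E' f \<and>
     homeomorphic_map (sub_top (tdim E) (total E)) (sub_top (tdim E') (total E')) f"

definition isomorphic_bundles ::
    "('a::real_closed_field, 'f, 'r) expansion \<Rightarrow> 'a fibre_bundle \<Rightarrow> 'a fibre_bundle \<Rightarrow> bool" where
  "isomorphic_bundles M E E' \<longleftrightarrow> (\<exists>g. definable_bundle_iso M E E' g)"

definition induced_bundle ::
    "'a fibre_bundle \<Rightarrow> nat \<Rightarrow> (nat \<Rightarrow> 'a) set \<Rightarrow> ((nat \<Rightarrow> 'a) \<Rightarrow> nat \<Rightarrow> 'a) \<Rightarrow> 'a fibre_bundle" where
  "induced_bundle E' n Y h =
     \<lparr>tdim = tdim E' + n,
      total = {join (tdim E') x y | x y. x \<in> total E' \<and> y \<in> Y \<and> proj E' x = h y},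
      bdim = n,
      base = Y,
      proj = right_part (tdim E') n,
      fdim = fdim E',
      fibre = fibre E'\<rparr>"

definition induced_bundle_map :: "'a fibre_bundle \<Rightarrow> (nat \<Rightarrow> 'a) \<Rightarrow> nat \<Rightarrow> 'a" where
  "induced_bundle_map E' = left_part (tdim E')"

end

theory Submission
  imports Defs
begin

text \<open>
  The map \<open>g b = (f b, p b)\<close> is a continuous definable bijection onto the total space of the
  induced bundle, so everything rests on the continuity of its inverse. Locally, this says that for
  a continuous definable \<open>\<Phi> : W \<times> F \<rightarrow> F\<close> whose maps \<open>\<Phi> (x, _)\<close> are homeomorphisms of \<open>F\<close>, the
  inverses depend continuously on \<open>x\<close>. Suppose this fails at \<open>(x0, v0)\<close>, put \<open>w0 = \<Phi> (x0, v0)\<close>, and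
  choose definable curves \<open>x t \<rightarrow> x0\<close> and \<open>v t\<close> outside a small sphere around \<open>v0\<close> with
  \<open>w t = \<Phi> (x t, v t) \<rightarrow> w0\<close>; put \<open>u t = \<Phi> (x t, v0) \<rightarrow> w0\<close>. For fixed \<open>s\<close>, pulling back the curves
  \<open>u\<close> and \<open>w\<close> over \<open>[0, s]\<close> by \<open>\<Phi> (x s, _)\<close> joins \<open>v0\<close> to \<open>v s\<close>, so some \<open>b s\<close> on the sphere satisfies
  \<open>\<Phi> (x s, b s) \<in> {w r, u r}\<close> with \<open>r \<le> s\<close>. By local definable compactness \<open>b\<close> has a limit \<open>l\<close> on
  the sphere, and \<open>\<Phi> (x0, l) = w0\<close> contradicts injectivity.

  That definable curves are eventually continuous follows from two remarks on a definable
  \<open>h : (a, b) \<rightarrow> R\<close>: either \<open>h\<close> has finite image or its image contains arbitrarily short intervals,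
  whose infinite preimages contain intervals, so \<open>h\<close> oscillates arbitrarily little on subintervals; and
  by the same dichotomy a positive \<open>h\<close> is bounded away from \<open>0\<close> on a subinterval, which makes the
  oscillation at everywhere discontinuous points uniformly large.
\<close>

section \<open>Definable predicates\<close>

text \<open>\<open>F\<close> is not assumed definably connected, not even locally, so
  \<open>v0\<close> and \<open>v s\<close> cannot simply be joined inside \<open>F\<close>. The only
  connections at hand run through \<open>w0\<close>, from which both \<open>u\<close> and
  \<open>w\<close> start. They have to be pulled back at a fixed \<open>s\<close>: for each single
  point of the base the inverse of \<open>\<Phi> (x s, _)\<close> is known to be continuous, while
  its dependence on that point is exactly what is in question. No definability is assumed of this
  inverse either, so the side of the sphere on which a pulled back point lies is expressed by
  equations in \<Phi>. The parameter \<open>r\<close> of the crossing is never selected: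
  \<open>r \<le> s\<close> already forces \<open>w r\<close> and \<open>u r\<close> towards
  \<open>w0\<close> as \<open>s\<close> tends to 0. Local definable compactness keeps the crossing
  points from leaving \<open>F\<close> in the limit.

  The field may be non-archimedean and incomplete, so limits, infima and connectedness are only
  available for definable data. Hence every auxiliary object is produced by definable choice, and
  formulas are manipulated only in this section, to yield closure rules that follow the shape of a
  predicate.\<close>

primrec term_vars :: "'f fo_term \<Rightarrow> nat set" where
  "term_vars (Var i) = {i}"
| "term_vars (Add s t) = term_vars s \<union> term_vars t"
| "term_vars (Mul s t) = term_vars s \<union> term_vars t"
| "term_vars (App g ts) = \<Union> (set (map term_vars ts))"

text \<open>Bound variables are counted as well: a finite superset of the free variables is enough
  both for the locality of \<open>sat\<close> and for finding a fresh variable.\<close>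

primrec vars :: "('f, 'r) fo_formula \<Rightarrow> nat set" where
  "vars (Eq s t) = term_vars s \<union> term_vars t"
| "vars (Less s t) = term_vars s \<union> term_vars t"
| "vars (Rel r ts) = \<Union> (set (map term_vars ts))"
| "vars (Neg \<phi>) = vars \<phi>"
| "vars (Conj \<phi> \<psi>) = vars \<phi> \<union> vars \<psi>"
| "vars (Ex i \<phi>) = insert i (vars \<phi>)"

lemma finite_term_vars: "finite (term_vars t)"
  by (induction t) auto

lemma finite_vars: "finite (vars \<phi>)"
  by (induction \<phi>) (auto simp: finite_term_vars)

lemma term_val_cong: "(\<forall>i\<in>term_vars t. e i = e' i) \<Longrightarrow> term_val M e t = term_val M e' t"
proof (induction t)
  case (App g ts)
  have "map (term_val M e) ts = map (term_val M e') ts"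
  proof (rule map_cong[OF refl])
    fix t assume "t \<in> set ts"
    then show "term_val M e t = term_val M e' t"
      using App.prems by (intro App.IH) (simp_all add: ball_Un)
  qed
  then show ?case by (simp only: term_val.simps)
next
  case (Add s t)
  have "term_val M e s = term_val M e' s"
    using Add.prems by (intro Add.IH(1)) (simp add: ball_Un)
  moreover have "term_val M e t = term_val M e' t"
    using Add.prems by (intro Add.IH(2)) (simp add: ball_Un)
  ultimately show ?case by (simp only: term_val.simps)
next
  case (Mul s t)
  have "term_val M e s = term_val M e' s"
    using Mul.prems by (intro Mul.IH(1)) (simp add: ball_Un)
  moreover have "term_val M e t = term_val M e' t"
    using Mul.prems by (intro Mul.IH(2)) (simp add: ball_Un)
  ultimately show ?case by (simp only: term_val.simps)
qed simp

lemma sat_cong: "(\<forall>i\<in>vars \<phi>. e i = e' i) \<Longrightarrow> sat M e \<phi> \<longleftrightarrow> sat M e' \<phi>"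
proof (induction \<phi> arbitrary: e e')
  case (Eq s t)
  have "term_val M e s = term_val M e' s" "term_val M e t = term_val M e' t"
    using Eq.prems by (intro term_val_cong; simp)+
  then show ?case by simp
next
  case (Less s t)
  have "term_val M e s = term_val M e' s" "term_val M e t = term_val M e' t"
    using Less.prems by (intro term_val_cong; simp)+
  then show ?case by simp
next
  case (Rel r ts)
  have "term_val M e t = term_val M e' t" if "t \<in> set ts" for t
    using Rel.prems that by (intro term_val_cong) auto
  then have "map (term_val M e) ts = map (term_val M e') ts"
    by simp
  then show ?case by (simp only: sat.simps)
next
  case (Neg \<phi>)
  have "sat M e \<phi> = sat M e' \<phi>"
    using Neg.prems by (intro Neg.IH) simp
  then show ?case by simp
next
  case (Conj \<phi> \<psi>)
  have "sat M e \<phi> = sat M e' \<phi>" "sat M e \<psi> = sat M e' \<psi>"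
    using Conj.prems by (intro Conj.IH; simp)+
  then show ?case by simp
next
  case (Ex i \<phi>)
  have "sat M (e(i := a)) \<phi> = sat M (e'(i := a)) \<phi>" for a
    using Ex.prems by (intro Ex.IH) simp
  then show ?case by simp
qed

primrec rename_term :: "(nat \<Rightarrow> nat) \<Rightarrow> 'f fo_term \<Rightarrow> 'f fo_term" where
  "rename_term r (Var i) = Var (r i)"
| "rename_term r (Add s t) = Add (rename_term r s) (rename_term r t)"
| "rename_term r (Mul s t) = Mul (rename_term r s) (rename_term r t)"
| "rename_term r (App g ts) = App g (map (rename_term r) ts)"

lemma term_val_rename: "term_val M e (rename_term r t) = term_val M (\<lambda>i. e (r i)) t"
proof (induction t)
  case (App g ts)
  then have "map (\<lambda>t. term_val M e (rename_term r t)) ts = map (term_val M (\<lambda>i. e (r i))) ts"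
    by (intro map_cong refl)
  then show ?case by (simp only: term_val.simps rename_term.simps map_map o_def)
qed simp_all

text \<open>Since \<open>r\<close> need not be injective, a bound variable could capture others. It
  is therefore moved to \<open>k\<close>, which exceeds the image under \<open>r\<close> of every
  variable of the body.\<close>

primrec rename :: "(nat \<Rightarrow> nat) \<Rightarrow> ('f, 'r) fo_formula \<Rightarrow> ('f, 'r) fo_formula" where
  "rename r (Eq s t) = Eq (rename_term r s) (rename_term r t)"
| "rename r (Less s t) = Less (rename_term r s) (rename_term r t)"
| "rename r (Rel q ts) = Rel q (map (rename_term r) ts)"
| "rename r (Neg \<phi>) = Neg (rename r \<phi>)"
| "rename r (Conj \<phi> \<psi>) = Conj (rename r \<phi>) (rename r \<psi>)"
| "rename r (Ex i \<phi>) =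
     (let k = Suc (Max (insert 0 (r ` vars \<phi>))) in Ex k (rename (r(i := k)) \<phi>))"

lemma sat_rename: "sat M e (rename r \<phi>) \<longleftrightarrow> sat M (\<lambda>i. e (r i)) \<phi>"
proof (induction \<phi> arbitrary: e r)
  case (Rel q ts)
  show ?case by (simp add: o_def term_val_rename)
next
  case (Ex i \<phi>)
  define k where "k = Suc (Max (insert 0 (r ` vars \<phi>)))"
  have k: "r j \<noteq> k" if "j \<in> vars \<phi>" for j
  proof -
    have "r j \<le> Max (insert 0 (r ` vars \<phi>))"
      using that finite_vars by (intro Max_ge) auto
    then show ?thesis by (simp add: k_def)
  qed
  have "sat M (e(k := a)) (rename (r(i := k)) \<phi>) \<longleftrightarrow> sat M ((\<lambda>i. e (r i))(i := a)) \<phi>" for a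
    unfolding Ex.IH by (rule sat_cong) (auto simp: k)
  then show ?case by (simp only: sat.simps rename.simps Let_def flip: k_def)
qed (simp_all add: term_val_rename)

text \<open>
  Predicates on infinite environments \<open>s\<close>. Variables are treated as de Bruijn indices: a quantifier
  binds \<open>s 0\<close> and shifts the rest of the environment. Each variable of the formula is either an entry
  of the environment (\<open>Inl\<close>) or a parameter (\<open>Inr\<close>).
\<close>

definition dpred :: "('a::real_closed_field, 'f, 'r) expansion \<Rightarrow> ((nat \<Rightarrow> 'a) \<Rightarrow> bool) \<Rightarrow> bool" where
  "dpred M P \<longleftrightarrow> (\<exists>\<phi> v. \<forall>s. P s \<longleftrightarrow> sat M (case_sum s id \<circ> v) \<phi>)"

lemma dpredI: "(\<And>s. P s \<longleftrightarrow> sat M (case_sum s id \<circ> v) \<phi>) \<Longrightarrow> dpred M P"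
  unfolding dpred_def by blast

text \<open>The common source of reindexing, of constants and of passing to a section: each entry of
  the environment may be replaced by another entry or by a fixed field element.\<close>

lemma dpred_inst:
  assumes "dpred M P"
  shows "dpred M (\<lambda>s. P (\<lambda>i. case_sum s id (\<sigma> i)))"
proof -
  obtain \<phi> v where v: "\<And>s. P s \<longleftrightarrow> sat M (case_sum s id \<circ> v) \<phi>"
    using assms unfolding dpred_def by blast
  show ?thesis
  proof (rule dpredI)
    fix s :: "nat \<Rightarrow> 'a"
    have "case_sum (\<lambda>i. case_sum s id (\<sigma> i)) id \<circ> v = case_sum s id \<circ> (case_sum \<sigma> Inr \<circ> v)"
      by (auto simp: fun_eq_iff split: sum.splits)
    then show "P (\<lambda>i. case_sum s id (\<sigma> i)) \<longleftrightarrow> sat M (case_sum s id \<circ> (case_sum \<sigma> Inr \<circ> v)) \<phi>"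
      by (simp add: v)
  qed
qed

lemma dpred_reindex: "dpred M P \<Longrightarrow> dpred M (\<lambda>s. P (\<lambda>i. s (\<sigma> i)))"
  using dpred_inst[of M P "\<lambda>i. Inl (\<sigma> i)"] by simp

lemma dpred_not: "dpred M P \<Longrightarrow> dpred M (\<lambda>s. \<not> P s)"
  unfolding dpred_def by (metis sat.simps(4))

lemma dpred_conj:
  assumes "dpred M P" "dpred M Q"
  shows "dpred M (\<lambda>s. P s \<and> Q s)"
proof -
  obtain \<phi> v where v: "\<And>s. P s \<longleftrightarrow> sat M (case_sum s id \<circ> v) \<phi>"
    using assms unfolding dpred_def by blast
  obtain \<psi> u where u: "\<And>s. Q s \<longleftrightarrow> sat M (case_sum s id \<circ> u) \<psi>"
    using assms unfolding dpred_def by blast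
  \<comment> \<open>The two formulas come with unrelated variable assignments. Renaming them apart
    to even and odd variables lets one assignment serve both.\<close>
  define w where "w = (\<lambda>i. if even i then v (i div 2) else u (i div 2))"
  have "w (2 * i) = v i" "w (2 * i + 1) = u i" for i
    by (auto simp: w_def)
  then show ?thesis
    by (intro dpredI[of _ M w "Conj (rename (\<lambda>i. 2 * i) \<phi>) (rename (\<lambda>i. 2 * i + 1) \<psi>)"])
      (simp add: u v sat_rename o_def)
qed

lemma dpred_ex:
  assumes "dpred M (\<lambda>s. P (s 0) (\<lambda>i. s (Suc i)))"
  shows "dpred M (\<lambda>s. \<exists>a. P a s)"
proof -
  obtain \<phi> v where v: "\<And>s. P (s 0) (\<lambda>i. s (Suc i)) \<longleftrightarrow> sat M (case_sum s id \<circ> v) \<phi>"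
    using assms unfolding dpred_def by blast
  have v': "P a s \<longleftrightarrow> sat M (case_sum (case_nat a s) id \<circ> v) \<phi>" for a s
    using v[of "case_nat a s"] by simp
  \<comment> \<open>All variables that read the quantified entry collapse to 0, the variable bound
    by \<open>Ex 0\<close>; the others move up by one to stay clear of it. In \<open>u\<close> the
    index of an entry drops by one because the quantified entry has left the environment.\<close>
  define r where "r i = (if v i = Inl 0 then 0 else Suc i)" for i
  define u where "u j = (case v (j - 1) of Inl i \<Rightarrow> Inl (i - 1) | Inr b \<Rightarrow> Inr b)" for j
  have "(\<lambda>i. ((case_sum s id \<circ> u)(0 := a)) (r i)) = case_sum (case_nat a s) id \<circ> v" for s :: "nat \<Rightarrow> 'a" and a
    by (auto simp: fun_eq_iff r_def u_def split: sum.splits nat.splits)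
  then show ?thesis
    by (intro dpredI[of _ M u "Ex 0 (rename r \<phi>)"]) (simp add: sat_rename v' o_def)
qed

lemma dpred_disj: "dpred M P \<Longrightarrow> dpred M Q \<Longrightarrow> dpred M (\<lambda>s. P s \<or> Q s)"
  using dpred_not[OF dpred_conj[OF dpred_not[of M P] dpred_not[of M Q]]] by simp

lemma dpred_imp: "dpred M P \<Longrightarrow> dpred M Q \<Longrightarrow> dpred M (\<lambda>s. P s \<longrightarrow> Q s)"
  unfolding imp_conv_disj by (intro dpred_disj dpred_not)

lemma dpred_iff: "dpred M P \<Longrightarrow> dpred M Q \<Longrightarrow> dpred M (\<lambda>s. P s \<longleftrightarrow> Q s)"
  unfolding iff_conv_conj_imp by (intro dpred_conj dpred_imp)

lemma dpred_all:
  assumes "dpred M (\<lambda>s. P (s 0) (\<lambda>i. s (Suc i)))"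
  shows "dpred M (\<lambda>s. \<forall>a. P a s)"
  using dpred_not[OF dpred_ex[of M "\<lambda>a s. \<not> P a s", OF dpred_not[OF assms]]] by simp

lemma dpred_True: "dpred M (\<lambda>s. True)"
  by (rule dpredI[of _ M "\<lambda>_. Inl 0" "Eq (Var 0) (Var 0)"]) simp

lemma dpred_const: "dpred M (\<lambda>s. c)"
  by (cases c) (use dpred_True dpred_not[OF dpred_True] in auto)

lemma dpred_all_less: "(\<And>i. i < n \<Longrightarrow> dpred M (P i)) \<Longrightarrow> dpred M (\<lambda>s. \<forall>i<(n::nat). P i s)"
proof (induction n)
  case (Suc n)
  have "dpred M (\<lambda>s. P n s \<and> (\<forall>i<n. P i s))"
    by (intro dpred_conj Suc.IH Suc.prems) simp_all
  then show ?case by (simp only: All_less_Suc)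
qed (simp add: dpred_True)

section \<open>Definable functions of the environment\<close>

definition dfun :: "('a::real_closed_field, 'f, 'r) expansion \<Rightarrow> ((nat \<Rightarrow> 'a) \<Rightarrow> 'a) \<Rightarrow> bool" where
  "dfun M t \<longleftrightarrow> dpred M (\<lambda>s. s 0 = t (\<lambda>i. s (Suc i)))"

lemma dpred_eq_var: "dpred M (\<lambda>s. s i = s j)"
  by (rule dpredI[of _ M Inl "Eq (Var i) (Var j)"]) simp

lemma dpred_less_var: "dpred M (\<lambda>s. s i < s j)"
  by (rule dpredI[of _ M Inl "Less (Var i) (Var j)"]) simp

text \<open>The one-point rule: \<open>P (t s) s\<close> holds iff some \<open>a\<close> with
  \<open>a = t s\<close> satisfies \<open>P a s\<close>, so substitution costs one
  quantifier.\<close>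

lemma dpred_subst:
  assumes "dpred M (\<lambda>s. P (s 0) (\<lambda>i. s (Suc i)))" "dfun M t"
  shows "dpred M (\<lambda>s. P (t s) s)"
proof -
  have "dpred M (\<lambda>s. \<exists>a. a = t s \<and> P a s)"
    using assms by (intro dpred_ex dpred_conj) (simp_all add: dfun_def)
  then show ?thesis by simp
qed

lemma dfun_reindex: "dfun M t \<Longrightarrow> dfun M (\<lambda>s. t (\<lambda>i. s (\<sigma> i)))"
  unfolding dfun_def
  using dpred_reindex[of M "\<lambda>s. s 0 = t (\<lambda>i. s (Suc i))" "case_nat 0 (\<lambda>i. Suc (\<sigma> i))"] by simp

lemma dpred_subst2:
  assumes "dpred M (\<lambda>s. P (s 0) (s 1))" "dfun M t" "dfun M u"
  shows "dpred M (\<lambda>s. P (t s) (u s))"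
proof (rule dpred_subst[where P = "\<lambda>a s. P a (u s)", OF _ assms(2)])
  show "dpred M (\<lambda>s. P (s 0) (u (\<lambda>i. s (Suc i))))"
  proof (rule dpred_subst[where P = "\<lambda>a s. P (s 0) a", OF _ dfun_reindex[OF assms(3)]])
    show "dpred M (\<lambda>s. P (s (Suc 0)) (s 0))"
      using dpred_reindex[OF assms(1), of "\<lambda>i. if i = 0 then 1 else 0"] by simp
  qed
qed

lemma dpred_eq: "dfun M t \<Longrightarrow> dfun M u \<Longrightarrow> dpred M (\<lambda>s. t s = u s)"
  by (rule dpred_subst2[where P = "(=)", OF dpred_eq_var])

lemma dpred_less: "dfun M t \<Longrightarrow> dfun M u \<Longrightarrow> dpred M (\<lambda>s. t s < u s)"
  by (rule dpred_subst2[where P = "(<)", OF dpred_less_var])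

lemma dpred_le: "dfun M t \<Longrightarrow> dfun M u \<Longrightarrow> dpred M (\<lambda>s. t s \<le> u s)"
  by (subst linorder_not_less[symmetric]) (intro dpred_not dpred_less)

lemma dfun_subst2:
  assumes "dfun M (\<lambda>s. h (s 0) (s 1))" "dfun M t" "dfun M u"
  shows "dfun M (\<lambda>s. h (t s) (u s))"
proof -
  have "dpred M (\<lambda>s. \<exists>a. a = t (\<lambda>i. s (Suc i)) \<and> (\<exists>b. b = u (\<lambda>i. s (Suc i)) \<and> s 0 = h a b))"
  proof (intro dpred_ex dpred_conj)
    show "dpred M (\<lambda>s. s 0 = t (\<lambda>i. s (Suc (Suc i))))"
      using dfun_reindex[OF assms(2), of Suc] by (simp add: dfun_def)
    show "dpred M (\<lambda>s. s 0 = u (\<lambda>i. s (Suc (Suc (Suc i)))))"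
      using dfun_reindex[OF assms(3), of "\<lambda>i. Suc (Suc i)"] by (simp add: dfun_def)
    show "dpred M (\<lambda>s. s (Suc (Suc 0)) = h (s (Suc 0)) (s 0))"
      using dpred_reindex[OF assms(1)[unfolded dfun_def], of "case_nat 2 (case_nat 1 (\<lambda>_. 0))"]
      by (simp add: numeral_2_eq_2)
  qed
  then show ?thesis by (simp add: dfun_def)
qed

lemma dfun_var: "dfun M (\<lambda>s. s i)"
  by (simp add: dfun_def dpred_eq_var)

lemma dfun_const: "dfun M (\<lambda>s. c)"
  unfolding dfun_def
  using dpred_inst[OF dpred_eq_var, of M "case_nat (Inl 0) (\<lambda>_. Inr c)" 0 1] by simp

lemma dfun_add: "dfun M t \<Longrightarrow> dfun M u \<Longrightarrow> dfun M (\<lambda>s. t s + u s)"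
  by (rule dfun_subst2[where h = "(+)"])
    (auto simp: dfun_def numeral_2_eq_2 intro!: dpredI[of _ M Inl "Eq (Var 0) (Add (Var 1) (Var 2))"])

lemma dfun_mult: "dfun M t \<Longrightarrow> dfun M u \<Longrightarrow> dfun M (\<lambda>s. t s * u s)"
  by (rule dfun_subst2[where h = "(*)"])
    (auto simp: dfun_def numeral_2_eq_2 intro!: dpredI[of _ M Inl "Eq (Var 0) (Mul (Var 1) (Var 2))"])

lemma dfun_uminus: "dfun M t \<Longrightarrow> dfun M (\<lambda>s. - t s)"
  using dfun_mult[OF dfun_const[of M "-1"], of t] by simp

lemma dfun_diff: "dfun M t \<Longrightarrow> dfun M u \<Longrightarrow> dfun M (\<lambda>s. t s - u s)"
  using dfun_add[of M t "\<lambda>s. - u s"] dfun_uminus[of M u] by simp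

lemma dfun_if:
  assumes "dpred M P" "dfun M t" "dfun M u"
  shows "dfun M (\<lambda>s. if P s then t s else u s)"
proof -
  have "dpred M (\<lambda>s. (P (\<lambda>i. s (Suc i)) \<and> s 0 = t (\<lambda>i. s (Suc i))) \<or>
    (\<not> P (\<lambda>i. s (Suc i)) \<and> s 0 = u (\<lambda>i. s (Suc i))))"
    using assms dpred_reindex[OF assms(1), of Suc] unfolding dfun_def
    by (intro dpred_disj dpred_conj dpred_not)
  then show ?thesis unfolding dfun_def
    by (elim back_subst[where P = "dpred M"]) (auto simp: fun_eq_iff)
qed

lemma dfun_abs: "dfun M t \<Longrightarrow> dfun M (\<lambda>s. \<bar>t s\<bar>)"
  unfolding abs_if by (intro dfun_if dpred_less dfun_uminus dfun_const)

text \<open>The value 0 outside the case of unique existence makes this operator definable in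
  parameters; the unspecified value of a bare \<open>THE\<close> could depend on the predicate in
  any way.\<close>

definition unique_elem :: "('a::zero \<Rightarrow> bool) \<Rightarrow> 'a" where
  "unique_elem P = (if \<exists>!a. P a then THE a. P a else 0)"

lemma unique_elemI: "\<exists>!a. P a \<Longrightarrow> P (unique_elem P)"
  unfolding unique_elem_def by (simp add: theI')

lemma unique_elem_eq: "\<exists>!a. P a \<Longrightarrow> P b \<Longrightarrow> unique_elem P = b"
  unfolding unique_elem_def by (simp add: the1_equality)

lemma dfun_unique_elem:
  assumes "dpred M (\<lambda>s. P (s 0) (\<lambda>i. s (Suc i)))"
  shows "dfun M (\<lambda>s. unique_elem (\<lambda>a. P a s))"
proof -
  let ?sh = "\<lambda>s i. s (Suc i)"
  have r: "dpred M (\<lambda>s. P (s j) (\<lambda>i. s (k + i)))" for j k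
    using dpred_reindex[OF assms, of "case_nat j (\<lambda>i. k + i)"] by simp
  have "dpred M (\<lambda>s. ((\<exists>a. P a (?sh s) \<and> (\<forall>b. P b (?sh s) \<longrightarrow> b = a)) \<and> P (s 0) (?sh s)) \<or>
          (\<not> (\<exists>a. P a (?sh s) \<and> (\<forall>b. P b (?sh s) \<longrightarrow> b = a)) \<and> s 0 = 0))"
    using r[of 0 1] r[of 0 2] r[of 0 3]
    by (intro dpred_disj dpred_conj dpred_not dpred_ex dpred_all dpred_imp dpred_eq dfun_var dfun_const)
      (simp_all add: numeral_2_eq_2 numeral_3_eq_3)
  moreover have "s 0 = unique_elem (\<lambda>a. P a (?sh s)) \<longleftrightarrow>
     ((\<exists>a. P a (?sh s) \<and> (\<forall>b. P b (?sh s) \<longrightarrow> b = a)) \<and> P (s 0) (?sh s)) \<or>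
     (\<not> (\<exists>a. P a (?sh s) \<and> (\<forall>b. P b (?sh s) \<longrightarrow> b = a)) \<and> s 0 = 0)" for s
  proof (cases "\<exists>!a. P a (?sh s)")
    case True
    have "s 0 = unique_elem (\<lambda>a. P a (?sh s)) \<longleftrightarrow> P (s 0) (?sh s)"
      using unique_elemI[OF True] unique_elem_eq[OF True, of "s 0"] by auto
    with True show ?thesis by (simp only: Ex1_def[symmetric] simp_thms)
  next
    case False
    then show ?thesis by (simp only: unique_elem_def Ex1_def[symmetric] simp_thms if_False)
  qed
  ultimately show ?thesis unfolding dfun_def by simp
qed

section \<open>Quantifiers and terms ranging over points of \<open>R^n\<close>\<close>

lemma dpred_ex_vars:
  assumes "dpred M (\<lambda>s. P (\<lambda>i\<in>{..<n}. s i) (\<lambda>i. s (n + i)))"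
  shows "dpred M (\<lambda>s. \<exists>y\<in>cart_space n. P y s)"
proof -
  \<comment> \<open>Induction on the number \<open>k\<close> of coordinates already quantified; the
    other \<open>n - k\<close> still sit at the front of the environment.\<close>
  have "dpred M (\<lambda>s. \<exists>y\<in>cart_space k. P (\<lambda>i\<in>{..<n}. if i < k then y i else s (i - k)) (\<lambda>i. s (n - k + i)))"
    if "k \<le> n" for k
    using that
  proof (induction k)
    case 0
    have "cart_space 0 = {\<lambda>_. undefined :: 'a}" by (simp add: cart_space_def)
    then show ?case using assms by (simp add: restrict_def)
  next
    case (Suc k)
    have eq: "(\<exists>y\<in>cart_space (Suc k). Q y) \<longleftrightarrow> (\<exists>a. \<exists>y\<in>cart_space k. Q (y(k := a)))" (is "?L = ?R") for Q :: "(nat \<Rightarrow> 'a) \<Rightarrow> bool"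
    proof
      assume ?L
      then obtain y where y: "y \<in> cart_space (Suc k)" "Q y" by blast
      have "y(k := undefined) \<in> cart_space k" "(y(k := undefined))(k := y k) = y"
        using y by (auto simp: cart_space_def PiE_def extensional_def)
      with y show ?R by metis
    next
      assume ?R
      then obtain a y where y: "y \<in> cart_space k" "Q (y(k := a))" by blast
      then have "y(k := a) \<in> cart_space (Suc k)"
        by (simp add: cart_space_def PiE_def extensional_def)
      with y show ?L by blast
    qed
    have "dpred M (\<lambda>s. \<exists>a. \<exists>y\<in>cart_space k.
       P (\<lambda>i\<in>{..<n}. if i < k then y i else if i = k then a else s (i - Suc k)) (\<lambda>i. s (n - Suc k + i)))"
    proof (rule dpred_ex)
      have *: "(\<lambda>i\<in>{..<n}. if i < k then y i else if i = k then s 0 else s (Suc (i - Suc k)))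
         = (\<lambda>i\<in>{..<n}. if i < k then y i else s (i - k))" for y s :: "nat \<Rightarrow> 'a"
        by (auto simp: restrict_def fun_eq_iff Suc_diff_Suc)
      have **: "Suc (n - Suc k + i) = n - k + i" for i
        using Suc.prems by simp
      show "dpred M (\<lambda>s. \<exists>y\<in>cart_space k. P (\<lambda>i\<in>{..<n}. if i < k then y i else if i = k then s 0 else s (Suc (i - Suc k))) (\<lambda>i. s (Suc (n - Suc k + i))))"
        unfolding * ** using Suc.prems by (intro Suc.IH) simp
    qed
    also have "(\<lambda>s. \<exists>a. \<exists>y\<in>cart_space k.
       P (\<lambda>i\<in>{..<n}. if i < k then y i else if i = k then a else s (i - Suc k)) (\<lambda>i. s (n - Suc k + i)))
      = (\<lambda>s. \<exists>y\<in>cart_space (Suc k). P (\<lambda>i\<in>{..<n}. if i < Suc k then y i else s (i - Suc k)) (\<lambda>i. s (n - Suc k + i)))"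
    proof -
      have "(\<lambda>i\<in>{..<n}. if i < k then y i else if i = k then a else s (i - Suc k)) = (\<lambda>i\<in>{..<n}. if i < Suc k then (y(k := a)) i else s (i - Suc k))" for y s :: "nat \<Rightarrow> 'a" and a
        by (auto simp: restrict_def fun_eq_iff)
      then show ?thesis by (simp only: eq)
    qed
    finally show ?case .
  qed
  from this[of n] have "dpred M (\<lambda>s. \<exists>y\<in>cart_space n. P (\<lambda>i\<in>{..<n}. if i < n then y i else s (i - n)) s)"
    by (simp add: restrict_def)
  moreover have "(\<lambda>i\<in>{..<n}. if i < n then y i else s (i - n)) = y" if "y \<in> cart_space n" for s y :: "nat \<Rightarrow> 'a"
    using that by (auto simp: fun_eq_iff cart_space_def PiE_def extensional_def restrict_def)
  ultimately show ?thesis by (simp only: cong: bex_cong)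
qed

lemma definable_imp_dpred:
  assumes "definable M n A"
  shows "dpred M (\<lambda>s. (\<lambda>i\<in>{..<n}. s i) \<in> A)"
proof -
  obtain \<phi> e where A: "A = {x \<in> cart_space n. sat M (\<lambda>i. if i < n then x i else e i) \<phi>}"
    using assms unfolding definable_def by blast
  have "case_sum s id \<circ> (\<lambda>i. if i < n then Inl i else Inr (e i)) =
      (\<lambda>i. if i < n then (\<lambda>i\<in>{..<n}. s i) i else e i)" for s
    by auto
  then show ?thesis
    by (intro dpredI[of _ M "\<lambda>i. if i < n then Inl i else Inr (e i)" \<phi>])
      (simp add: A cart_space_def)
qed

lemma dpred_imp_definable:
  assumes "dpred M (\<lambda>s. P (\<lambda>i\<in>{..<n}. s i))"
  shows "definable M n {x \<in> cart_space n. P x}"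
proof -
  obtain \<phi> v where v: "\<And>s. P (\<lambda>i\<in>{..<n}. s i) \<longleftrightarrow> sat M (case_sum s id \<circ> v) \<phi>"
    using assms unfolding dpred_def by blast
  \<comment> \<open>Variables that read a coordinate \<open>j < n\<close> become \<open>j\<close>;
    all others go to \<open>n + i\<close>, where the assignment \<open>e\<close> supplies the
    parameter. An entry with index at least \<open>n\<close> gets \<open>undefined\<close>, which is
    its true value, as points are extensional.\<close>
  define r where "r i = (case v i of Inl j \<Rightarrow> if j < n then j else n + i | Inr _ \<Rightarrow> n + i)" for i
  define e where "e k = (case v (k - n) of Inl _ \<Rightarrow> undefined | Inr a \<Rightarrow> a)" for k
  have "P x \<longleftrightarrow> sat M (\<lambda>i. if i < n then x i else e i) (rename r \<phi>)" if "x \<in> cart_space n" for x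
  proof -
    have x: "x = (\<lambda>i\<in>{..<n}. x i)" "\<And>i. i \<ge> n \<Longrightarrow> x i = undefined"
      using that by (auto simp: cart_space_def PiE_def extensional_def)
    have "(\<lambda>j. (\<lambda>i. if i < n then x i else e i) (r j)) = case_sum x id \<circ> v"
      by (auto simp: fun_eq_iff r_def e_def x(2) split: sum.splits)
    then show ?thesis using v[of x] x(1) by (simp add: sat_rename)
  qed
  then show ?thesis unfolding definable_def by blast
qed

text \<open>Membership in \<open>cart_space n\<close> is demanded for every environment so that the
  \<open>n\<close> coordinates determine the value.\<close>

definition dpoint ::
    "('a::real_closed_field, 'f, 'r) expansion \<Rightarrow> nat \<Rightarrow> ((nat \<Rightarrow> 'a) \<Rightarrow> nat \<Rightarrow> 'a) \<Rightarrow> bool" where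
  "dpoint M n t \<longleftrightarrow> (\<forall>s. t s \<in> cart_space n) \<and> (\<forall>i<n. dfun M (\<lambda>s. t s i))"

lemma dpointI:
  "(\<And>s. t s \<in> cart_space n) \<Longrightarrow> (\<And>i. i < n \<Longrightarrow> dfun M (\<lambda>s. t s i)) \<Longrightarrow> dpoint M n t"
  by (simp add: dpoint_def)

lemma dpoint_dfun: "dpoint M n t \<Longrightarrow> i < n \<Longrightarrow> dfun M (\<lambda>s. t s i)"
  by (simp add: dpoint_def)

lemma restrict_in_cart_space: "(\<lambda>i\<in>{..<n}. f i) \<in> cart_space n"
  by (simp add: cart_space_def)

lemma cart_space_ext: "x \<in> cart_space n \<Longrightarrow> y \<in> cart_space n \<Longrightarrow> (\<And>i. i < n \<Longrightarrow> x i = y i) \<Longrightarrow> x = y"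
  unfolding cart_space_def by (rule PiE_ext) auto

lemma dpoint_const: "c \<in> cart_space n \<Longrightarrow> dpoint M n (\<lambda>s. c)"
  by (rule dpointI) (simp_all add: dfun_const)

lemma dpoint_reindex: "dpoint M n t \<Longrightarrow> dpoint M n (\<lambda>s. t (\<lambda>i. s (\<sigma> i)))"
  unfolding dpoint_def using dfun_reindex[of M "\<lambda>s. t s _" \<sigma>] by blast

lemma dpred_subst_point:
  assumes "dpred M (\<lambda>s. P (\<lambda>i\<in>{..<n}. s i) (\<lambda>i. s (n + i)))" "dpoint M n t"
  shows "dpred M (\<lambda>s. P (t s) s)"
proof -
  have "dpred M (\<lambda>s. (\<lambda>i\<in>{..<n}. s i) i = t (\<lambda>i. s (n + i)) i)" if "i < n" for i
    using that dpred_eq[OF dfun_var dpoint_dfun[OF dpoint_reindex[OF assms(2)] that], of i] by simp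
  then have "dpred M (\<lambda>s. \<exists>y\<in>cart_space n. (\<forall>i<n. y i = t s i) \<and> P y s)"
    by (intro dpred_ex_vars dpred_conj dpred_all_less assms(1))
  moreover have "(\<exists>y\<in>cart_space n. (\<forall>i<n. y i = t s i) \<and> P y s) \<longleftrightarrow> P (t s) s" for s
  proof -
    have "t s \<in> cart_space n" using assms(2) by (simp add: dpoint_def)
    moreover have "y = t s" if "y \<in> cart_space n" "\<forall>i<n. y i = t s i" for y
      using that calculation by (intro cart_space_ext) auto
    ultimately show ?thesis by blast
  qed
  ultimately show ?thesis by simp
qed

lemma dfun_subst_point:
  assumes "dfun M (\<lambda>s. h (\<lambda>i\<in>{..<n}. s i))" "dpoint M n t"
  shows "dfun M (\<lambda>s. h (t s))"
  unfolding dfun_def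
proof (rule dpred_subst_point[where P = "\<lambda>y s. s 0 = h y", OF _ dpoint_reindex[OF assms(2)]])
  show "dpred M (\<lambda>s. s (n + 0) = h (\<lambda>i\<in>{..<n}. s i))"
    by (intro dpred_eq dfun_var assms)
qed

lemma dpred_mem: "definable M n A \<Longrightarrow> dpoint M n t \<Longrightarrow> dpred M (\<lambda>s. t s \<in> A)"
  by (rule dpred_subst_point[where P = "\<lambda>y s. y \<in> A", OF definable_imp_dpred])

definition dmap ::
    "('a::real_closed_field, 'f, 'r) expansion \<Rightarrow> nat \<Rightarrow> nat \<Rightarrow> ((nat \<Rightarrow> 'a) \<Rightarrow> nat \<Rightarrow> 'a) \<Rightarrow> bool" where
  "dmap M m n g \<longleftrightarrow> dpoint M n (\<lambda>s. g (\<lambda>i\<in>{..<m}. s i))"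

lemma dpoint_dmap:
  assumes "dmap M m n g" "dpoint M m t"
  shows "dpoint M n (\<lambda>s. g (t s))"
proof (rule dpointI)
  fix s
  have "(\<lambda>i\<in>{..<m}. t s i) = t s"
    using assms(2) by (intro cart_space_ext[of _ m] restrict_in_cart_space) (auto simp: dpoint_def)
  moreover have "g (\<lambda>i\<in>{..<m}. t s i) \<in> cart_space n"
    using assms(1) by (auto simp: dmap_def dpoint_def)
  ultimately show "g (t s) \<in> cart_space n" by simp
next
  fix i assume "i < n"
  then show "dfun M (\<lambda>s. g (t s) i)"
    using assms by (intro dfun_subst_point[where h = "\<lambda>y. g y i", OF _ assms(2)])
      (simp add: dmap_def dpoint_def)
qed

section \<open>One-dimensional consequences of o-minimality\<close>

lemma o_minimal_interval_union:
  assumes "o_minimal M" "dpred M (\<lambda>s. Q (s 0))"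
  obtains \<C> where "finite \<C>" "{t. Q t} = \<Union>\<C>"
    "\<And>I. I \<in> \<C> \<Longrightarrow> I = UNIV \<or> (\<exists>a b. I = {a} \<or> I = {a<..<b} \<or> I = {a<..} \<or> I = {..<b})"
proof -
  have "definable M 1 {x \<in> cart_space 1. Q (x 0)}"
    using assms(2) by (intro dpred_imp_definable) simp
  moreover have "(\<lambda>x. x 0) ` {x \<in> cart_space 1. Q (x 0)} = {t. Q t}"
  proof safe
    fix t assume "Q t"
    then have "(\<lambda>i\<in>{..<1}. t) \<in> {x \<in> cart_space 1. Q (x 0)}"
      by (simp add: restrict_in_cart_space)
    then show "t \<in> (\<lambda>x. x 0) ` {x \<in> cart_space 1. Q (x 0)}"
      by (rule rev_image_eqI) simp
  qed
  ultimately have "\<exists>\<C>. finite \<C> \<and> {t. Q t} = \<Union>\<C> \<and> (\<forall>I\<in>\<C>. I = UNIV \<or>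
      (\<exists>a b. I = {a} \<or> I = {a<..<b} \<or> I = {a<..} \<or> I = {..<b}))"
    using assms(1)[unfolded o_minimal_def, rule_format, of "{x \<in> cart_space 1. Q (x 0)}"] by simp
  then show ?thesis by (elim exE conjE) (rule that, assumption+, erule bspec)
qed

text \<open>Every interval or singleton either contains or misses some right neighbourhood of
  \<open>a\<close>, and this alternative survives finite unions.\<close>

lemma o_minimal_germ:
  fixes a :: "'a::real_closed_field"
  assumes "o_minimal M" "dpred M (\<lambda>s. Q (s 0))"
  obtains b where "a < b" "(\<forall>t. a < t \<and> t < b \<longrightarrow> Q t) \<or> (\<forall>t. a < t \<and> t < b \<longrightarrow> \<not> Q t)"
proof -
  obtain \<C> where \<C>: "finite \<C>" "{t. Q t} = \<Union>\<C>"
    "\<And>I. I \<in> \<C> \<Longrightarrow> I = UNIV \<or> (\<exists>c d. I = {c} \<or> I = {c<..<d} \<or> I = {c<..} \<or> I = {..<d})"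
    by (rule o_minimal_interval_union[OF assms]) blast
  define G where "G I \<longleftrightarrow> (\<exists>b>a. {a<..<b} \<subseteq> I \<or> {a<..<b} \<inter> I = {})" for I :: "'a set"
  have G: "G I" if I: "I \<in> \<C>" for I
  proof -
    have 1: "G {c}" for c
    proof (cases "a < c")
      case True
      then show ?thesis unfolding G_def by (intro exI[of _ c]) auto
    next
      case False
      then show ?thesis using gt_ex[of a] unfolding G_def by auto
    qed
    have 2: "G {c<..}" for c
    proof (cases "a < c")
      case True
      then show ?thesis unfolding G_def by (intro exI[of _ c]) auto
    next
      case False
      then show ?thesis using gt_ex[of a] unfolding G_def by auto
    qed
    have 3: "G {..<d}" for d
    proof (cases "a < d")
      case True
      then show ?thesis unfolding G_def by (intro exI[of _ d]) auto
    next
      case False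
      then show ?thesis using gt_ex[of a] unfolding G_def by auto
    qed
    have 4: "G {c<..<d}" for c d
    proof -
      obtain b1 b2 where "b1 > a" "b2 > a" "{a<..<b1} \<subseteq> {c<..} \<or> {a<..<b1} \<inter> {c<..} = {}"
        "{a<..<b2} \<subseteq> {..<d} \<or> {a<..<b2} \<inter> {..<d} = {}"
        using 2[of c] 3[of d] unfolding G_def by blast
      moreover have "{a<..<min b1 b2} \<subseteq> {a<..<b1}" "{a<..<min b1 b2} \<subseteq> {a<..<b2}" by auto
      ultimately have "{a<..<min b1 b2} \<subseteq> {c<..} \<inter> {..<d} \<or> {a<..<min b1 b2} \<inter> ({c<..} \<inter> {..<d}) = {}"
        "min b1 b2 > a" by (blast, simp)
      then show ?thesis unfolding G_def greaterThanLessThan_def[of c d] by blast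
    qed
    have 5: "G UNIV" using gt_ex[of a] unfolding G_def by auto
    show ?thesis using \<C>(3)[OF I] 1 2 3 4 5 by blast
  qed
  have "G (\<Union>\<D>)" if "finite \<D>" "\<D> \<subseteq> \<C>" for \<D>
    using that
  proof (induction rule: finite_induct)
    case empty
    then show ?case using gt_ex[of a] unfolding G_def by auto
  next
    case (insert I \<D>)
    have "G I" "G (\<Union>\<D>)" using insert G by auto
    then obtain b1 b2 where b: "b1 > a" "b2 > a"
      "{a<..<b1} \<subseteq> I \<or> {a<..<b1} \<inter> I = {}"
      "{a<..<b2} \<subseteq> \<Union>\<D> \<or> {a<..<b2} \<inter> \<Union>\<D> = {}"
      unfolding G_def by (elim exE conjE) (rule that)
    define J where "J = {a<..<min b1 b2}"
    have "J \<subseteq> {a<..<b1}" "J \<subseteq> {a<..<b2}" by (auto simp: J_def)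
    then have "J \<subseteq> I \<or> J \<inter> I = {}" "J \<subseteq> \<Union>\<D> \<or> J \<inter> \<Union>\<D> = {}"
      using b(3,4) by fast+
    then have "J \<subseteq> I \<union> \<Union>\<D> \<or> J \<inter> (I \<union> \<Union>\<D>) = {}"
      unfolding Int_Un_distrib by fast
    then show ?case using b(1,2) unfolding G_def J_def Union_insert
      by (intro exI[of _ "min b1 b2"]) simp
  qed
  from this[OF \<C>(1) order_refl] obtain b where
    "a < b" "{a<..<b} \<subseteq> {t. Q t} \<or> {a<..<b} \<inter> {t. Q t} = {}"
    unfolding G_def \<C>(2)[symmetric] by blast
  then show ?thesis by (intro that[of b]) auto
qed

text \<open>One of the finitely many pieces must be infinite, and an infinite piece of the permitted
  shapes contains an open interval.\<close>

lemma o_minimal_infinite: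
  fixes Q :: "'a::real_closed_field \<Rightarrow> bool"
  assumes "o_minimal M" "dpred M (\<lambda>s. Q (s 0))" "infinite {t. Q t}"
  obtains a b where "a < b" "\<And>t. a < t \<Longrightarrow> t < b \<Longrightarrow> Q t"
proof -
  obtain \<C> where \<C>: "finite \<C>" "{t. Q t} = \<Union>\<C>"
    "\<And>I. I \<in> \<C> \<Longrightarrow> I = UNIV \<or> (\<exists>c d. I = {c} \<or> I = {c<..<d} \<or> I = {c<..} \<or> I = {..<d})"
    by (rule o_minimal_interval_union[OF assms(1,2)]) blast
  obtain I where I: "I \<in> \<C>" "infinite I"
    using assms(3) \<C>(1) unfolding \<C>(2) by blast
  have sub: "I \<subseteq> {t. Q t}" using I \<C>(2) by auto
  have "\<exists>a b. a < b \<and> {a<..<b} \<subseteq> I"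
  proof -
    have 2: "\<exists>a b. a < b \<and> {a<..<b} \<subseteq> {c<..}" for c :: 'a
    proof -
      obtain b where "c < b" using gt_ex by blast
      then show ?thesis by (intro exI[of _ c] exI[of _ b]) auto
    qed
    have 3: "\<exists>a b. a < b \<and> {a<..<b} \<subseteq> {..<d}" for d :: 'a
    proof -
      obtain a where "a < d" using lt_ex by blast
      then show ?thesis by (intro exI[of _ a] exI[of _ d]) auto
    qed
    consider "I = UNIV" | c where "I = {c}" | c d where "I = {c<..<d}" | c where "I = {c<..}"
      | d where "I = {..<d}"
      using \<C>(3)[OF I(1)] by blast
    then show ?thesis
    proof cases
      case 1
      then show ?thesis using 2[of 0] by auto
    next
      case (3 c d)
      moreover have "c < d" using 3 I(2) by (cases "c < d") auto
      ultimately show ?thesis by blast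
    qed (use I(2) 2 3 in auto)
  qed
  then show ?thesis using that sub by (metis greaterThanLessThan_iff mem_Collect_eq subsetD)
qed

definition is_glb :: "('a::order \<Rightarrow> bool) \<Rightarrow> 'a \<Rightarrow> bool" where
  "is_glb Q g \<longleftrightarrow> (\<forall>t. Q t \<longrightarrow> g \<le> t) \<and> (\<forall>b. (\<forall>t. Q t \<longrightarrow> b \<le> t) \<longrightarrow> b \<le> g)"

text \<open>Definable completeness, in place of completeness of the field: a nonempty piece has its
  left end as infimum, and a finite union the least of these. Uniqueness is included for use with
  \<open>unique_elem\<close>.\<close>

lemma o_minimal_glb:
  fixes Q :: "'a::real_closed_field \<Rightarrow> bool"
  assumes "o_minimal M" "dpred M (\<lambda>s. Q (s 0))" "\<exists>t. Q t" "\<forall>t. Q t \<longrightarrow> l \<le> t"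
  shows "\<exists>!g. is_glb Q g"
proof -
  obtain \<C> where \<C>: "finite \<C>" "{t. Q t} = \<Union>\<C>"
    "\<And>I. I \<in> \<C> \<Longrightarrow> I = UNIV \<or> (\<exists>c d. I = {c} \<or> I = {c<..<d} \<or> I = {c<..} \<or> I = {..<d})"
    by (rule o_minimal_interval_union[OF assms(1,2)]) blast
  have lb: "l \<le> t" if "t \<in> I" "I \<in> \<C>" for t I
    using that \<C>(2) assms(4) by blast
  have one: "\<exists>g. is_glb (\<lambda>t. t \<in> I) g" if I: "I \<in> \<C>" "I \<noteq> {}" for I
  proof -
    have 1: "is_glb (\<lambda>t. t \<in> {c}) c" for c :: 'a
      unfolding is_glb_def by auto
    have 2: "is_glb (\<lambda>t. t \<in> {c<..}) c" for c :: 'a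
      unfolding is_glb_def by (auto intro: dense_ge)
    have 4: "is_glb (\<lambda>t. t \<in> {c<..<d}) c" if "c < d" for c d :: 'a
      using that unfolding is_glb_def by (auto intro: dense_ge_bounded)
    have "\<exists>t<l. t < d" for d
      using lt_ex[of "min l d"] by auto
    then have "I \<noteq> {..<d}" for d
      using lb[OF _ I(1)] by (metis lessThan_iff linorder_not_le)
    moreover have "I \<noteq> UNIV"
      using lb[OF _ I(1)] lt_ex[of l] by (metis UNIV_I linorder_not_le)
    ultimately show ?thesis
      using \<C>(3)[OF I(1)] I(2) 1 2 4 by (metis greaterThanLessThan_empty_iff linorder_not_le)
  qed
  have "\<exists>g. is_glb (\<lambda>t. t \<in> \<Union>\<D>) g" if "finite \<D>" "\<D> \<subseteq> \<C>" "\<Union>\<D> \<noteq> {}" for \<D>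
    using that
  proof (induction rule: finite_induct)
    case (insert I \<D>)
    consider "I = {}" | "\<Union>\<D> = {}" | "I \<noteq> {}" "\<Union>\<D> \<noteq> {}" by blast
    then show ?case
    proof cases
      case 1
      then show ?thesis using insert by auto
    next
      case 2
      have "I \<in> \<C>" "I \<noteq> {}" using insert 2 by auto
      then show ?thesis using one 2 by (simp only: Union_insert Un_empty_right)
    next
      case 3
      then obtain g h where "is_glb (\<lambda>t. t \<in> I) g" "is_glb (\<lambda>t. t \<in> \<Union>\<D>) h"
        using insert one by (metis insert_subset)
      then have "is_glb (\<lambda>t. t \<in> \<Union>(insert I \<D>)) (min g h)"
        unfolding is_glb_def by (auto simp: min_le_iff_disj)
      then show ?thesis by blast
    qed
  qed simp
  from this[OF \<C>(1) order_refl] have "\<exists>g. is_glb (\<lambda>t. t \<in> {t. Q t}) g"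
    using assms(3) unfolding \<C>(2)[symmetric] by blast
  moreover have "g = h" if "is_glb Q g" "is_glb Q h" for g h
    using that unfolding is_glb_def by (meson order_antisym)
  ultimately show ?thesis by auto
qed

text \<open>Let \<open>c\<close> be the infimum of the points where \<open>Q\<close> differs from
  its value at \<open>a\<close>. If \<open>Q\<close> differs at \<open>c\<close>, it also differs
  slightly to the left of \<open>c\<close>; if not, these points keep a distance \<delta> from
  \<open>c\<close>. Both contradict the choice of \<open>c\<close>.\<close>

lemma o_minimal_connected:
  fixes a b :: "'a::real_closed_field"
  assumes "o_minimal M" "dpred M (\<lambda>s. Q (s 0))" "a \<le> b"
    and loc: "\<And>t. a \<le> t \<Longrightarrow> t \<le> b \<Longrightarrow>
      \<exists>\<delta>>0. \<forall>u. a \<le> u \<and> u \<le> b \<and> \<bar>u - t\<bar> < \<delta> \<longrightarrow> (Q u \<longleftrightarrow> Q t)"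
  shows "Q a \<longleftrightarrow> Q b"
proof (rule ccontr)
  assume neq: "Q a \<noteq> Q b"
  define S where "S t \<longleftrightarrow> a \<le> t \<and> t \<le> b \<and> \<not> (Q t \<longleftrightarrow> Q a)" for t
  have "dpred M (\<lambda>s. S (s 0))"
    unfolding S_def
    by (intro dpred_conj dpred_not dpred_iff dpred_le dfun_var dfun_const dpred_const assms)
  moreover have "S b" using neq assms(3) by (auto simp: S_def)
  ultimately obtain c where c: "is_glb S c"
    using o_minimal_glb[OF assms(1), of S a] S_def by blast
  have ac: "a \<le> c" "c \<le> b"
    using c \<open>S b\<close> unfolding is_glb_def by (auto simp: S_def)
  then obtain \<delta> where \<delta>: "\<delta> > 0" "\<And>u. a \<le> u \<Longrightarrow> u \<le> b \<Longrightarrow> \<bar>u - c\<bar> < \<delta> \<Longrightarrow> Q u \<longleftrightarrow> Q c"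
    using loc by blast
  show False
  proof (cases "Q c \<longleftrightarrow> Q a")
    case False
    then have "c \<noteq> a" by blast
    then have "max a (c - \<delta>) < c" using ac \<delta>(1) by simp
    then obtain u where u: "max a (c - \<delta>) < u" "u < c" using dense by blast
    then have "\<bar>u - c\<bar> < \<delta>" by (auto simp: abs_less_iff algebra_simps)
    then have "S u" using \<delta>(2)[of u] u ac False by (auto simp: S_def)
    then show False using c u unfolding is_glb_def by force
  next
    case True
    have "c + \<delta> \<le> u" if "S u" for u
    proof (rule ccontr)
      assume "\<not> c + \<delta> \<le> u"
      moreover have "c \<le> u" using c that unfolding is_glb_def by blast
      ultimately have "\<bar>u - c\<bar> < \<delta>" by (auto simp: abs_less_iff algebra_simps)
      then show False using \<delta>(2)[of u] that True by (auto simp: S_def)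
    qed
    then have "c + \<delta> \<le> c" using c unfolding is_glb_def by blast
    then show False using \<delta>(1) by simp
  qed
qed

section \<open>Definable choice\<close>

lemma dpred_at:
  assumes "dpred M (\<lambda>s. P (s 0) (\<lambda>i. s (Suc i)))" "dfun M t"
  shows "dpred M (\<lambda>s. P (t s) (\<lambda>i. s (\<sigma> i)))"
proof (rule dpred_subst[where P = "\<lambda>a s. P a (\<lambda>i. s (\<sigma> i))", OF _ assms(2)])
  show "dpred M (\<lambda>s. P (s 0) (\<lambda>i. s (Suc (\<sigma> i))))"
    using dpred_reindex[OF assms(1), of "case_nat 0 (\<lambda>i. Suc (\<sigma> i))"] by simp
qed

definition glb :: "('a::{order,zero} \<Rightarrow> bool) \<Rightarrow> 'a" where
  "glb Q = unique_elem (is_glb Q)"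

lemma is_glb_glb:
  fixes Q :: "'a::real_closed_field \<Rightarrow> bool"
  assumes "o_minimal M" "dpred M (\<lambda>s. Q (s 0))" "\<exists>t. Q t" "\<forall>t. Q t \<longrightarrow> l \<le> t"
  shows "is_glb Q (glb Q)"
  unfolding glb_def by (rule unique_elemI, rule o_minimal_glb[OF assms])

lemma dfun_glb:
  assumes "dpred M (\<lambda>s. P (s 0) (\<lambda>i. s (Suc i)))"
  shows "dfun M (\<lambda>s. glb (\<lambda>a. P a s))"
  unfolding glb_def is_glb_def
  by (intro dfun_unique_elem dpred_conj dpred_all dpred_imp dpred_le dfun_var dpred_at[of M P, OF assms])

lemma dpred_section:
  assumes "dpred M (\<lambda>s. P (s 0) (\<lambda>i. s (Suc i)))"
  shows "dpred M (\<lambda>s. P (s 0) r)"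
  using dpred_inst[OF assms, of "case_nat (Inl 0) (\<lambda>i. Inr (r i))"] by simp

text \<open>Among the values of a definable set, take one of least absolute value if there is one;
  otherwise the absolute values contain an interval with left end their infimum \<open>a\<close>, and the
  midpoint of the part of this interval below \<open>a + 1\<close> is an absolute value.\<close>

lemma definable_choice_1:
  fixes M :: "('a::real_closed_field, 'f, 'r) expansion"
  assumes "o_minimal M" and P: "dpred M (\<lambda>s. P (s 0) (\<lambda>i. s (Suc i)))"
  obtains t where "dfun M t" "\<And>s a. P a s \<Longrightarrow> P (t s) s"
proof -
  define T where "T r s \<longleftrightarrow> 0 \<le> r \<and> (P r s \<or> P (- r) s)" for r s
  define a where "a s = glb (\<lambda>r. T r s)" for s
  \<comment> \<open>\<open>c s\<close> is to be the end of the first interval of \<open>T\<close> to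
    the right of \<open>a s\<close>. The cap at \<open>a s + 1\<close> keeps \<open>U\<close>
    nonempty when that interval is unbounded.\<close>
  define U where "U r s \<longleftrightarrow> a s < r \<and> (\<not> T r s \<or> a s + 1 \<le> r)" for r s
  define c where "c s = glb (\<lambda>r. U r s)" for s
  define r where "r s = (if T (a s) s then a s else (a s + c s) * (1 / 2))" for s
  define t where "t s = (if P (r s) s then r s else - r s)" for s
  have T: "dpred M (\<lambda>s. T (s 0) (\<lambda>i. s (Suc i)))"
    unfolding T_def
    by (intro dpred_conj dpred_disj dpred_le dfun_uminus dfun_const dfun_var dpred_at[of M P, OF P])
  have a: "dfun M a"
    unfolding a_def by (rule dfun_glb[OF T])
  have U: "dpred M (\<lambda>s. U (s 0) (\<lambda>i. s (Suc i)))"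
    unfolding U_def
    by (intro dpred_conj dpred_disj dpred_not dpred_le dpred_less dfun_add dfun_const dfun_var T
        dfun_reindex[OF a, of Suc])
  have c: "dfun M c"
    unfolding c_def by (rule dfun_glb[OF U])
  have r: "dfun M r"
    unfolding r_def
    by (intro dfun_if dfun_mult dfun_add dfun_const a c dpred_subst[where P = T, OF T a])
  have t: "dfun M t"
    unfolding t_def by (intro dfun_if dfun_uminus r dpred_subst[where P = P, OF P r])
  have "P (t s) s" if "P b s" for b s
  proof -
    have "T \<bar>b\<bar> s" using that by (auto simp: T_def abs_if)
    then have ga: "is_glb (\<lambda>r. T r s) (a s)"
      unfolding a_def
    proof (intro is_glb_glb[OF assms(1) dpred_section[of M T s, OF T]] exI)
      show "\<forall>r. T r s \<longrightarrow> 0 \<le> r" by (simp add: T_def)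
    qed
    have "T (r s) s"
    proof (cases "T (a s) s")
      case False
      have "U (a s + 1) s" by (simp add: U_def)
      then have gc: "is_glb (\<lambda>r. U r s) (c s)"
        unfolding c_def
      proof (intro is_glb_glb[OF assms(1) dpred_section[of M U s, OF U]] exI)
        show "\<forall>r. U r s \<longrightarrow> a s \<le> r" by (simp add: U_def)
      qed
      obtain d where d: "a s < d" "(\<forall>t. a s < t \<and> t < d \<longrightarrow> T t s) \<or> (\<forall>t. a s < t \<and> t < d \<longrightarrow> \<not> T t s)"
        by (rule o_minimal_germ[OF assms(1) dpred_section[of M T s, OF T]])
      \<comment> \<open>Otherwise \<open>T\<close> would miss both \<open>a s\<close> and the
        interval up to \<open>d\<close>, making \<open>d\<close> a lower bound above the infimum.
        With the dichotomy for germs, \<open>T\<close> then holds on the whole interval.\<close>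
      have "\<exists>t. a s < t \<and> t < d \<and> T t s"
      proof (rule ccontr)
        assume n: "\<not> ?thesis"
        have "d \<le> t" if "T t s" for t
        proof -
          have "a s \<le> t" using ga that unfolding is_glb_def by blast
          moreover have "a s \<noteq> t" using False that by blast
          ultimately show ?thesis using n that by force
        qed
        then have "d \<le> a s" using ga unfolding is_glb_def by blast
        then show False using d by simp
      qed
      then have dT: "T t s" if "a s < t" "t < d" for t using d that by blast
      have "min d (a s + 1) \<le> u" if "U u s" for u
      proof (rule ccontr)
        assume "\<not> ?thesis"
        then have "u < d" "u < a s + 1" by auto
        with that dT[of u] show False by (auto simp: U_def)
      qed
      then have "min d (a s + 1) \<le> c s" using gc unfolding is_glb_def by blast
      moreover have "a s < min d (a s + 1)" using d by simp
      ultimately have ac: "a s < c s" by (rule less_le_trans[rotated])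
      define m where "m = (a s + c s) * (1 / 2)"
      have m: "a s < m" "m < c s" using ac by (simp_all add: m_def)
      have "\<not> U m s" using gc m unfolding is_glb_def by (meson linorder_not_le)
      then have "T m s" using m by (simp add: U_def)
      then show ?thesis using False by (simp add: r_def m_def)
    qed (simp add: r_def)
    then show ?thesis by (auto simp: t_def T_def)
  qed
  with t that show ?thesis by blast
qed

text \<open>The coordinates are chosen one at a time. Invariant: wherever a solution exists at all,
  there is one with the coordinates chosen so far; \<open>R\<close> collects the values by which
  such a partial choice can be continued.\<close>

lemma definable_choice:
  fixes M :: "('a::real_closed_field, 'f, 'r) expansion"
  assumes "o_minimal M" and P: "dpred M (\<lambda>s. P (\<lambda>i\<in>{..<n}. s i) (\<lambda>i. s (n + i)))"
  obtains t where "dpoint M n t" "\<And>s y. y \<in> cart_space n \<Longrightarrow> P y s \<Longrightarrow> P (t s) s"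
proof -
  have "\<exists>c. (\<forall>i<k. dfun M (c i)) \<and> (\<forall>s. (\<exists>y\<in>cart_space n. P y s) \<longrightarrow>
      (\<exists>y\<in>cart_space n. P y s \<and> (\<forall>i<k. y i = c i s)))" if "k \<le> n" for k
    using that
  proof (induction k)
    case (Suc k)
    then obtain c where c: "\<forall>i<k. dfun M (c i)"
      "\<And>s. \<exists>y\<in>cart_space n. P y s \<Longrightarrow> \<exists>y\<in>cart_space n. P y s \<and> (\<forall>i<k. y i = c i s)"
      by auto
    define R where "R a s \<longleftrightarrow> (\<exists>y\<in>cart_space n. P y s \<and> (\<forall>i<k. y i = c i s) \<and> y k = a)" for a s
    have "dpred M (\<lambda>s. R (s 0) (\<lambda>i. s (Suc i)))"
      unfolding R_def
    proof (intro dpred_ex_vars dpred_conj dpred_all_less)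
      show "dpred M (\<lambda>s. P (\<lambda>i\<in>{..<n}. s i) (\<lambda>i. s (n + Suc i)))"
        using dpred_reindex[OF P, of "\<lambda>i. if i < n then i else Suc i"] by (simp cong: restrict_cong)
      show "dpred M (\<lambda>s. (\<lambda>i\<in>{..<n}. s i) i = c i (\<lambda>i. s (n + Suc i)))" if "i < k" for i
      proof -
        have "dpred M (\<lambda>s. s i = c i (\<lambda>i. s (n + Suc i)))"
          by (rule dpred_eq[OF dfun_var dfun_reindex]) (use c(1) that in simp)
        then show ?thesis using that Suc.prems by simp
      qed
      show "dpred M (\<lambda>s. (\<lambda>i\<in>{..<n}. s i) k = s (n + 0))"
        using Suc.prems dpred_eq_var[of M k n] by simp
    qed
    then obtain d where d: "dfun M d" "\<And>s a. R a s \<Longrightarrow> R (d s) s"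
      by (rule definable_choice_1[OF assms(1), of R]) blast
    have "\<exists>y\<in>cart_space n. P y s \<and> (\<forall>i<Suc k. y i = (c(k := d)) i s)" if "\<exists>y\<in>cart_space n. P y s" for s
    proof -
      have "R (d s) s" using c(2)[OF that] d(2)[of _ s] unfolding R_def by blast
      then show ?thesis unfolding R_def by (auto simp: All_less_Suc)
    qed
    then show ?case using c(1) d(1) by (intro exI[of _ "c(k := d)"]) (auto simp: less_Suc_eq)
  qed auto
  from this[of n] obtain c where c: "\<forall>i<n. dfun M (c i)"
      "\<And>s. \<exists>y\<in>cart_space n. P y s \<Longrightarrow> \<exists>y\<in>cart_space n. P y s \<and> (\<forall>i<n. y i = c i s)"
    by auto
  show ?thesis
  proof (rule that[of "\<lambda>s. \<lambda>i\<in>{..<n}. c i s"])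
    show "dpoint M n (\<lambda>s. \<lambda>i\<in>{..<n}. c i s)"
      using c(1) by (intro dpointI restrict_in_cart_space) simp
    fix s y assume "y \<in> cart_space n" "P y s"
    then obtain z where z: "z \<in> cart_space n" "P z s" "\<forall>i<n. z i = c i s" using c(2)[of s] by blast
    then have "(\<lambda>i\<in>{..<n}. c i s) = z" by (intro cart_space_ext[of _ n] restrict_in_cart_space) auto
    with z show "P (\<lambda>i\<in>{..<n}. c i s) s" by simp
  qed
qed

lemma definable_curve_choice:
  fixes M :: "('a::real_closed_field, 'f, 'r) expansion"
  assumes "o_minimal M" and P: "dpred M (\<lambda>s. P (\<lambda>i\<in>{..<n}. s i) (s n))"
  obtains c where "dpoint M n (\<lambda>s. c (s 0))" "\<And>t y. y \<in> cart_space n \<Longrightarrow> P y t \<Longrightarrow> P (c t) t"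
proof -
  obtain c where c: "dpoint M n c" "\<And>s y. y \<in> cart_space n \<Longrightarrow> P y (s 0) \<Longrightarrow> P (c s) (s 0)"
    using definable_choice[of M "\<lambda>y s. P y (s 0)" n] assms by auto
  show ?thesis
    using dpoint_reindex[OF c(1), of "\<lambda>_. 0"] c(2)[of _ "\<lambda>_. _"] by (intro that[of "\<lambda>t. c (\<lambda>_. t)"]) auto
qed

section \<open>Generic continuity of definable curves\<close>

lemma infinite_interval:
  fixes a :: "'a::real_closed_field"
  shows "a < b \<Longrightarrow> infinite {t. a < t \<and> t < b}"
  using infinite_Ioo[of a b] by (simp add: greaterThanLessThan_def greaterThan_def lessThan_def Collect_conj_eq)

lemma definable_image:
  fixes h :: "'a::real_closed_field \<Rightarrow> 'a"
  assumes "dfun M (\<lambda>s. h (s 0))"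
  shows "dpred M (\<lambda>s. \<exists>t. (a < t \<and> t < b) \<and> s 0 = h t)"
  using dfun_reindex[OF assms, of "\<lambda>_. 0"]
  by (intro dpred_ex dpred_conj dpred_less dpred_eq dfun_var dfun_const)

lemma definable_positive_bounded_below:
  fixes h :: "'a::real_closed_field \<Rightarrow> 'a"
  assumes "o_minimal M" and h: "dfun M (\<lambda>s. h (s 0))"
    and "a < b" and pos: "\<And>t. a < t \<Longrightarrow> t < b \<Longrightarrow> 0 < h t"
  obtains \<delta> c d where "0 < \<delta>" "a \<le> c" "c < d" "d \<le> b" "\<And>t. c < t \<Longrightarrow> t < d \<Longrightarrow> \<delta> < h t"
proof -
  note thesisI = that
  let ?I = "{t. a < t \<and> t < b}"
  \<comment> \<open>A lower bound on an infinite subset is enough, since this definable subset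
    contains an interval; density of the order places its ends inside \<open>[a, b]\<close>.\<close>
  have sub: ?thesis if \<delta>: "0 < \<delta>" "infinite {t. (a < t \<and> t < b) \<and> \<delta> < h t}" for \<delta>
  proof -
    have "dpred M (\<lambda>s. (a < s 0 \<and> s 0 < b) \<and> \<delta> < h (s 0))"
      by (intro dpred_conj dpred_less dfun_var dfun_const h)
    from o_minimal_infinite[OF assms(1) this \<delta>(2)] obtain c d where cd: "c < d"
      "\<And>t. c < t \<Longrightarrow> t < d \<Longrightarrow> (a < t \<and> t < b) \<and> \<delta> < h t"
      by (metis (full_types))
    have "a \<le> c" using cd dense_ge_bounded[of c d a] by (meson order_less_imp_le)
    moreover have "d \<le> b" using cd dense_le_bounded[of c d b] by (meson order_less_imp_le)
    ultimately show ?thesis using cd \<delta>(1) by (intro thesisI) auto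
  qed
  show ?thesis
  proof (cases "finite (h ` ?I)")
    case True
    obtain t0 where "a < t0" "t0 < b" using dense \<open>a < b\<close> by blast
    then have "Min (h ` ?I) \<in> h ` ?I" using True by (intro Min_in) auto
    then have "0 < Min (h ` ?I)" using pos by auto
    then obtain \<delta> where "0 < \<delta>" "\<delta> < Min (h ` ?I)" using dense by blast
    have "\<delta> < h t" if "a < t" "t < b" for t
      by (rule less_le_trans[OF \<open>\<delta> < Min (h ` ?I)\<close>]) (use True that in simp)
    then show ?thesis using that \<open>0 < \<delta>\<close> \<open>a < b\<close> by blast
  next
    case False
    have "h ` ?I = {y. \<exists>t. (a < t \<and> t < b) \<and> y = h t}" by auto
    with False have inf: "infinite {y. \<exists>t. (a < t \<and> t < b) \<and> y = h t}" by simp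
    obtain c d where cd: "c < d" "\<And>y. c < y \<Longrightarrow> y < d \<Longrightarrow> \<exists>t. (a < t \<and> t < b) \<and> y = h t"
      by (rule o_minimal_infinite[OF assms(1) definable_image[OF h] inf]) blast
    \<comment> \<open>Being inside the interval of values, \<open>m\<close> is itself a value, hence
      positive. The infinitely many values between \<open>m\<close> and \<open>d\<close> need
      infinitely many arguments, at which \<open>h\<close> exceeds \<open>m\<close>.\<close>
    obtain m where m: "c < m" "m < d" using dense cd(1) by blast
    have "{y. m < y \<and> y < d} \<subseteq> h ` {t. (a < t \<and> t < b) \<and> m < h t}"
    proof safe
      fix y assume "m < y" "y < d"
      then show "y \<in> h ` {t. (a < t \<and> t < b) \<and> m < h t}"
        using cd(2)[of y] m by fastforce
    qed
    then have "infinite {t. (a < t \<and> t < b) \<and> m < h t}"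
      using infinite_interval[OF m(2)] by (meson finite_imageI finite_subset)
    moreover have "0 < m" using cd(2)[OF m] pos by auto
    ultimately show ?thesis by (intro sub[of m])
  qed
qed

lemma definable_small_oscillation:
  fixes h :: "'a::real_closed_field \<Rightarrow> 'a"
  assumes "o_minimal M" and h: "dfun M (\<lambda>s. h (s 0))" and "a < b" "0 < \<delta>"
  obtains c d where "a \<le> c" "c < d" "d \<le> b"
    "\<And>t u. c < t \<Longrightarrow> t < d \<Longrightarrow> c < u \<Longrightarrow> u < d \<Longrightarrow> \<bar>h t - h u\<bar> < \<delta>"
proof -
  note thesisI = that
  let ?I = "{t. a < t \<and> t < b}"
  have sub: ?thesis
    if Q: "dpred M (\<lambda>s. Q (s 0))" "infinite {t. (a < t \<and> t < b) \<and> Q (h t)}"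
      and osc: "\<And>x y. Q x \<Longrightarrow> Q y \<Longrightarrow> \<bar>x - y\<bar> < \<delta>" for Q
  proof -
    have "dpred M (\<lambda>s. (a < s 0 \<and> s 0 < b) \<and> Q (h (s 0)))"
      by (intro dpred_conj dpred_less dfun_var dfun_const dpred_subst[of M "\<lambda>a s. Q a", OF Q(1) h])
    from o_minimal_infinite[OF assms(1) this Q(2)] obtain c d where cd: "c < d"
      "\<And>t. c < t \<Longrightarrow> t < d \<Longrightarrow> (a < t \<and> t < b) \<and> Q (h t)"
      by (metis (full_types))
    have "a \<le> c" using cd dense_ge_bounded[of c d a] by (meson order_less_imp_le)
    moreover have "d \<le> b" using cd dense_le_bounded[of c d b] by (meson order_less_imp_le)
    ultimately show ?thesis using cd osc by (intro thesisI) auto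
  qed
  show ?thesis
  proof (cases "finite (h ` ?I)")
    case True
    have "infinite ?I" using infinite_interval[OF \<open>a < b\<close>] .
    \<comment> \<open>Some value is attained infinitely often, so \<open>h\<close> is constant on a
      subinterval and has no oscillation there.\<close>
    from pigeonhole_infinite[OF this True] obtain t0 where "infinite {t \<in> ?I. h t = h t0}" by blast
    then have "infinite {t. (a < t \<and> t < b) \<and> h t = h t0}" by simp
    then show ?thesis
      using \<open>0 < \<delta>\<close> by (intro sub[of "\<lambda>y. y = h t0"] dpred_eq dfun_var dfun_const) auto
  next
    case False
    have "h ` ?I = {y. \<exists>t. (a < t \<and> t < b) \<and> y = h t}" by auto
    with False have inf: "infinite {y. \<exists>t. (a < t \<and> t < b) \<and> y = h t}" by simp
    obtain c d where cd: "c < d" "\<And>y. c < y \<Longrightarrow> y < d \<Longrightarrow> \<exists>t. (a < t \<and> t < b) \<and> y = h t"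
      by (rule o_minimal_infinite[OF assms(1) definable_image[OF h] inf]) blast
    \<comment> \<open>Shortens the interval of values to length at most \<delta>, so that any two
      values strictly inside differ by less than \<delta>.\<close>
    define e where "e = min d (c + \<delta>)"
    have "c < e" using cd(1) \<open>0 < \<delta>\<close> by (simp add: e_def)
    have "{y. c < y \<and> y < e} \<subseteq> h ` {t. (a < t \<and> t < b) \<and> (c < h t \<and> h t < e)}"
    proof safe
      fix y assume "c < y" "y < e"
      then show "y \<in> h ` {t. (a < t \<and> t < b) \<and> (c < h t \<and> h t < e)}"
        using cd(2)[of y] by (fastforce simp: e_def)
    qed
    then have "infinite {t. (a < t \<and> t < b) \<and> (c < h t \<and> h t < e)}"
      using infinite_interval[OF \<open>c < e\<close>] by (meson finite_imageI finite_subset)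
    then show ?thesis
      by (intro sub[of "\<lambda>y. c < y \<and> y < e"] dpred_conj dpred_less dfun_var dfun_const)
        (auto simp: e_def abs_less_iff algebra_simps)
  qed
qed

lemma definable_eventually_continuous_1:
  fixes h :: "'a::real_closed_field \<Rightarrow> 'a"
  assumes "o_minimal M" and h: "dfun M (\<lambda>s. h (s 0))"
  obtains b where "a < b"
    "\<And>t \<epsilon>. a < t \<Longrightarrow> t < b \<Longrightarrow> 0 < \<epsilon> \<Longrightarrow> \<exists>\<delta>>0. \<forall>u. \<bar>u - t\<bar> < \<delta> \<longrightarrow> \<bar>h u - h t\<bar> < \<epsilon>"
proof -
  define D where "D \<epsilon> t \<longleftrightarrow> 0 < \<epsilon> \<and> \<not> (\<exists>\<delta>. 0 < \<delta> \<and> (\<forall>u. \<bar>u - t\<bar> < \<delta> \<longrightarrow> \<bar>h u - h t\<bar> < \<epsilon>))" for \<epsilon> t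
  have hs: "dfun M (\<lambda>s. h (s k))" for k using dfun_reindex[OF h, of "\<lambda>_. k"] .
  have D: "dpred M (\<lambda>s. D (s i) (s j))" for i j
    unfolding D_def
    by (intro dpred_ex dpred_all dpred_conj dpred_imp dpred_not dpred_less dfun_abs dfun_diff hs dfun_var dfun_const)
  have "dpred M (\<lambda>s. \<exists>\<epsilon>. D \<epsilon> (s 0))" by (intro dpred_ex D)
  \<comment> \<open>To the right of \<open>a\<close>, either all points of some interval are points
    of continuity or all are points of discontinuity; only the second case has to be
    refuted.\<close>
  then obtain b where b: "a < b"
    "(\<forall>t. a < t \<and> t < b \<longrightarrow> (\<exists>\<epsilon>. D \<epsilon> t)) \<or> (\<forall>t. a < t \<and> t < b \<longrightarrow> \<not> (\<exists>\<epsilon>. D \<epsilon> t))"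
    by (rule o_minimal_germ[OF assms(1)])
  from b(2) show ?thesis
  proof
    assume "\<forall>t. a < t \<and> t < b \<longrightarrow> \<not> (\<exists>\<epsilon>. D \<epsilon> t)"
    then show ?thesis using that[OF b(1)] unfolding D_def by blast
  next
    assume disc: "\<forall>t. a < t \<and> t < b \<longrightarrow> (\<exists>\<epsilon>. D \<epsilon> t)"
    \<comment> \<open>The size of the jump has to be a definable function of the point before it can
      be bounded away from 0 on a subinterval.\<close>
    obtain e' where e': "dfun M e'" "\<And>s \<epsilon>. D \<epsilon> (s 0) \<Longrightarrow> D (e' s) (s 0)"
      using definable_choice_1[OF assms(1), of "\<lambda>\<epsilon> s. D \<epsilon> (s 0)"] D[of 0 1] by auto
    define e where "e t = e' (\<lambda>_. t)" for t
    have e: "dfun M (\<lambda>s. e (s 0))" unfolding e_def using dfun_reindex[OF e'(1), of "\<lambda>_. 0"] .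
    have De: "D (e t) t" if "a < t" "t < b" for t
      using disc that e'(2)[of _ "\<lambda>_. t"] unfolding e_def by blast
    obtain \<delta> c d where 1: "0 < \<delta>" "a \<le> c" "c < d" "d \<le> b" "\<And>t. c < t \<Longrightarrow> t < d \<Longrightarrow> \<delta> < e t"
      using definable_positive_bounded_below[OF assms(1) e b(1)] De D_def by (metis (full_types))
    obtain c' d' where 2: "c \<le> c'" "c' < d'" "d' \<le> d"
      "\<And>t u. c' < t \<Longrightarrow> t < d' \<Longrightarrow> c' < u \<Longrightarrow> u < d' \<Longrightarrow> \<bar>h t - h u\<bar> < \<delta>"
      using definable_small_oscillation[OF assms(1) h 1(3,1)] by (metis (full_types))
    obtain t where t: "c' < t" "t < d'" using dense 2(2) by blast
    have "D (e t) t" using t 1 2 by (intro De) auto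
    moreover have "\<bar>h u - h t\<bar> < e t" if "\<bar>u - t\<bar> < min (t - c') (d' - t)" for u
    proof -
      have "c' < u" "u < d'" using that by (auto simp: abs_less_iff)
      then have "\<bar>h u - h t\<bar> < \<delta>" using 2(4) t by blast
      also have "\<delta> < e t" using t 1 2 by auto
      finally show ?thesis .
    qed
    moreover have "0 < min (t - c') (d' - t)" using t by simp
    ultimately show ?thesis unfolding D_def by blast
  qed
qed

text \<open>The open box of the sup distance. Radii are field elements: the field may be
  non-archimedean, so real-valued distances would not do.\<close>

definition near :: "nat \<Rightarrow> 'a::real_closed_field \<Rightarrow> (nat \<Rightarrow> 'a) \<Rightarrow> (nat \<Rightarrow> 'a) \<Rightarrow> bool" where
  "near n \<epsilon> x y \<longleftrightarrow> (\<forall>i<n. \<bar>x i - y i\<bar> < \<epsilon>)"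

lemma dpred_near:
  "dfun M e \<Longrightarrow> dpoint M n t \<Longrightarrow> dpoint M n u \<Longrightarrow> dpred M (\<lambda>s. near n (e s) (t s) (u s))"
  unfolding near_def
  by (intro dpred_all_less dpred_less dfun_abs dfun_diff) (simp_all add: dpoint_def)

lemma definable_eventually_continuous:
  fixes c :: "'a::real_closed_field \<Rightarrow> nat \<Rightarrow> 'a"
  assumes "o_minimal M" and c: "dpoint M n (\<lambda>s. c (s 0))"
  obtains b where "a < b"
    "\<And>t \<epsilon>. a < t \<Longrightarrow> t < b \<Longrightarrow> 0 < \<epsilon> \<Longrightarrow> \<exists>\<delta>>0. \<forall>u. \<bar>u - t\<bar> < \<delta> \<longrightarrow> near n \<epsilon> (c t) (c u)"
proof -
  have "\<exists>b>a. \<forall>t \<epsilon>. a < t \<and> t < b \<and> 0 < \<epsilon> \<longrightarrow> (\<exists>\<delta>>0. \<forall>u. \<bar>u - t\<bar> < \<delta> \<longrightarrow> near k \<epsilon> (c t) (c u))"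
    if "k \<le> n" for k
    using that
  proof (induction k)
    case 0
    then show ?case using gt_ex[of a] by (auto simp: near_def intro!: exI[of _ 1])
  next
    case (Suc k)
    then obtain b where b: "a < b"
      "\<And>t \<epsilon>. a < t \<Longrightarrow> t < b \<Longrightarrow> 0 < \<epsilon> \<Longrightarrow> \<exists>\<delta>>0. \<forall>u. \<bar>u - t\<bar> < \<delta> \<longrightarrow> near k \<epsilon> (c t) (c u)"
      by auto
    have "dfun M (\<lambda>s. c (s 0) k)" using c Suc.prems by (simp add: dpoint_def)
    then obtain b' where b': "a < b'"
      "\<And>t \<epsilon>. a < t \<Longrightarrow> t < b' \<Longrightarrow> 0 < \<epsilon> \<Longrightarrow> \<exists>\<delta>>0. \<forall>u. \<bar>u - t\<bar> < \<delta> \<longrightarrow> \<bar>c u k - c t k\<bar> < \<epsilon>"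
      by (rule definable_eventually_continuous_1[OF assms(1), where a = a]) blast
    have "\<exists>\<delta>>0. \<forall>u. \<bar>u - t\<bar> < \<delta> \<longrightarrow> near (Suc k) \<epsilon> (c t) (c u)"
      if "a < t" "t < min b b'" "0 < \<epsilon>" for t \<epsilon>
    proof -
      obtain \<delta> where \<delta>: "\<delta> > 0" "\<And>u. \<bar>u - t\<bar> < \<delta> \<Longrightarrow> near k \<epsilon> (c t) (c u)"
        using b(2)[of t \<epsilon>] \<open>a < t\<close> \<open>t < min b b'\<close> \<open>0 < \<epsilon>\<close> by auto
      obtain \<delta>' where \<delta>': "\<delta>' > 0" "\<And>u. \<bar>u - t\<bar> < \<delta>' \<Longrightarrow> \<bar>c u k - c t k\<bar> < \<epsilon>"
        using b'(2)[of t \<epsilon>] \<open>a < t\<close> \<open>t < min b b'\<close> \<open>0 < \<epsilon>\<close> by auto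
      have "near (Suc k) \<epsilon> (c t) (c u)" if "\<bar>u - t\<bar> < min \<delta> \<delta>'" for u
        using \<delta>(2)[of u] \<delta>'(2)[of u] that by (auto simp: near_def less_Suc_eq abs_minus_commute)
      then show ?thesis using \<delta>(1) \<delta>'(1) by (intro exI[of _ "min \<delta> \<delta>'"]) auto
    qed
    then show ?case using b(1) b'(1) by (intro exI[of _ "min b b'"]) auto
  qed
  from this[of n] show ?thesis using that by auto
qed

section \<open>Definable maps in coordinates\<close>

lemma dpoint_restrict: "dpoint M n (\<lambda>s. \<lambda>i\<in>{..<n}. s (\<sigma> i))"
  by (rule dpointI) (simp_all add: restrict_in_cart_space dfun_var)

text \<open>Conditions that survive shrinking share the minimum of their finitely many
  witnesses.\<close>

lemma ex_pos_uniform: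
  fixes P :: "nat \<Rightarrow> 'a::real_closed_field \<Rightarrow> bool"
  assumes "\<And>i. i < n \<Longrightarrow> \<exists>\<epsilon>>0. P i \<epsilon>" "\<And>i \<epsilon> \<delta>. P i \<epsilon> \<Longrightarrow> 0 < \<delta> \<Longrightarrow> \<delta> \<le> \<epsilon> \<Longrightarrow> P i \<delta>"
  shows "\<exists>\<epsilon>>0. \<forall>i<n. P i \<epsilon>"
  using assms(1)
proof (induction n)
  case 0
  then show ?case by (auto intro: exI[of _ 1])
next
  case (Suc n)
  then obtain \<epsilon> where \<epsilon>: "\<epsilon> > 0" "\<forall>i<n. P i \<epsilon>" by auto
  obtain \<delta> where \<delta>: "\<delta> > 0" "P n \<delta>" using Suc.prems by auto
  have "P i (min \<epsilon> \<delta>)" if "i < Suc n" for i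
    using \<epsilon> \<delta> that assms(2)[of i \<epsilon> "min \<epsilon> \<delta>"] assms(2)[of i \<delta> "min \<epsilon> \<delta>"] by (auto simp: less_Suc_eq)
  then show ?case using \<epsilon>(1) \<delta>(1) by (intro exI[of _ "min \<epsilon> \<delta>"]) auto
qed

section \<open>Calculus of boxes\<close>

lemma near_refl: "0 < \<epsilon> \<Longrightarrow> near n \<epsilon> x x"
  by (simp add: near_def)

lemma near_sym: "near n \<epsilon> x y \<Longrightarrow> near n \<epsilon> y x"
  by (simp add: near_def abs_minus_commute)

lemma near_mono: "near n \<delta> x y \<Longrightarrow> \<delta> \<le> \<epsilon> \<Longrightarrow> near n \<epsilon> x y"
  by (auto simp: near_def intro: less_le_trans)

lemma near_trans: "near n \<delta> x y \<Longrightarrow> near n \<epsilon> y z \<Longrightarrow> near n (\<delta> + \<epsilon>) x z"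
proof -
  assume a: "near n \<delta> x y" "near n \<epsilon> y z"
  have "\<bar>x i - z i\<bar> < \<delta> + \<epsilon>" if "i < n" for i
  proof -
    have "\<bar>x i - z i\<bar> \<le> \<bar>x i - y i\<bar> + \<bar>y i - z i\<bar>"
      using abs_triangle_ineq[of "x i - y i" "y i - z i"] by simp
    also have "\<dots> < \<delta> + \<epsilon>"
      using a that by (intro add_strict_mono) (simp_all add: near_def)
    finally show ?thesis .
  qed
  then show ?thesis by (simp add: near_def)
qed

text \<open>Boxes are open: the least of the finitely many gaps between \<epsilon> and
  \<open>\<bar>x i - y i\<bar>\<close> is room enough.\<close>

lemma near_room:
  assumes "near n \<epsilon> x y"
  obtains \<delta> where "0 < \<delta>" "\<And>z. near n \<delta> y z \<Longrightarrow> near n \<epsilon> x z"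
proof -
  have "\<exists>\<delta>>0. \<forall>i<n. \<bar>x i - y i\<bar> + \<delta> \<le> \<epsilon>"
  proof (rule ex_pos_uniform)
    show "\<exists>\<delta>>0. \<bar>x i - y i\<bar> + \<delta> \<le> \<epsilon>" if "i < n" for i
      using assms that by (intro exI[of _ "\<epsilon> - \<bar>x i - y i\<bar>"]) (auto simp: near_def)
  qed auto
  then obtain \<delta> where \<delta>: "\<delta> > 0" "\<forall>i<n. \<bar>x i - y i\<bar> + \<delta> \<le> \<epsilon>" by blast
  have "near n \<epsilon> x z" if "near n \<delta> y z" for z
    unfolding near_def
  proof safe
    fix i assume "i < n"
    have "\<bar>x i - z i\<bar> \<le> \<bar>x i - y i\<bar> + \<bar>y i - z i\<bar>" 
      using abs_triangle_ineq[of "x i - y i" "y i - z i"] by simp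
    also have "\<dots> < \<bar>x i - y i\<bar> + \<delta>" using that \<open>i < n\<close> by (simp add: near_def)
    also have "\<dots> \<le> \<epsilon>" using \<delta> \<open>i < n\<close> by blast
    finally show "\<bar>x i - z i\<bar> < \<epsilon>" .
  qed
  with \<delta>(1) that show ?thesis by blast
qed

lemma near_imp_eq:
  assumes "x \<in> cart_space n" "y \<in> cart_space n" "\<And>\<epsilon>. 0 < \<epsilon> \<Longrightarrow> near n \<epsilon> x y"
  shows "x = y"
proof (rule cart_space_ext[OF assms(1,2)])
  fix i assume "i < n"
  then have "\<bar>x i - y i\<bar> < \<epsilon>" if "0 < \<epsilon>" for \<epsilon>
    using assms(3)[OF that] by (simp add: near_def)
  then show "x i = y i"
    by (metis abs_0 eq_iff_diff_eq_0 less_irrefl zero_less_abs_iff)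
qed

section \<open>The topologies of \<open>R^n\<close> and of its subsets in terms of boxes\<close>

lemma topspace_cart_top: "topspace (cart_top n) = cart_space n"
  by (simp add: cart_top_def cart_space_def)

lemma open_interval_nbhd:
  fixes x :: "'a::real_closed_field"
  assumes "open S" "x \<in> S"
  shows "\<exists>\<epsilon>>0. \<forall>y. \<bar>x - y\<bar> < \<epsilon> \<longrightarrow> y \<in> S"
proof -
  obtain b where b: "b > x" "{x..<b} \<subseteq> S"
    using open_right[OF assms, of "x + 1"] by auto
  obtain c where c: "c < x" "{c<..x} \<subseteq> S"
    using open_left[OF assms, of "x - 1"] by auto
  have "y \<in> S" if "\<bar>x - y\<bar> < min (b - x) (x - c)" for y
    using that b c by (cases "x \<le> y") (auto simp: abs_less_iff subset_iff)
  then show ?thesis using b c by (intro exI[of _ "min (b - x) (x - c)"]) auto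
qed

lemma openin_cart_top:
  fixes T :: "(nat \<Rightarrow> 'a::real_closed_field) set"
  shows "openin (cart_top n) T \<longleftrightarrow>
    T \<subseteq> cart_space n \<and> (\<forall>x\<in>T. \<exists>\<epsilon>>0. \<forall>y\<in>cart_space n. near n \<epsilon> x y \<longrightarrow> y \<in> T)" (is "_ \<longleftrightarrow> ?R")
proof
  assume o: "openin (cart_top n) T"
  then have "T \<subseteq> cart_space n" using openin_subset topspace_cart_top by blast
  moreover have "\<exists>\<epsilon>>0. \<forall>y\<in>cart_space n. near n \<epsilon> x y \<longrightarrow> y \<in> T" if x: "x \<in> T" for x
  proof -
    obtain U where U0: "\<forall>i\<in>{..<n}. openin euclidean (U i)" and U: "x \<in> Pi\<^sub>E {..<n} U" "Pi\<^sub>E {..<n} U \<subseteq> T"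
      using o[unfolded cart_top_def openin_product_topology_alt, rule_format, OF x] by blast
    have "\<exists>\<epsilon>>0. \<forall>i<n. \<forall>y. \<bar>x i - y\<bar> < \<epsilon> \<longrightarrow> y \<in> U i"
    proof (rule ex_pos_uniform)
      show "\<exists>\<epsilon>>0. \<forall>y. \<bar>x i - y\<bar> < \<epsilon> \<longrightarrow> y \<in> U i" if "i < n" for i
        using U0 U(1) that by (intro open_interval_nbhd) auto
    qed auto
    then obtain \<epsilon> where \<epsilon>: "\<epsilon> > 0" "\<forall>i<n. \<forall>y. \<bar>x i - y\<bar> < \<epsilon> \<longrightarrow> y \<in> U i" by blast
    have "y \<in> T" if "y \<in> cart_space n" "near n \<epsilon> x y" for y
      using that \<epsilon>(2) by (intro subsetD[OF U(2)]) (auto simp: near_def cart_space_def PiE_iff)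
    with \<epsilon>(1) show ?thesis by blast
  qed
  ultimately show ?R by blast
next
  assume R: ?R
  show "openin (cart_top n) T"
    unfolding cart_top_def openin_product_topology_alt
  proof
    fix x assume x: "x \<in> T"
    then obtain \<epsilon> where \<epsilon>: "\<epsilon> > 0" "\<And>y. y \<in> cart_space n \<Longrightarrow> near n \<epsilon> x y \<Longrightarrow> y \<in> T" using R by blast
    define U where "U i = {x i - \<epsilon><..<x i + \<epsilon>}" for i
    have "finite {i \<in> {..<n}. U i \<noteq> topspace euclidean}" by simp
    moreover have "\<forall>i\<in>{..<n}. openin euclidean (U i)" by (simp add: U_def)
    moreover have "x \<in> Pi\<^sub>E {..<n} U"
      using x R \<epsilon>(1) by (auto simp: U_def cart_space_def PiE_iff)
    moreover have "Pi\<^sub>E {..<n} U \<subseteq> T"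
    proof
      fix y assume y: "y \<in> Pi\<^sub>E {..<n} U"
      have "\<bar>x i - y i\<bar> < \<epsilon>" if "i < n" for i
        using PiE_mem[OF y, of i] that by (simp add: U_def abs_less_iff algebra_simps)
      moreover have "y \<in> cart_space n"
        using y by (simp add: cart_space_def PiE_iff)
      ultimately show "y \<in> T" by (intro \<epsilon>(2)) (simp_all add: near_def)
    qed
    ultimately show "\<exists>U. finite {i \<in> {..<n}. U i \<noteq> topspace euclidean} \<and>
        (\<forall>i\<in>{..<n}. openin euclidean (U i)) \<and> x \<in> Pi\<^sub>E {..<n} U \<and> Pi\<^sub>E {..<n} U \<subseteq> T"
      by blast
  qed
qed

lemma openin_sub_top:
  assumes "A \<subseteq> cart_space n"
  shows "openin (sub_top n A) U \<longleftrightarrow> U \<subseteq> A \<and> (\<forall>x\<in>U. \<exists>\<epsilon>>0. \<forall>y\<in>A. near n \<epsilon> x y \<longrightarrow> y \<in> U)"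
    (is "_ \<longleftrightarrow> ?R")
proof
  assume "openin (sub_top n A) U"
  then obtain T where T: "openin (cart_top n) T" "U = T \<inter> A" by (auto simp: openin_subtopology)
  have "\<exists>\<epsilon>>0. \<forall>y\<in>A. near n \<epsilon> x y \<longrightarrow> y \<in> U" if "x \<in> U" for x
  proof -
    have "x \<in> T" using that T(2) by blast
    then obtain \<epsilon> where "\<epsilon> > 0" "\<forall>y\<in>cart_space n. near n \<epsilon> x y \<longrightarrow> y \<in> T"
      using T(1) unfolding openin_cart_top by blast
    then show ?thesis using assms T(2) by blast
  qed
  then show ?R using T(2) by blast
next
  assume R: ?R
  \<comment> \<open>The union of all boxes centred in \<open>U\<close> whose trace on
    \<open>A\<close> stays in \<open>U\<close>; it is open and cuts out exactly
    \<open>U\<close>.\<close>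
  define T where "T = {z \<in> cart_space n. \<exists>x\<in>U. \<exists>\<epsilon>>0. near n \<epsilon> x z \<and> (\<forall>y\<in>A. near n \<epsilon> x y \<longrightarrow> y \<in> U)}"
  have "openin (cart_top n) T"
    unfolding openin_cart_top
  proof safe
    fix z assume "z \<in> T"
    then obtain x \<epsilon> where x: "x \<in> U" "\<epsilon> > 0" "near n \<epsilon> x z" "\<forall>y\<in>A. near n \<epsilon> x y \<longrightarrow> y \<in> U"
      by (auto simp: T_def)
    obtain \<delta> where "0 < \<delta>" "\<And>y. near n \<delta> z y \<Longrightarrow> near n \<epsilon> x y"
      by (rule near_room[OF x(3)]) blast
    then show "\<exists>\<epsilon>>0. \<forall>y\<in>cart_space n. near n \<epsilon> z y \<longrightarrow> y \<in> T"
      using x unfolding T_def by blast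
  qed (simp add: T_def)
  moreover have "U = T \<inter> A"
  proof
    show "T \<inter> A \<subseteq> U" by (auto simp: T_def)
    show "U \<subseteq> T \<inter> A" using R assms near_refl unfolding T_def by blast
  qed
  ultimately show "openin (sub_top n A) U" by (auto simp: openin_subtopology)
qed

lemma topspace_sub_top: "A \<subseteq> cart_space n \<Longrightarrow> topspace (sub_top n A) = A"
  by (auto simp: topspace_cart_top)

definition cont ::
    "nat \<Rightarrow> (nat \<Rightarrow> 'a::real_closed_field) set \<Rightarrow> nat \<Rightarrow> ((nat \<Rightarrow> 'a) \<Rightarrow> nat \<Rightarrow> 'a) \<Rightarrow> bool" where
  "cont m A n f \<longleftrightarrow>
     (\<forall>x\<in>A. \<forall>\<epsilon>>0. \<exists>\<delta>>0. \<forall>y\<in>A. near m \<delta> x y \<longrightarrow> near n \<epsilon> (f x) (f y))"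

lemma contD:
  assumes "cont m A n f" "x \<in> A" "0 < \<epsilon>"
  obtains \<delta> where "0 < \<delta>" "\<And>y. y \<in> A \<Longrightarrow> near m \<delta> x y \<Longrightarrow> near n \<epsilon> (f x) (f y)"
  using assms unfolding cont_def by blast

lemma continuous_map_iff_cont:
  assumes "A \<subseteq> cart_space m" "B \<subseteq> cart_space n"
  shows "continuous_map (sub_top m A) (sub_top n B) f \<longleftrightarrow> f ` A \<subseteq> B \<and> cont m A n f" (is "?L \<longleftrightarrow> ?R")
proof
  assume L: ?L
  then have fAB: "f ` A \<subseteq> B"
    using continuous_map_image_subset_topspace[OF L] topspace_sub_top[OF assms(1)] by auto
  moreover have "cont m A n f"
    unfolding cont_def
  proof (intro ballI allI impI)
    fix x and \<epsilon> :: 'a assume x: "x \<in> A" "0 < \<epsilon>"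
    define V where "V = {y \<in> B. near n \<epsilon> (f x) y}"
    have "openin (sub_top n B) V"
      unfolding openin_sub_top[OF assms(2)]
    proof (intro conjI ballI)
      fix y assume "y \<in> V"
      then have "near n \<epsilon> (f x) y" by (simp add: V_def)
      then obtain \<delta> where "0 < \<delta>" "\<And>z. near n \<delta> y z \<Longrightarrow> near n \<epsilon> (f x) z"
        by (rule near_room) blast
      then show "\<exists>\<delta>>0. \<forall>z\<in>B. near n \<delta> y z \<longrightarrow> z \<in> V" by (auto simp: V_def)
    qed (simp add: V_def)
    then have "openin (sub_top m A) {y \<in> A. f y \<in> V}"
      using openin_continuous_map_preimage[OF L, of V] unfolding topspace_sub_top[OF assms(1)] by simp
    moreover have "x \<in> {y \<in> A. f y \<in> V}"
      using x fAB near_refl by (auto simp: V_def)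
    ultimately show "\<exists>\<delta>>0. \<forall>y\<in>A. near m \<delta> x y \<longrightarrow> near n \<epsilon> (f x) (f y)"
      unfolding openin_sub_top[OF assms(1)] V_def by blast
  qed
  ultimately show ?R by blast
next
  assume R: ?R
  show ?L
    unfolding continuous_map topspace_sub_top[OF assms(1)] topspace_sub_top[OF assms(2)]
  proof (intro conjI allI impI)
    show "f ` A \<subseteq> B" using R by blast
    fix V assume "openin (sub_top n B) V"
    then have V: "\<And>y. y \<in> V \<Longrightarrow> \<exists>\<epsilon>>0. \<forall>z\<in>B. near n \<epsilon> y z \<longrightarrow> z \<in> V"
      by (simp add: openin_sub_top[OF assms(2)])
    show "openin (sub_top m A) {x \<in> A. f x \<in> V}"
      unfolding openin_sub_top[OF assms(1)]
    proof safe
      fix x assume x: "x \<in> A" "f x \<in> V"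
      then obtain \<epsilon> where \<epsilon>: "\<epsilon> > 0" "\<forall>z\<in>B. near n \<epsilon> (f x) z \<longrightarrow> z \<in> V" using V by blast
      obtain \<delta> where "\<delta> > 0" "\<And>y. y \<in> A \<Longrightarrow> near m \<delta> x y \<Longrightarrow> near n \<epsilon> (f x) (f y)"
        using R contD x(1) \<epsilon>(1) by blast
      with \<epsilon> R show "\<exists>\<epsilon>>0. \<forall>y\<in>A. near m \<epsilon> x y \<longrightarrow> y \<in> {x \<in> A. f x \<in> V}" by blast
    qed
  qed
qed

section \<open>Pairs and their projections\<close>

lemma join_in_cart_space:
  "x \<in> cart_space m \<Longrightarrow> y \<in> cart_space n \<Longrightarrow> join m x y \<in> cart_space (m + n)"
  by (auto simp: join_def cart_space_def PiE_def extensional_def)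

lemma left_part_in_cart_space: "left_part m z \<in> cart_space m"
  by (simp add: left_part_def restrict_in_cart_space)

lemma right_part_in_cart_space: "right_part m n z \<in> cart_space n"
  by (simp add: right_part_def restrict_in_cart_space)

lemma left_part_join: "x \<in> cart_space m \<Longrightarrow> left_part m (join m x y) = x"
  by (rule cart_space_ext[OF left_part_in_cart_space]) (auto simp: left_part_def join_def)

lemma right_part_join: "y \<in> cart_space n \<Longrightarrow> right_part m n (join m x y) = y"
  by (rule cart_space_ext[OF right_part_in_cart_space]) (auto simp: right_part_def join_def)

lemma join_left_right: "z \<in> cart_space (m + n) \<Longrightarrow> join m (left_part m z) (right_part m n z) = z"
  by (rule cart_space_ext[OF join_in_cart_space[OF left_part_in_cart_space right_part_in_cart_space]])
    (auto simp: left_part_def right_part_def join_def)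

lemma near_join: "near (m + k) \<epsilon> (join m x v) (join m y w) \<longleftrightarrow> near m \<epsilon> x y \<and> near k \<epsilon> v w" (is "?L \<longleftrightarrow> ?R")
proof
  assume L: ?L
  have "\<bar>x i - y i\<bar> < \<epsilon>" if "i < m" for i
    using L[unfolded near_def, rule_format, of i] that by (simp add: join_def)
  moreover have "\<bar>v i - w i\<bar> < \<epsilon>" if "i < k" for i
    using L[unfolded near_def, rule_format, of "m + i"] that by (simp add: join_def)
  ultimately show ?R by (simp add: near_def)
next
  assume ?R
  then show ?L by (auto simp: near_def join_def)
qed

lemma near_left_part: "near (m + k) \<epsilon> x y \<Longrightarrow> near m \<epsilon> (left_part m x) (left_part m y)"
  by (simp add: near_def left_part_def)

lemma near_right_part: "near (m + k) \<epsilon> x y \<Longrightarrow> near k \<epsilon> (right_part m k x) (right_part m k y)"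
  by (simp add: near_def right_part_def)

lemma dpoint_join:
  assumes "dpoint M m t" "dpoint M n u"
  shows "dpoint M (m + n) (\<lambda>s. join m (t s) (u s))"
proof (rule dpointI)
  show "join m (t s) (u s) \<in> cart_space (m + n)" for s
    using assms by (intro join_in_cart_space) (auto simp: dpoint_def)
  show "dfun M (\<lambda>s. join m (t s) (u s) i)" if "i < m + n" for i
    using assms that by (cases "i < m") (auto simp: join_def dpoint_def)
qed

lemma dpoint_left_part: "dpoint M (m + n) t \<Longrightarrow> dpoint M m (\<lambda>s. left_part m (t s))"
  by (rule dpointI[OF left_part_in_cart_space]) (simp add: left_part_def dpoint_def)

lemma dpoint_right_part: "dpoint M (m + n) t \<Longrightarrow> dpoint M n (\<lambda>s. right_part m n (t s))"
  by (rule dpointI[OF right_part_in_cart_space]) (simp add: right_part_def dpoint_def)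

lemma dpoint_if:
  assumes "dpred M P" "dpoint M n t" "dpoint M n u"
  shows "dpoint M n (\<lambda>s. if P s then t s else u s)"
proof (rule dpointI)
  show "(if P s then t s else u s) \<in> cart_space n" for s
    using assms by (simp add: dpoint_def)
  show "dfun M (\<lambda>s. (if P s then t s else u s) i)" if "i < n" for i
    using dfun_if[OF assms(1) dpoint_dfun[OF assms(2) that] dpoint_dfun[OF assms(3) that]]
    by (simp add: if_distrib[of "\<lambda>f. f i"])
qed

lemma dpred_eq_point:
  assumes "dpoint M n t" "dpoint M n u"
  shows "dpred M (\<lambda>s. t s = u s)"
proof -
  have "dpred M (\<lambda>s. \<forall>i<n. t s i = u s i)"
    using assms by (intro dpred_all_less dpred_eq) (auto simp: dpoint_def)
  moreover have "t s = u s \<longleftrightarrow> (\<forall>i<n. t s i = u s i)" for s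
    using assms by (auto simp: dpoint_def intro!: cart_space_ext[of _ n])
  ultimately show ?thesis by simp
qed

section \<open>Graphs, coordinate functions and closure properties of definable maps\<close>

lemma definable_subset: "definable M n A \<Longrightarrow> A \<subseteq> cart_space n"
  by (auto simp: definable_def)

text \<open>The extension of a map on \<open>A\<close> by a constant makes composition with it total.\<close>

definition ext_map ::
    "(nat \<Rightarrow> 'a::zero) set \<Rightarrow> nat \<Rightarrow> ((nat \<Rightarrow> 'a) \<Rightarrow> nat \<Rightarrow> 'a) \<Rightarrow> (nat \<Rightarrow> 'a) \<Rightarrow> nat \<Rightarrow> 'a" where
  "ext_map A n f x = (if x \<in> A then f x else (\<lambda>i\<in>{..<n}. 0))"

lemma ext_map_in: "x \<in> A \<Longrightarrow> ext_map A n f x = f x"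
  by (simp add: ext_map_def)

text \<open>Translates the graph condition of \<open>definable_map\<close> into a total function
  that may occur inside terms. A coordinate of the value is read off a quantified second component
  of the graph; conversely the graph is cut out by one equation between the two projections.\<close>

lemma graph_definable_iff_dmap:
  assumes A: "definable M m A" and fA: "f ` A \<subseteq> cart_space n"
  shows "definable M (m + n) {join m x (f x) | x. x \<in> A} \<longleftrightarrow> dmap M m n (ext_map A n f)" (is "?L \<longleftrightarrow> ?R")
proof
  let ?G = "{join m x (f x) | x. x \<in> A}"
  assume L: ?L
  have mem: "join m x y \<in> ?G \<longleftrightarrow> y = f x" if "x \<in> A" "y \<in> cart_space n" for x y
  proof -
    have "y = f x'" if "join m x y = join m x' (f x')" "x' \<in> A" for x'
    proof -
      have "x = x'"
        using that \<open>x \<in> A\<close> left_part_join[of x m y] left_part_join[of x' m "f x'"] definable_subset[OF A] by auto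
      moreover have "y = f x'"
        using that \<open>y \<in> cart_space n\<close> right_part_join[of y n m x] right_part_join[of "f x'" n m x'] fA by auto
      ultimately show ?thesis by simp
    qed
    moreover have "x = x'" if "join m x y = join m x' (f x')" "x' \<in> A" for x'
      using that \<open>x \<in> A\<close> left_part_join[of x m y] left_part_join[of x' m "f x'"] definable_subset[OF A] by auto
    ultimately show ?thesis using \<open>x \<in> A\<close> by blast
  qed
  show ?R
    unfolding dmap_def
  proof (rule dpointI)
    show "ext_map A n f (\<lambda>i\<in>{..<m}. s i) \<in> cart_space n" for s
      using fA by (auto simp: ext_map_def restrict_in_cart_space)
    fix i assume i: "i < n"
    let ?x = "\<lambda>s. \<lambda>i\<in>{..<m}. s (Suc i)"
    have "dpred M (\<lambda>s. (\<lambda>i\<in>{..<m}. s (n + Suc i)) \<in> A \<and> join m (\<lambda>i\<in>{..<m}. s (n + Suc i)) (\<lambda>i\<in>{..<n}. s i) \<in> ?G \<and>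
        s (n + 0) = (\<lambda>i\<in>{..<n}. s i) i)"
      using dpred_eq_var[of M "n + 0" i] i
      by (intro dpred_conj dpred_mem[OF A] dpred_mem[OF L] dpoint_join dpoint_restrict) simp_all
    then have "dpred M (\<lambda>s. \<exists>y\<in>cart_space n. ?x s \<in> A \<and> join m (?x s) y \<in> ?G \<and> s 0 = y i)"
      by (rule dpred_ex_vars[of M "\<lambda>y s. ?x s \<in> A \<and> join m (?x s) y \<in> ?G \<and> s 0 = y i"])
    then have "dpred M (\<lambda>s. (\<exists>y\<in>cart_space n. ?x s \<in> A \<and> join m (?x s) y \<in> ?G \<and> s 0 = y i) \<or>
        (?x s \<notin> A \<and> s 0 = 0))"
      by (rule dpred_disj)
        (intro dpred_conj dpred_not dpred_eq dfun_var dfun_const dpred_mem[OF A] dpoint_restrict)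
    moreover have "(\<exists>y\<in>cart_space n. ?x s \<in> A \<and> join m (?x s) y \<in> ?G \<and> s 0 = y i) \<or> (?x s \<notin> A \<and> s 0 = 0)
        \<longleftrightarrow> s 0 = ext_map A n f (?x s) i" for s
    proof (cases "?x s \<in> A")
      case True
      then have "f (?x s) \<in> cart_space n" using fA by blast
      with True mem[OF True] show ?thesis by (metis (no_types, lifting) ext_map_in)
    next
      case False
      then show ?thesis using i by (simp add: ext_map_def)
    qed
    ultimately show "dfun M (\<lambda>s. ext_map A n f (\<lambda>i\<in>{..<m}. s i) i)"
      unfolding dfun_def by simp
  qed
next
  assume R: ?R
  have "dpred M (\<lambda>s. (left_part m (\<lambda>i\<in>{..<m + n}. s i)) \<in> A \<and>
      right_part m n (\<lambda>i\<in>{..<m + n}. s i) = ext_map A n f (left_part m (\<lambda>i\<in>{..<m + n}. s i)))"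
    by (intro dpred_conj dpred_mem[OF A] dpred_eq_point[of _ n] dpoint_dmap[OF R] dpoint_left_part[of _ _ n]
        dpoint_right_part dpoint_restrict)
  then have "definable M (m + n) {z \<in> cart_space (m + n). left_part m z \<in> A \<and>
      right_part m n z = ext_map A n f (left_part m z)}"
    by (rule dpred_imp_definable)
  also have "{z \<in> cart_space (m + n). left_part m z \<in> A \<and> right_part m n z = ext_map A n f (left_part m z)}
      = {join m x (f x) | x. x \<in> A}" (is "?S = ?G")
  proof
    show "?S \<subseteq> ?G"
    proof
      fix z assume "z \<in> ?S"
      then have "z = join m (left_part m z) (f (left_part m z))" "left_part m z \<in> A"
        using join_left_right[of z m n] by (auto simp: ext_map_in)
      then show "z \<in> ?G" by blast
    qed
    show "?G \<subseteq> ?S"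
    proof safe
      fix x assume x: "x \<in> A"
      then have c: "x \<in> cart_space m" "f x \<in> cart_space n" using definable_subset[OF A] fA by auto
      then show "join m x (f x) \<in> cart_space (m + n)" by (rule join_in_cart_space)
      show "left_part m (join m x (f x)) \<in> A"
        "right_part m n (join m x (f x)) = ext_map A n f (left_part m (join m x (f x)))"
        using x c by (simp_all add: left_part_join right_part_join ext_map_in)
    qed
  qed
  finally show ?L .
qed

lemma definable_map_iff:
  "definable_map M m A n B f \<longleftrightarrow> definable M m A \<and> definable M n B \<and> f ` A \<subseteq> B \<and> cont m A n f \<and>
     dmap M m n (ext_map A n f)"
  unfolding definable_map_def
  using graph_definable_iff_dmap[of M m A f n] continuous_map_iff_cont[of A m B n f]
    definable_subset[of M m A] definable_subset[of M n B] by (meson order_trans)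

lemma definable_mapE:
  assumes "definable_map M m A n B f"
  shows "definable M m A" "definable M n B" "\<And>x. x \<in> A \<Longrightarrow> f x \<in> B" "cont m A n f"
    "dmap M m n (ext_map A n f)"
  using assms unfolding definable_map_iff by auto

lemma definable_mapI:
  assumes "definable M m A" "definable M n B" "\<And>x. x \<in> A \<Longrightarrow> f x \<in> B" "cont m A n f"
    "dmap M m n (ext_map A n f)"
  shows "definable_map M m A n B f"
  using assms unfolding definable_map_iff by auto

text \<open>\<open>f'\<close> is any definable expression that agrees with \<open>f\<close> on
  \<open>A\<close>; off \<open>A\<close> the constant of \<open>ext_map\<close> takes over.\<close>

lemma dmap_ext_mapI:
  assumes "definable M m A" "dpoint M n (\<lambda>s. f' (\<lambda>i\<in>{..<m}. s i))" "\<And>x. x \<in> A \<Longrightarrow> f x = f' x"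
  shows "dmap M m n (ext_map A n f)"
proof -
  have "ext_map A n f x = (if x \<in> A then f' x else (\<lambda>i\<in>{..<n}. 0))" for x
    using assms(3) by (simp add: ext_map_def)
  then show ?thesis
    unfolding dmap_def
    by (simp only:) (intro dpoint_if dpred_mem[OF assms(1)] dpoint_restrict assms(2) dpoint_const restrict_in_cart_space)
qed

lemma cont_comp:
  assumes "cont m A n f" "cont n B k g" "f ` A \<subseteq> B"
  shows "cont m A k (\<lambda>x. g (f x))"
  unfolding cont_def
proof (intro ballI allI impI)
  fix x and \<epsilon> :: 'a assume x: "x \<in> A" "0 < \<epsilon>"
  obtain \<delta> where \<delta>: "0 < \<delta>" "\<And>y. y \<in> B \<Longrightarrow> near n \<delta> (f x) y \<Longrightarrow> near k \<epsilon> (g (f x)) (g y)"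
    by (rule contD[OF assms(2), of "f x" \<epsilon>]) (use x assms(3) in auto)
  obtain \<delta>' where \<delta>': "0 < \<delta>'" "\<And>y. y \<in> A \<Longrightarrow> near m \<delta>' x y \<Longrightarrow> near n \<delta> (f x) (f y)"
    by (rule contD[OF assms(1) x(1) \<delta>(1)]) blast
  show "\<exists>\<delta>>0. \<forall>y\<in>A. near m \<delta> x y \<longrightarrow> near k \<epsilon> (g (f x)) (g (f y))"
    using \<delta> \<delta>' assms(3) by (intro exI[of _ \<delta>']) auto
qed

lemma cont_subset: "cont m A n f \<Longrightarrow> A' \<subseteq> A \<Longrightarrow> cont m A' n f"
  unfolding cont_def by (meson subsetD)

lemma cont_join:
  assumes "cont m A n f" "cont m A k g"
  shows "cont m A (n + k) (\<lambda>x. join n (f x) (g x))"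
  unfolding cont_def near_join
proof (intro ballI allI impI)
  fix x and \<epsilon> :: 'a assume x: "x \<in> A" "0 < \<epsilon>"
  obtain \<delta> where \<delta>: "0 < \<delta>" "\<And>y. y \<in> A \<Longrightarrow> near m \<delta> x y \<Longrightarrow> near n \<epsilon> (f x) (f y)"
    by (rule contD[OF assms(1) x]) blast
  obtain \<delta>' where \<delta>': "0 < \<delta>'" "\<And>y. y \<in> A \<Longrightarrow> near m \<delta>' x y \<Longrightarrow> near k \<epsilon> (g x) (g y)"
    by (rule contD[OF assms(2) x]) blast
  show "\<exists>\<delta>>0. \<forall>y\<in>A. near m \<delta> x y \<longrightarrow> near n \<epsilon> (f x) (f y) \<and> near k \<epsilon> (g x) (g y)"
    using \<delta> \<delta>' near_mono[of m "min \<delta> \<delta>'"] by (intro exI[of _ "min \<delta> \<delta>'"]) auto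
qed

lemma cont_left_part: "cont (m + k) A m (left_part m)"
  unfolding cont_def using near_left_part by blast

lemma cont_right_part: "cont (m + k) A k (right_part m k)"
  unfolding cont_def using near_right_part by blast

lemma definable_join_prod:
  assumes "definable M m A" "definable M n B"
  shows "definable M (m + n) (join_prod m A B)"
proof -
  have "dpred M (\<lambda>s. left_part m (\<lambda>i\<in>{..<m + n}. s i) \<in> A \<and> right_part m n (\<lambda>i\<in>{..<m + n}. s i) \<in> B)"
    by (intro dpred_conj dpred_mem[OF assms(1)] dpred_mem[OF assms(2)] dpoint_left_part[of _ _ n]
        dpoint_right_part[of _ m] dpoint_restrict)
  then have "definable M (m + n) {z \<in> cart_space (m + n). left_part m z \<in> A \<and> right_part m n z \<in> B}"
    by (rule dpred_imp_definable)
  moreover have "{z \<in> cart_space (m + n). left_part m z \<in> A \<and> right_part m n z \<in> B} = join_prod m A B" (is "?S = ?T")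
  proof
    show "?S \<subseteq> ?T"
    proof
      fix z assume "z \<in> ?S"
      then have "z = join m (left_part m z) (right_part m n z)" "left_part m z \<in> A" "right_part m n z \<in> B"
        using join_left_right[of z m n] by auto
      then show "z \<in> ?T" unfolding join_prod_def by blast
    qed
    show "?T \<subseteq> ?S"
      using definable_subset[OF assms(1)] definable_subset[OF assms(2)]
      by (auto simp: join_prod_def left_part_join right_part_join subset_iff join_in_cart_space)
  qed
  ultimately show ?thesis by simp
qed

lemma join_prodI: "x \<in> A \<Longrightarrow> y \<in> B \<Longrightarrow> join m x y \<in> join_prod m A B"
  by (auto simp: join_prod_def)

lemma join_prodD:
  assumes "z \<in> join_prod m A B" "A \<subseteq> cart_space m" "B \<subseteq> cart_space n"
  shows "left_part m z \<in> A" "right_part m n z \<in> B" "join m (left_part m z) (right_part m n z) = z"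
  using assms by (auto simp: join_prod_def left_part_join right_part_join subset_iff)

lemma definable_map_comp:
  assumes f: "definable_map M m A n B f" and g: "definable_map M n B k C g"
  shows "definable_map M m A k C (\<lambda>x. g (f x))"
proof (rule definable_mapI)
  note f = definable_mapE[OF f] and g = definable_mapE[OF g]
  show "definable M m A" "definable M k C" "\<And>x. x \<in> A \<Longrightarrow> g (f x) \<in> C"
    using f g by auto
  show "cont m A k (\<lambda>x. g (f x))"
    by (rule cont_comp[OF f(4) g(4)]) (use f in auto)
  show "dmap M m k (ext_map A k (\<lambda>x. g (f x)))"
    by (rule dmap_ext_mapI[OF f(1), of _ "\<lambda>x. ext_map B k g (ext_map A n f x)"])
      (use f(3) in \<open>auto simp: ext_map_in intro!: dpoint_dmap[OF g(5)] dpoint_dmap[OF f(5)] dpoint_restrict\<close>)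
qed

lemma definable_map_restrict:
  assumes f: "definable_map M m A n B f" and "definable M m A'" "A' \<subseteq> A" "definable M n B'"
    "\<And>x. x \<in> A' \<Longrightarrow> f x \<in> B'"
  shows "definable_map M m A' n B' f"
proof (rule definable_mapI)
  note f = definable_mapE[OF f]
  show "cont m A' n f" by (rule cont_subset[OF f(4) assms(3)])
  show "dmap M m n (ext_map A' n f)"
    by (rule dmap_ext_mapI[OF assms(2), of _ "ext_map A n f"])
      (use assms(3) in \<open>auto simp: ext_map_in subset_iff intro!: dpoint_dmap[OF f(5)] dpoint_restrict\<close>)
qed (use assms in auto)

lemma definable_map_join:
  assumes f: "definable_map M m A n B f" and g: "definable_map M m A k C g"
  shows "definable_map M m A (n + k) (join_prod n B C) (\<lambda>x. join n (f x) (g x))"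
proof (rule definable_mapI)
  note f = definable_mapE[OF f] and g = definable_mapE[OF g]
  show "dmap M m (n + k) (ext_map A (n + k) (\<lambda>x. join n (f x) (g x)))"
    by (rule dmap_ext_mapI[OF f(1), of _ "\<lambda>x. join n (ext_map A n f x) (ext_map A k g x)"])
      (auto simp: ext_map_in intro!: dpoint_join dpoint_dmap[OF g(5)] dpoint_dmap[OF f(5)] dpoint_restrict)
qed (use definable_mapE[OF f] definable_mapE[OF g] in \<open>auto intro: definable_join_prod cont_join join_prodI\<close>)

lemma definable_map_left_part:
  assumes "definable M m A" "definable M k B"
  shows "definable_map M (m + k) (join_prod m A B) m A (left_part m)"
proof (rule definable_mapI)
  note d = definable_join_prod[OF assms]
  show "definable M (m + k) (join_prod m A B)" by (rule d)
  show "left_part m z \<in> A" if "z \<in> join_prod m A B" for z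
    using join_prodD[OF that] definable_subset assms by blast
  show "dmap M (m + k) m (ext_map (join_prod m A B) m (left_part m))"
    by (rule dmap_ext_mapI[OF d, of _ "left_part m"]) (intro dpoint_left_part[of _ _ k] dpoint_restrict refl)+
qed (use assms in \<open>auto intro: cont_left_part\<close>)

lemma definable_map_right_part:
  assumes "definable M m A" "definable M k B"
  shows "definable_map M (m + k) (join_prod m A B) k B (right_part m k)"
proof (rule definable_mapI)
  note d = definable_join_prod[OF assms]
  show "definable M (m + k) (join_prod m A B)" by (rule d)
  show "right_part m k z \<in> B" if "z \<in> join_prod m A B" for z
    using join_prodD[OF that] definable_subset assms by blast
  show "dmap M (m + k) k (ext_map (join_prod m A B) k (right_part m k))"
    by (rule dmap_ext_mapI[OF d, of _ "right_part m k"]) (intro dpoint_right_part[of _ m] dpoint_restrict refl)+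
qed (use assms in \<open>auto intro: cont_right_part\<close>)

lemma definable_map_id:
  assumes "definable M m A"
  shows "definable_map M m A m A (\<lambda>x. x)"
proof (rule definable_mapI)
  show "dmap M m m (ext_map A m (\<lambda>x. x))"
    by (rule dmap_ext_mapI[OF assms, of _ "\<lambda>x. x"]) (intro dpoint_restrict refl)+
qed (use assms in \<open>auto simp: cont_def\<close>)

lemma definable_preimage:
  assumes f: "definable_map M m A n B f" and C: "definable M n C"
  shows "definable M m {x \<in> A. f x \<in> C}"
proof -
  note f = definable_mapE[OF f]
  have "dpred M (\<lambda>s. (\<lambda>i\<in>{..<m}. s i) \<in> A \<and> ext_map A n f (\<lambda>i\<in>{..<m}. s i) \<in> C)"
    by (intro dpred_conj dpred_mem[OF f(1)] dpred_mem[OF C] dpoint_dmap[OF f(5)] dpoint_restrict)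
  then have "definable M m {x \<in> cart_space m. x \<in> A \<and> ext_map A n f x \<in> C}"
    by (rule dpred_imp_definable)
  moreover have "{x \<in> cart_space m. x \<in> A \<and> ext_map A n f x \<in> C} = {x \<in> A. f x \<in> C}"
    using definable_subset[OF f(1)] by (auto simp: ext_map_in)
  ultimately show ?thesis by simp
qed

section \<open>Definable homeomorphisms and their inverses\<close>

lemma homeomorphic_map_iff_cont:
  assumes "A \<subseteq> cart_space m" "B \<subseteq> cart_space n"
  shows "homeomorphic_map (sub_top m A) (sub_top n B) f \<longleftrightarrow> f ` A \<subseteq> B \<and> cont m A n f \<and>
    (\<exists>g. g ` B \<subseteq> A \<and> cont n B m g \<and> (\<forall>x\<in>A. g (f x) = x) \<and> (\<forall>y\<in>B. f (g y) = y))"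
  unfolding homeomorphic_map_maps homeomorphic_maps_def topspace_sub_top[OF assms(1)]
    topspace_sub_top[OF assms(2)] continuous_map_iff_cont[OF assms] continuous_map_iff_cont[OF assms(2,1)]
  by blast

text \<open>The graph of the inverse is the graph of \<open>f\<close> with its factors swapped, so
  any continuous inverse is automatically definable.\<close>

lemma definable_map_inverse:
  assumes f: "definable_map M m A n B f" and h: "homeomorphic_map (sub_top m A) (sub_top n B) f"
  obtains g where "definable_map M n B m A g" "\<And>x. x \<in> A \<Longrightarrow> g (f x) = x" "\<And>y. y \<in> B \<Longrightarrow> f (g y) = y"
proof -
  note f = definable_mapE[OF f]
  note sub = definable_subset[OF f(1)] definable_subset[OF f(2)]
  obtain g where g: "g ` B \<subseteq> A" "cont n B m g" "\<And>x. x \<in> A \<Longrightarrow> g (f x) = x" "\<And>y. y \<in> B \<Longrightarrow> f (g y) = y"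
    using h unfolding homeomorphic_map_iff_cont[OF sub] by blast
  have "dpred M (\<lambda>s. left_part n (\<lambda>i\<in>{..<n + m}. s i) \<in> B \<and> right_part n m (\<lambda>i\<in>{..<n + m}. s i) \<in> A \<and>
      ext_map A n f (right_part n m (\<lambda>i\<in>{..<n + m}. s i)) = left_part n (\<lambda>i\<in>{..<n + m}. s i))"
    by (intro dpred_conj dpred_mem[OF f(1)] dpred_mem[OF f(2)] dpred_eq_point[of _ n] dpoint_dmap[OF f(5)]
        dpoint_left_part[of _ _ m] dpoint_right_part[of _ n] dpoint_restrict)
  then have "definable M (n + m) {z \<in> cart_space (n + m). left_part n z \<in> B \<and> right_part n m z \<in> A \<and>
      ext_map A n f (right_part n m z) = left_part n z}"
    by (rule dpred_imp_definable)
  also have "{z \<in> cart_space (n + m). left_part n z \<in> B \<and> right_part n m z \<in> A \<and>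
      ext_map A n f (right_part n m z) = left_part n z} = {join n y (g y) | y. y \<in> B}" (is "?S = ?T")
  proof
    show "?S \<subseteq> ?T"
    proof
      fix z assume z: "z \<in> ?S"
      then have "g (left_part n z) = right_part n m z"
        using g(3)[of "right_part n m z"] by (auto simp: ext_map_in)
      then have "z = join n (left_part n z) (g (left_part n z))"
        using z join_left_right[of z n m] by simp
      with z show "z \<in> ?T" by blast
    qed
    show "?T \<subseteq> ?S"
    proof safe
      fix y assume y: "y \<in> B"
      then have c: "g y \<in> A" "y \<in> cart_space n" "g y \<in> cart_space m" using g(1) sub by auto
      show "join n y (g y) \<in> cart_space (n + m)" using c by (intro join_in_cart_space)
      show "left_part n (join n y (g y)) \<in> B" "right_part n m (join n y (g y)) \<in> A"
        "ext_map A n f (right_part n m (join n y (g y))) = left_part n (join n y (g y))"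
        using c y g(4) by (simp_all add: left_part_join right_part_join ext_map_in)
    qed
  qed
  finally have "definable_map M n B m A g"
    using f g continuous_map_iff_cont[OF sub(2,1)] unfolding definable_map_def by blast
  with g that show ?thesis by blast
qed

lemma definable_homeoI:
  assumes "definable_map M m A n B f" "definable_map M n B m A g"
    "\<And>x. x \<in> A \<Longrightarrow> g (f x) = x" "\<And>y. y \<in> B \<Longrightarrow> f (g y) = y"
  shows "definable_homeo M m A n B f"
  unfolding definable_homeo_def
  using assms by (auto simp: homeomorphic_map_maps homeomorphic_maps_def definable_map_def)

lemma openin_definable_mem:
  assumes "A \<subseteq> cart_space n" "openin (sub_top n A) U" "x \<in> U"
  obtains \<epsilon> where "0 < \<epsilon>" "\<And>y. y \<in> A \<Longrightarrow> near n \<epsilon> x y \<Longrightarrow> y \<in> U"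
  using assms(2,3) unfolding openin_sub_top[OF assms(1)] by blast

section \<open>Inverting a definable family of homeomorphisms\<close>

text \<open>The boundary of a box, as closed box minus open box. Written coordinatewise, it needs no
  maximum and is visibly definable.\<close>

definition on_sphere :: "nat \<Rightarrow> 'a::real_closed_field \<Rightarrow> (nat \<Rightarrow> 'a) \<Rightarrow> (nat \<Rightarrow> 'a) \<Rightarrow> bool" where
  "on_sphere n \<epsilon> x y \<longleftrightarrow> (\<forall>i<n. \<bar>x i - y i\<bar> \<le> \<epsilon>) \<and> \<not> near n \<epsilon> x y"

lemma dpred_on_sphere:
  "dfun M e \<Longrightarrow> dpoint M n t \<Longrightarrow> dpoint M n u \<Longrightarrow> dpred M (\<lambda>s. on_sphere n (e s) (t s) (u s))"
  unfolding on_sphere_def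
  by (intro dpred_conj dpred_not dpred_near dpred_all_less dpred_le dfun_abs dfun_diff)
    (simp_all add: dpoint_def)

text \<open>Off the sphere both sides are open: outside, some coordinate exceeds \<epsilon>, and its
  excess is the room available. This makes the side a locally constant property, as
  \<open>o_minimal_connected\<close> requires.\<close>

lemma near_locally_constant:
  assumes "\<not> on_sphere n \<epsilon> x y"
  obtains \<delta> where "0 < \<delta>" "\<And>z. near n \<delta> y z \<Longrightarrow> near n \<epsilon> x z \<longleftrightarrow> near n \<epsilon> x y"
proof (cases "near n \<epsilon> x y")
  case True
  then show ?thesis using that near_room by metis
next
  case False
  then obtain i where i: "i < n" "\<epsilon> < \<bar>x i - y i\<bar>"
    using assms by (auto simp: on_sphere_def not_le)
  have "\<not> near n \<epsilon> x z" if "near n (\<bar>x i - y i\<bar> - \<epsilon>) y z" for z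
  proof
    assume "near n \<epsilon> x z"
    then have "\<bar>x i - z i\<bar> < \<epsilon>" "\<bar>y i - z i\<bar> < \<bar>x i - y i\<bar> - \<epsilon>"
      using that i by (auto simp: near_def)
    moreover have "\<bar>x i - y i\<bar> \<le> \<bar>x i - z i\<bar> + \<bar>y i - z i\<bar>"
      using abs_triangle_ineq4[of "x i - z i" "y i - z i"] by simp
    ultimately show False by linarith
  qed
  with that[of "\<bar>x i - y i\<bar> - \<epsilon>"] i False show ?thesis by auto
qed

lemma limitin_right_near:
  fixes \<gamma> :: "'a::real_closed_field \<Rightarrow> nat \<Rightarrow> 'a"
  assumes K: "K \<subseteq> cart_space k" and lim: "limitin (sub_top k K) \<gamma> l (at_right 0)"
    and "0 < \<epsilon>"
  obtains \<beta> where "0 < \<beta>" "\<And>t. 0 < t \<Longrightarrow> t < \<beta> \<Longrightarrow> near k \<epsilon> l (\<gamma> t)"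
proof -
  have l: "l \<in> K" using lim topspace_sub_top[OF K] by (auto simp: limitin_def)
  have "openin (sub_top k K) {y \<in> K. near k \<epsilon> l y}"
    unfolding openin_sub_top[OF K]
  proof (intro conjI ballI)
    fix y assume "y \<in> {y \<in> K. near k \<epsilon> l y}"
    then have "near k \<epsilon> l y" by simp
    then obtain \<delta> where "0 < \<delta>" "\<And>z. near k \<delta> y z \<Longrightarrow> near k \<epsilon> l z"
      by (rule near_room) blast
    then show "\<exists>\<delta>>0. \<forall>z\<in>K. near k \<delta> y z \<longrightarrow> z \<in> {y \<in> K. near k \<epsilon> l y}" by auto
  qed simp
  moreover have "l \<in> {y \<in> K. near k \<epsilon> l y}" using l near_refl[OF \<open>0 < \<epsilon>\<close>] by simp
  ultimately have "eventually (\<lambda>t. \<gamma> t \<in> {y \<in> K. near k \<epsilon> l y}) (at_right 0)"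
    using lim unfolding limitin_def by blast
  from iffD1[OF eventually_at_right[OF zero_less_one] this]
  obtain \<beta> where "0 < \<beta>" "\<forall>t>0. t < \<beta> \<longrightarrow> \<gamma> t \<in> {y \<in> K. near k \<epsilon> l y}"
    by blast
  then show ?thesis using that by blast
qed

text \<open>\<open>definably_compact\<close> speaks of continuous curves only. Cutting
  \<open>b\<close> down to an initial interval on which it is continuous does not affect its limit
  at 0.\<close>

lemma definable_curve_limit:
  fixes b :: "'a::real_closed_field \<Rightarrow> nat \<Rightarrow> 'a"
  assumes "o_minimal M" "definably_compact M k K" "0 < \<tau>" and b: "dpoint M k (\<lambda>s. b (s 0))"
    and bK: "\<And>t. 0 < t \<Longrightarrow> t < \<tau> \<Longrightarrow> b t \<in> K"
  obtains l where "l \<in> K"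
    "\<And>\<epsilon>. 0 < \<epsilon> \<Longrightarrow> \<exists>\<beta>>0. \<forall>t. 0 < t \<and> t < \<beta> \<longrightarrow> near k \<epsilon> l (b t)"
proof -
  obtain c where c: "0 < c"
    "\<And>t \<epsilon>. 0 < t \<Longrightarrow> t < c \<Longrightarrow> 0 < \<epsilon> \<Longrightarrow> \<exists>\<delta>>0. \<forall>u. \<bar>u - t\<bar> < \<delta> \<longrightarrow> near k \<epsilon> (b t) (b u)"
    by (rule definable_eventually_continuous[OF assms(1) b, of 0]) blast
  define \<sigma> where "\<sigma> p = b (p 0)" for p :: "nat \<Rightarrow> 'a"
  define d where "d = min c \<tau>"
  have d: "0 < d" "d \<le> c" "d \<le> \<tau>" using c(1) assms(3) by (auto simp: d_def)
  let ?A = "point1 ` {0<..<d}"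
  have K: "definable M k K" using assms(2) by (simp add: definably_compact_def)
  have A_eq: "?A = {x \<in> cart_space 1. 0 < x 0 \<and> x 0 < d}"
  proof safe
    fix x :: "nat \<Rightarrow> 'a" assume x: "x \<in> cart_space 1" "0 < x 0" "x 0 < d"
    have "x = point1 (x 0)"
      unfolding point1_def using x by (intro cart_space_ext[of x 1] restrict_in_cart_space) auto
    with x show "x \<in> ?A" by (intro image_eqI[of _ _ "x 0"]) auto
  qed (auto simp: point1_def restrict_in_cart_space)
  have "dpred M (\<lambda>s. 0 < (\<lambda>i\<in>{..<1::nat}. s i) 0 \<and> (\<lambda>i\<in>{..<1::nat}. s i) 0 < d)"
    using dpred_conj[OF dpred_less[OF dfun_const dfun_var] dpred_less[OF dfun_var dfun_const], of M 0 0 0 d] by simp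
  then have A: "definable M 1 ?A"
    unfolding A_eq by (rule dpred_imp_definable)
  have "definable_map M 1 ?A k K \<sigma>"
  proof (rule definable_mapI[OF A K])
    show "\<sigma> x \<in> K" if "x \<in> ?A" for x
      using that bK d unfolding A_eq by (auto simp: \<sigma>_def)
    show "cont 1 ?A k \<sigma>"
      unfolding cont_def
    proof (intro ballI allI impI)
      fix x and \<epsilon> :: 'a assume x: "x \<in> ?A" "0 < \<epsilon>"
      then obtain \<delta> where "\<delta> > 0" "\<And>u. \<bar>u - x 0\<bar> < \<delta> \<Longrightarrow> near k \<epsilon> (b (x 0)) (b u)"
        using c(2)[of "x 0" \<epsilon>] d unfolding A_eq by auto
      moreover have "\<bar>y 0 - x 0\<bar> < \<delta>" if "near 1 \<delta> x y" for y
        using that by (simp add: near_def abs_minus_commute)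
      ultimately have "near k \<epsilon> (\<sigma> x) (\<sigma> y)" if "near 1 \<delta> x y" for y
        using that unfolding \<sigma>_def by blast
      with \<open>\<delta> > 0\<close> show "\<exists>\<delta>>0. \<forall>y\<in>?A. near 1 \<delta> x y \<longrightarrow> near k \<epsilon> (\<sigma> x) (\<sigma> y)"
        by blast
    qed
    show "dmap M 1 k (ext_map ?A k \<sigma>)"
      using b by (intro dmap_ext_mapI[OF A, of _ \<sigma>]) (simp_all add: \<sigma>_def)
  qed
  then obtain l where lim: "limitin (sub_top k K) (\<lambda>t. \<sigma> (point1 t)) l (at_right 0)"
    using assms(2) d(1) unfolding definably_compact_def by blast
  have Ks: "K \<subseteq> cart_space k" using definable_subset[OF K] .
  show ?thesis
  proof (rule that)
    show "l \<in> K" using lim topspace_sub_top[OF Ks] by (auto simp: limitin_def)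
    fix \<epsilon> :: 'a assume "0 < \<epsilon>"
    then obtain \<beta> where "0 < \<beta>" "\<And>t. 0 < t \<Longrightarrow> t < \<beta> \<Longrightarrow> near k \<epsilon> l (\<sigma> (point1 t))"
      by (rule limitin_right_near[OF Ks lim]) blast
    then show "\<exists>\<beta>>0. \<forall>t. 0 < t \<and> t < \<beta> \<longrightarrow> near k \<epsilon> l (b t)"
      by (auto simp: \<sigma>_def point1_def)
  qed
qed

text \<open>An intermediate value property: a curve that avoids the sphere stays on one side of it.
  Definability is required of the side \<open>Q\<close> only, not of the curve \<open>c\<close>,
  because \<open>c\<close> will be the image of a definable curve under an inverse not known to be
  definable.\<close>

lemma definable_curve_side:
  fixes c :: "'a::real_closed_field \<Rightarrow> nat \<Rightarrow> 'a"
  assumes "o_minimal M" "dpred M (\<lambda>\<sigma>. Q (\<sigma> 0))" "0 \<le> s"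
    and Q: "\<And>r. 0 \<le> r \<Longrightarrow> r \<le> s \<Longrightarrow> Q r \<longleftrightarrow> near k \<epsilon> v (c r)"
    and cont: "\<And>r e. 0 \<le> r \<Longrightarrow> r \<le> s \<Longrightarrow> 0 < e \<Longrightarrow>
      \<exists>\<delta>>0. \<forall>r'. 0 \<le> r' \<and> r' \<le> s \<and> \<bar>r' - r\<bar> < \<delta> \<longrightarrow> near k e (c r) (c r')"
    and avoid: "\<And>r. 0 \<le> r \<Longrightarrow> r \<le> s \<Longrightarrow> \<not> on_sphere k \<epsilon> v (c r)"
  shows "near k \<epsilon> v (c 0) \<longleftrightarrow> near k \<epsilon> v (c s)"
proof -
  have "Q 0 \<longleftrightarrow> Q s"
  proof (rule o_minimal_connected[OF assms(1,2,3)])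
    fix r assume r: "0 \<le> r" "r \<le> s"
    obtain \<delta> where \<delta>: "0 < \<delta>" "\<And>z. near k \<delta> (c r) z \<Longrightarrow> near k \<epsilon> v z \<longleftrightarrow> near k \<epsilon> v (c r)"
      by (rule near_locally_constant[OF avoid[OF r]]) blast
    show "\<exists>\<delta>>0. \<forall>u. 0 \<le> u \<and> u \<le> s \<and> \<bar>u - r\<bar> < \<delta> \<longrightarrow> Q u = Q r"
      using cont[OF r \<delta>(1)] \<delta>(2) Q r by metis
  qed
  then show ?thesis using Q[of 0] Q[of s] \<open>0 \<le> s\<close> by simp
qed

text \<open>The conclusion is continuity at one point of the inverse of
  \<open>(x, v) \<mapsto> (x, \<Phi> (x, v))\<close>. The hypothesis \<open>inv\<close> supplies a
  continuous inverse over each \<open>x\<close> separately, with no uniformity in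
  \<open>x\<close>.\<close>

lemma fibrewise_inverse_continuous:
  fixes M :: "('a::real_closed_field, 'f, 'r) expansion"
  assumes om: "o_minimal M" and lc: "locally_definably_compact M k F"
    and W: "definable M m W" and F: "definable M k F"
    and \<Phi>: "definable_map M (m + k) (join_prod m W F) k F \<Phi>"
    and inj: "\<And>x v v'. x \<in> W \<Longrightarrow> v \<in> F \<Longrightarrow> v' \<in> F \<Longrightarrow> \<Phi> (join m x v) = \<Phi> (join m x v') \<Longrightarrow> v = v'"
    and inv: "\<And>x. x \<in> W \<Longrightarrow> \<exists>G. G ` F \<subseteq> F \<and> cont k F k G \<and> (\<forall>w\<in>F. \<Phi> (join m x (G w)) = w)"
    and x0: "x0 \<in> W" and v0: "v0 \<in> F" and \<epsilon>: "0 < \<epsilon>"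
  shows "\<exists>\<delta>>0. \<forall>x\<in>W. \<forall>v\<in>F. near m \<delta> x0 x \<and> near k \<delta> (\<Phi> (join m x0 v0)) (\<Phi> (join m x v)) \<longrightarrow>
    near k \<epsilon> v0 v"
proof (rule ccontr)
  assume contra: "\<not> ?thesis"
  note dm = definable_mapE[OF \<Phi>]
  note Ws = definable_subset[OF W] and Fs = definable_subset[OF F]
  define \<Psi> where "\<Psi> = ext_map (join_prod m W F) k \<Phi>"
  have \<Psi>: "\<Psi> (join m x v) = \<Phi> (join m x v)" if "x \<in> W" "v \<in> F" for x v
    using join_prodI[OF that] by (simp add: \<Psi>_def ext_map_in)
  have \<Phi>F: "\<Phi> (join m x v) \<in> F" if "x \<in> W" "v \<in> F" for x v
    using dm(3) join_prodI[OF that] .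
  have d\<Psi>: "dmap M (m + k) k \<Psi>" using dm(5) by (simp add: \<Psi>_def)
  define w0 where "w0 = \<Phi> (join m x0 v0)"
  have w0: "w0 \<in> F" "w0 \<in> cart_space k" using \<Phi>F x0 v0 Fs by (auto simp: w0_def)
  have c0: "x0 \<in> cart_space m" "v0 \<in> cart_space k" using x0 v0 Ws Fs by auto
  obtain K U where K: "definably_compact M k K" "openin (sub_top k F) U" "v0 \<in> U" "U \<subseteq> K" "K \<subseteq> F"
    using lc v0 unfolding locally_definably_compact_def by blast
  obtain \<epsilon>0 where \<epsilon>0: "0 < \<epsilon>0" "\<And>y. y \<in> F \<Longrightarrow> near k \<epsilon>0 v0 y \<Longrightarrow> y \<in> U"
    by (rule openin_definable_mem[OF Fs K(2,3)]) blast
  \<comment> \<open>Being below \<epsilon>, the radius \<eta> leaves the counterexamples outside the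
    open box; being strictly below \<open>\<epsilon>0\<close>, it puts the points of
    \<open>F\<close> in the closed box, hence those on the sphere, into \<open>K\<close>.\<close>
  obtain \<eta> where \<eta>: "0 < \<eta>" "\<eta> < min \<epsilon> \<epsilon>0" using dense[of 0 "min \<epsilon> \<epsilon>0"] \<epsilon> \<epsilon>0(1) by auto
  have inK: "v \<in> K" if "v \<in> F" "on_sphere k \<eta> v0 v" for v
  proof -
    have "near k \<epsilon>0 v0 v" using that(2) \<eta>(2) by (auto simp: on_sphere_def near_def intro: le_less_trans)
    then show ?thesis using \<epsilon>0(2) that(1) K(4) by blast
  qed
  \<comment> \<open>The parameter \<open>t\<close> itself bounds the distances to \<open>x0\<close>
    and \<open>w0\<close>, so convergence as \<open>t\<close> tends to 0 is built into the choice of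
    the curve.\<close>
  define P where "P z t \<longleftrightarrow> z \<in> join_prod m W F \<and> near m t x0 (left_part m z) \<and> near k t w0 (\<Psi> z) \<and>
    \<not> near k \<eta> v0 (right_part m k z)" for z t
  have bad: "\<exists>z\<in>cart_space (m + k). P z t" if t: "0 < t" for t
  proof -
    obtain x v where xv: "x \<in> W" "v \<in> F" "near m t x0 x" "near k t w0 (\<Phi> (join m x v))" "\<not> near k \<epsilon> v0 v"
      using contra t unfolding w0_def by blast
    have "x \<in> cart_space m" "v \<in> cart_space k" using xv Ws Fs by auto
    moreover have "\<not> near k \<eta> v0 v" using xv(5) near_mono[of k \<eta> v0 v \<epsilon>] \<eta>(2) by auto
    ultimately show ?thesis
      using xv by (intro bexI[of _ "join m x v"] join_in_cart_space)
        (auto simp: P_def left_part_join right_part_join \<Psi> join_prodI)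
  qed
  have "dpred M (\<lambda>s. P (\<lambda>i\<in>{..<m + k}. s i) (s (m + k)))"
    unfolding P_def
    by (intro dpred_conj dpred_not dpred_mem[OF dm(1)] dpred_near dfun_var dfun_const dpoint_const c0 w0(2)
        dpoint_dmap[OF d\<Psi>] dpoint_left_part[of _ _ k] dpoint_right_part[of _ m] dpoint_restrict)
  then obtain z where z: "dpoint M (m + k) (\<lambda>s. z (s 0))" "\<And>t y. y \<in> cart_space (m + k) \<Longrightarrow> P y t \<Longrightarrow> P (z t) t"
    by (rule definable_curve_choice[OF om]) blast
  obtain b1 where b1: "0 < b1"
    "\<And>t \<epsilon>. 0 < t \<Longrightarrow> t < b1 \<Longrightarrow> 0 < \<epsilon> \<Longrightarrow> \<exists>\<delta>>0. \<forall>u. \<bar>u - t\<bar> < \<delta> \<longrightarrow> near (m + k) \<epsilon> (z t) (z u)"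
    by (rule definable_eventually_continuous[OF om z(1), of 0]) blast
  define x where "x t = left_part m (z t)" for t
  define v where "v t = right_part m k (z t)" for t
  have xv: "x t \<in> W" "v t \<in> F" "z t = join m (x t) (v t)" "near m t x0 (x t)"
    "near k t w0 (\<Phi> (z t))" "\<not> near k \<eta> v0 (v t)" if "0 < t" for t
  proof -
    have "P (z t) t" using bad[OF that] z(2) by blast
    then show "x t \<in> W" "v t \<in> F" "z t = join m (x t) (v t)" "near m t x0 (x t)"
      "near k t w0 (\<Phi> (z t))" "\<not> near k \<eta> v0 (v t)"
      using join_prodD[OF _ Ws Fs, of "z t"] by (auto simp: P_def x_def v_def \<Psi>_def ext_map_in)
  qed
  have xcont: "\<exists>\<delta>>0. \<forall>u. \<bar>u - t\<bar> < \<delta> \<longrightarrow> near m e (x t) (x u)" if "0 < t" "t < b1" "0 < e" for t e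
    using b1(2)[OF that] near_left_part unfolding x_def by blast
  have dx: "dpoint M m (\<lambda>s. x (s i))" for i
    unfolding x_def using dpoint_left_part[OF dpoint_reindex[OF z(1), of "\<lambda>_. i"]] .
  have dz: "dpoint M (m + k) (\<lambda>s. z (s i))" for i
    using dpoint_reindex[OF z(1), of "\<lambda>_. i"] .

  text \<open>Both curves start at \<open>w0\<close>; at parameter \<open>s\<close>, the inverse of \<open>\<Phi> (x s, _)\<close> takes them to
    \<open>v s\<close> and \<open>v0\<close>, on different sides of the sphere.\<close>
  define w where "w t = (if t \<le> 0 then w0 else \<Psi> (z t))" for t
  define u where "u t = (if t \<le> 0 then w0 else \<Psi> (join m (x t) v0))" for t
  \<comment> \<open>What \<open>w\<close> and \<open>u\<close> have in common. Their value
    \<open>w0\<close> for \<open>t \<le> 0\<close> closes them up at 0, so that they are continuous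
    on an interval including its left end, as the connectedness argument needs.\<close>
  define good where "good c \<longleftrightarrow> (\<forall>i. dpoint M k (\<lambda>s. c (s i))) \<and> c 0 = w0 \<and>
    (\<forall>t. 0 \<le> t \<and> t < b1 \<longrightarrow> c t \<in> F) \<and> (\<forall>t e. 0 \<le> t \<and> t < b1 \<and> 0 < e \<longrightarrow>
      (\<exists>\<delta>>0. \<forall>t'. 0 \<le> t' \<and> t' < b1 \<and> \<bar>t' - t\<bar> < \<delta> \<longrightarrow> near k e (c t) (c t')))" for c
  have goodI: "good (\<lambda>t. if t \<le> 0 then w0 else \<Psi> (y t))"
    if dy: "\<And>i. dpoint M (m + k) (\<lambda>s. y (s i))" and y: "\<And>t. 0 < t \<Longrightarrow> y t \<in> join_prod m W F"
      and ycont: "\<And>t e. 0 < t \<Longrightarrow> t < b1 \<Longrightarrow> 0 < e \<Longrightarrow> \<exists>\<delta>>0. \<forall>u. \<bar>u - t\<bar> < \<delta> \<longrightarrow> near (m + k) e (y t) (y u)"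
      and y0: "\<And>e. 0 < e \<Longrightarrow> \<exists>\<delta>>0. \<forall>t. 0 < t \<and> t < \<delta> \<longrightarrow> near k e w0 (\<Phi> (y t))" for y
  proof -
    have \<Psi>y: "\<Psi> (y t) = \<Phi> (y t)" if "0 < t" for t
      using y[OF that] by (simp add: \<Psi>_def ext_map_in)
    have "dpoint M k (\<lambda>s. if s i \<le> 0 then w0 else \<Psi> (y (s i)))" for i
      by (intro dpoint_if dpred_le dfun_var dfun_const dpoint_const w0 dpoint_dmap[OF d\<Psi>] dy)
    moreover have "\<exists>\<delta>>0. \<forall>t'. 0 \<le> t' \<and> t' < b1 \<and> \<bar>t' - t\<bar> < \<delta> \<longrightarrow>
        near k e (if t \<le> 0 then w0 else \<Psi> (y t)) (if t' \<le> 0 then w0 else \<Psi> (y t'))"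
      if t: "0 \<le> t" "t < b1" "0 < e" for t e
    proof (cases "t = 0")
      case True
      obtain \<delta> where "0 < \<delta>" "\<And>t. 0 < t \<Longrightarrow> t < \<delta> \<Longrightarrow> near k e w0 (\<Phi> (y t))"
        using y0[OF t(3)] by blast
      then show ?thesis using True t(3) \<Psi>y by (intro exI[of _ \<delta>]) (auto simp: near_refl)
    next
      case False
      with t have "0 < t" by simp
      obtain e' where e': "0 < e'" "\<And>y'. y' \<in> join_prod m W F \<Longrightarrow> near (m + k) e' (y t) y' \<Longrightarrow> near k e (\<Phi> (y t)) (\<Phi> y')"
        by (rule contD[OF dm(4) y[OF \<open>0 < t\<close>] t(3)]) blast
      obtain \<delta> where \<delta>: "0 < \<delta>" "\<And>u. \<bar>u - t\<bar> < \<delta> \<Longrightarrow> near (m + k) e' (y t) (y u)"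
        using ycont[OF \<open>0 < t\<close> t(2) e'(1)] by blast
      have "near k e (if t \<le> 0 then w0 else \<Psi> (y t)) (if t' \<le> 0 then w0 else \<Psi> (y t'))"
        if "\<bar>t' - t\<bar> < min \<delta> t" for t'
      proof -
        have "0 < t'" using that by (auto simp: abs_less_iff)
        then show ?thesis using e'(2)[OF y[OF \<open>0 < t'\<close>] \<delta>(2)] that \<open>0 < t\<close> by (simp add: \<Psi>y)
      qed
      then show ?thesis using \<delta>(1) \<open>0 < t\<close> by (intro exI[of _ "min \<delta> t"]) auto
    qed
    moreover have "(if t \<le> 0 then w0 else \<Psi> (y t)) \<in> F" for t
      using w0(1) dm(3)[OF y] \<Psi>y by (auto simp: not_le)
    ultimately show ?thesis unfolding good_def by (simp only: order_refl if_True) blast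
  qed
  have gw: "good w"
    unfolding w_def
  proof (rule goodI[OF dz])
    show "z t \<in> join_prod m W F" if "0 < t" for t using xv[OF that] join_prodI by metis
    show "\<exists>\<delta>>0. \<forall>t. 0 < t \<and> t < \<delta> \<longrightarrow> near k e w0 (\<Phi> (z t))" if "0 < e" for e
      using that near_mono[OF xv(5)] by (intro exI[of _ e]) auto
  qed (rule b1(2))
  have gu: "good u"
    unfolding u_def
  proof (rule goodI)
    show "dpoint M (m + k) (\<lambda>s. join m (x (s i)) v0)" for i
      by (intro dpoint_join dx dpoint_const c0)
    show "join m (x t) v0 \<in> join_prod m W F" if "0 < t" for t using xv(1)[OF that] v0 join_prodI by metis
    show "\<exists>\<delta>>0. \<forall>r. \<bar>r - t\<bar> < \<delta> \<longrightarrow> near (m + k) e (join m (x t) v0) (join m (x r) v0)"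
      if "0 < t" "t < b1" "0 < e" for t e
      using xcont[OF that] near_refl[OF that(3)] by (simp add: near_join)
    \<comment> \<open>Here \<open>u\<close> tends to \<open>w0\<close> because \<open>x t\<close>
      tends to \<open>x0\<close> and \<Phi> is continuous at \<open>(x0, v0)\<close>.\<close>
    show "\<exists>\<delta>>0. \<forall>t. 0 < t \<and> t < \<delta> \<longrightarrow> near k e w0 (\<Phi> (join m (x t) v0))" if e: "0 < e" for e
    proof -
      obtain \<delta> where \<delta>: "0 < \<delta>" "\<And>y. y \<in> join_prod m W F \<Longrightarrow> near (m + k) \<delta> (join m x0 v0) y \<Longrightarrow> near k e w0 (\<Phi> y)"
        unfolding w0_def by (rule contD[OF dm(4) join_prodI[OF x0 v0] e]) blast
      have "near k e w0 (\<Phi> (join m (x t) v0))" if "0 < t" "t < \<delta>" for t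
        using \<delta> xv(1,4)[OF that(1)] that(2) near_mono[of m t x0 "x t" \<delta>] near_refl[of \<delta> k v0] v0
        by (auto simp: near_join join_prodI)
      with \<delta>(1) show ?thesis by blast
    qed
  qed

  \<comment> \<open>\<open>r\<close> stays quantified: only the points \<open>y\<close> are chosen
    as a curve, and the bound \<open>r \<le> s\<close> is all that the limit will use.\<close>
  define R where "R y s \<longleftrightarrow> y \<in> F \<and> on_sphere k \<eta> v0 y \<and>
    (\<exists>r. 0 \<le> r \<and> r \<le> s \<and> (\<Psi> (join m (x s) y) = w r \<or> \<Psi> (join m (x s) y) = u r))" for y s
  have cross: "\<exists>y\<in>cart_space k. R y s" if s: "0 < s" "s < b1" for s
  proof (rule ccontr)
    assume no: "\<not> ?thesis"
    have xs: "x s \<in> W" "x s \<in> cart_space m" using xv(1)[OF s(1)] Ws by auto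
    obtain G where G: "\<And>w. w \<in> F \<Longrightarrow> G w \<in> F" "cont k F k G" "\<And>w. w \<in> F \<Longrightarrow> \<Phi> (join m (x s) (G w)) = w"
      using inv[OF xs(1)] by blast
    \<comment> \<open>With no crossing, \<open>G w0\<close> is on the same side as
      \<open>G (c s)\<close>. The two choices of \<open>c\<close> give \<open>G (w s) = v s\<close>
      and \<open>G (u s) = v0\<close>, which would put \<open>v s\<close> on the side of
      \<open>v0\<close>, inside the sphere.\<close>
    have side: "near k \<eta> v0 (G w0) \<longleftrightarrow> near k \<eta> v0 (G (c s))" if c: "good c" "c = w \<or> c = u" for c
    proof -
      have cF: "c r \<in> F" if "0 \<le> r" "r \<le> s" for r
        using c(1) that s unfolding good_def by auto
      have dc: "dpoint M k (\<lambda>s. c (s i))" for i using c(1) unfolding good_def by blast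
      have "near k \<eta> v0 (G (c 0)) \<longleftrightarrow> near k \<eta> v0 (G (c s))"
      \<comment> \<open>\<open>G\<close> may not be definable, so the side of \<open>G (c r)\<close>
        is described by the point \<open>y\<close> that \<Phi> over \<open>x s\<close> sends to
        \<open>c r\<close>; injectivity makes this point \<open>G (c r)\<close>.\<close>
      proof (rule definable_curve_side[OF om, of "\<lambda>r. \<exists>y\<in>cart_space k. y \<in> F \<and> \<Psi> (join m (x s) y) = c r \<and> near k \<eta> v0 y"])
        show "dpred M (\<lambda>\<sigma>. \<exists>y\<in>cart_space k. y \<in> F \<and> \<Psi> (join m (x s) y) = c (\<sigma> 0) \<and> near k \<eta> v0 y)"
          by (intro dpred_ex_vars dpred_conj dpred_mem[OF F] dpred_eq_point[of _ k] dpoint_dmap[OF d\<Psi>] dpoint_join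
              dpoint_const xs c0 dpred_near dfun_const dpoint_restrict dc)
        show "0 \<le> s" using s by simp
        fix r assume r: "0 \<le> r" "r \<le> s"
        show "(\<exists>y\<in>cart_space k. y \<in> F \<and> \<Psi> (join m (x s) y) = c r \<and> near k \<eta> v0 y) \<longleftrightarrow> near k \<eta> v0 (G (c r))"
        proof -
          have "y = G (c r)" if "y \<in> F" "\<Psi> (join m (x s) y) = c r" for y
            using that G(1,3)[OF cF[OF r]] inj[OF xs(1)] \<Psi>[OF xs(1)] by metis
          moreover have "\<Psi> (join m (x s) (G (c r))) = c r"
            using G(1,3)[OF cF[OF r]] \<Psi>[OF xs(1)] by simp
          ultimately show ?thesis using G(1)[OF cF[OF r]] Fs by (metis subsetD)
        qed
        show "\<not> on_sphere k \<eta> v0 (G (c r))"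
        proof
          assume "on_sphere k \<eta> v0 (G (c r))"
          moreover have "\<Psi> (join m (x s) (G (c r))) = c r"
            using G(1,3)[OF cF[OF r]] \<Psi>[OF xs(1)] by simp
          ultimately have "R (G (c r)) s" using c(2) r G(1)[OF cF[OF r]] unfolding R_def by blast
          then show False using no G(1)[OF cF[OF r]] Fs by blast
        qed
        fix e :: 'a assume "0 < e"
        obtain e' where e': "0 < e'" "\<And>y. y \<in> F \<Longrightarrow> near k e' (c r) y \<Longrightarrow> near k e (G (c r)) (G y)"
          by (rule contD[OF G(2) cF[OF r] \<open>0 < e\<close>]) blast
        have "r < b1" using r s by simp
        then obtain \<delta> where \<delta>: "0 < \<delta>" "\<And>t'. 0 \<le> t' \<Longrightarrow> t' < b1 \<Longrightarrow> \<bar>t' - r\<bar> < \<delta> \<Longrightarrow> near k e' (c r) (c t')"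
          using c(1) r(1) e'(1) unfolding good_def by blast
        have "near k e (G (c r)) (G (c r'))" if "0 \<le> r'" "r' \<le> s" "\<bar>r' - r\<bar> < \<delta>" for r'
          using \<delta>(2)[of r'] e'(2)[OF cF] that s by auto
        with \<delta>(1) show "\<exists>\<delta>>0. \<forall>r'. 0 \<le> r' \<and> r' \<le> s \<and> \<bar>r' - r\<bar> < \<delta> \<longrightarrow> near k e (G (c r)) (G (c r'))"
          by blast
      qed
      then show ?thesis using c(1) unfolding good_def by simp
    qed
    have "G (w s) = v s"
    proof (rule inj[OF xs(1)])
      have "w s \<in> F" using gw s unfolding good_def by auto
      then show "G (w s) \<in> F" "\<Phi> (join m (x s) (G (w s))) = \<Phi> (join m (x s) (v s))"
        using G(1,3) s xv(1,2,3)[OF s(1)] \<Psi> by (auto simp: w_def)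
    qed (rule xv(2)[OF s(1)])
    moreover have "G (u s) = v0"
    proof (rule inj[OF xs(1)])
      have "u s \<in> F" using gu s unfolding good_def by auto
      then show "G (u s) \<in> F" "\<Phi> (join m (x s) (G (u s))) = \<Phi> (join m (x s) v0)"
        using G(1,3) s xs(1) v0 \<Psi> by (auto simp: u_def)
    qed (rule v0)
    ultimately show False
      using side[OF gw] side[OF gu] xv(6)[OF s(1)] near_refl[OF \<eta>(1)] by auto
  qed
  have du: "dpoint M k (\<lambda>s. w (s i))" "dpoint M k (\<lambda>s. u (s i))" for i
    using gw gu unfolding good_def by auto
  have "dpred M (\<lambda>s. R (\<lambda>i\<in>{..<k}. s i) (s k))"
    unfolding R_def
    by (intro dpred_conj dpred_disj dpred_ex dpred_mem[OF F] dpred_on_sphere dpred_le dfun_var dfun_const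
        dpoint_const c0 dpred_eq_point[of _ k] dpoint_dmap[OF d\<Psi>] dpoint_join dx du dpoint_restrict)
  then obtain b where b: "dpoint M k (\<lambda>s. b (s 0))" "\<And>t y. y \<in> cart_space k \<Longrightarrow> R y t \<Longrightarrow> R (b t) t"
    by (rule definable_curve_choice[OF om]) blast
  have Rb: "R (b s) s" if "0 < s" "s < b1" for s using cross[OF that] b(2) by blast
  obtain l where l: "l \<in> K" "\<And>\<epsilon>. 0 < \<epsilon> \<Longrightarrow> \<exists>\<beta>>0. \<forall>t. 0 < t \<and> t < \<beta> \<longrightarrow> near k \<epsilon> l (b t)"
    by (rule definable_curve_limit[OF om K(1) b1(1) b(1)]) (use Rb inK R_def in blast)+
  have lF: "l \<in> F" using l(1) K(5) by blast
  \<comment> \<open>All smallness demands hold simultaneously for small \<open>t\<close>, so one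
    parameter can be picked that meets them together with \<open>R (b t) t\<close>.\<close>
  have close: "\<exists>t. 0 < t \<and> t < \<beta> \<and> t < b1 \<and> near k e l (b t) \<and> R (b t) t" if e: "0 < e" "0 < \<beta>" for e \<beta>
  proof -
    obtain \<gamma> where \<gamma>: "0 < \<gamma>" "\<And>t. 0 < t \<Longrightarrow> t < \<gamma> \<Longrightarrow> near k e l (b t)" using l(2)[OF e(1)] by blast
    obtain t where "0 < t" "t < min \<gamma> (min \<beta> b1)"
      using dense[of 0 "min \<gamma> (min \<beta> b1)"] \<gamma>(1) e(2) b1(1) by auto
    then show ?thesis using \<gamma>(2) Rb by auto
  qed
  \<comment> \<open>The sphere is closed: if \<open>l\<close> violated either of its two conditions,
    so would every point close to \<open>l\<close>, among them some \<open>b t\<close>.\<close>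
  have "on_sphere k \<eta> v0 l"
    unfolding on_sphere_def
  proof (intro conjI allI impI notI)
    fix i assume i: "i < k"
    show "\<bar>v0 i - l i\<bar> \<le> \<eta>"
    proof (rule ccontr)
      assume "\<not> ?thesis"
      then obtain t where t: "near k (\<bar>v0 i - l i\<bar> - \<eta>) l (b t)" "R (b t) t"
        using close[of "\<bar>v0 i - l i\<bar> - \<eta>" 1] by auto
      then have "\<bar>l i - b t i\<bar> < \<bar>v0 i - l i\<bar> - \<eta>" "\<bar>v0 i - b t i\<bar> \<le> \<eta>"
        using i unfolding near_def R_def on_sphere_def by auto
      moreover have "\<bar>v0 i - l i\<bar> \<le> \<bar>v0 i - b t i\<bar> + \<bar>l i - b t i\<bar>"
        using abs_triangle_ineq4[of "v0 i - b t i" "l i - b t i"] by simp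
      ultimately show False by linarith
    qed
  next
    assume "near k \<eta> v0 l"
    then obtain \<delta> where \<delta>: "0 < \<delta>" "\<And>y. near k \<delta> l y \<Longrightarrow> near k \<eta> v0 y"
      by (rule near_room) blast
    then show False using close[OF \<delta>(1) zero_less_one] unfolding R_def on_sphere_def by blast
  qed
  \<comment> \<open>For small \<open>t\<close> the point \<open>\<Phi> (x t, b t)\<close> is close
    to \<open>\<Phi> (x0, l)\<close> by continuity. It is also \<open>w r\<close> or
    \<open>u r\<close> with \<open>r \<le> t\<close>, hence close to \<open>w0\<close>.\<close>
  moreover have "\<Phi> (join m x0 l) = w0"
  proof (rule near_imp_eq[OF _ w0(2)])
    show "\<Phi> (join m x0 l) \<in> cart_space k" using \<Phi>F[OF x0 lF] Fs by blast
    fix e :: 'a assume "0 < e"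
    then have e2: "0 < e / 2" by simp
    obtain \<delta> where \<delta>: "0 < \<delta>" "\<And>y. y \<in> join_prod m W F \<Longrightarrow> near (m + k) \<delta> (join m x0 l) y \<Longrightarrow>
        near k (e / 2) (\<Phi> (join m x0 l)) (\<Phi> y)"
      by (rule contD[OF dm(4) join_prodI[OF x0 lF] e2]) blast
    have start: "\<exists>\<delta>>0. \<forall>r. 0 \<le> r \<and> r < b1 \<and> r < \<delta> \<longrightarrow> near k (e / 2) w0 (c r)" if "good c" for c
    proof -
      have "\<exists>\<delta>>0. \<forall>t'. 0 \<le> t' \<and> t' < b1 \<and> \<bar>t' - 0\<bar> < \<delta> \<longrightarrow> near k (e / 2) (c 0) (c t')" "c 0 = w0"
        using that b1(1) e2 unfolding good_def by blast+
      then obtain \<delta> where "0 < \<delta>"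
        "\<And>r. 0 \<le> r \<Longrightarrow> r < b1 \<Longrightarrow> \<bar>r - 0\<bar> < \<delta> \<Longrightarrow> near k (e / 2) w0 (c r)"
        by auto
      then show ?thesis by (intro exI[of _ \<delta>]) simp
    qed
    obtain \<delta>w where \<delta>w: "0 < \<delta>w" "\<And>r. 0 \<le> r \<Longrightarrow> r < b1 \<Longrightarrow> r < \<delta>w \<Longrightarrow> near k (e / 2) w0 (w r)"
      using start[OF gw] by blast
    obtain \<delta>u where \<delta>u: "0 < \<delta>u" "\<And>r. 0 \<le> r \<Longrightarrow> r < b1 \<Longrightarrow> r < \<delta>u \<Longrightarrow> near k (e / 2) w0 (u r)"
      using start[OF gu] by blast
    have "0 < min \<delta> (min \<delta>w \<delta>u)" using \<delta>(1) \<delta>w(1) \<delta>u(1) by simp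
    from close[OF \<delta>(1) this] obtain t where t: "0 < t" "t < \<delta>" "t < \<delta>w" "t < \<delta>u" "t < b1"
      "near k \<delta> l (b t)" "R (b t) t" by auto
    obtain r where r: "b t \<in> F" "0 \<le> r" "r \<le> t" "\<Psi> (join m (x t) (b t)) = w r \<or> \<Psi> (join m (x t) (b t)) = u r"
      using t(7) unfolding R_def by blast
    have "near k (e / 2) w0 (\<Phi> (join m (x t) (b t)))"
      using \<delta>w(2)[of r] \<delta>u(2)[of r] r t \<Psi>[OF xv(1)[OF t(1)] r(1)] by auto
    moreover have "near k (e / 2) (\<Phi> (join m x0 l)) (\<Phi> (join m (x t) (b t)))"
      using near_mono[OF xv(4)[OF t(1)], of \<delta>] t
      by (intro \<delta>(2) join_prodI xv(1) r) (auto simp: near_join)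
    ultimately show "near k e (\<Phi> (join m x0 l)) w0"
      using near_trans near_sym by (metis field_sum_of_halves)
  qed
  ultimately show False
    using inj[OF x0 lF v0] near_refl[OF \<eta>(1)] unfolding w0_def on_sphere_def by auto
qed

section \<open>Fibre bundles\<close>

lemma definable_equalizer:
  assumes f: "definable_map M m A n B f" and g: "definable_map M m A n C g"
  shows "definable M m {x \<in> A. f x = g x}"
proof -
  note f = definable_mapE[OF f] and g = definable_mapE[OF g]
  have "dpred M (\<lambda>s. (\<lambda>i\<in>{..<m}. s i) \<in> A \<and>
      ext_map A n f (\<lambda>i\<in>{..<m}. s i) = ext_map A n g (\<lambda>i\<in>{..<m}. s i))"
    by (intro dpred_conj dpred_mem[OF f(1)] dpred_eq_point[of _ n] dpoint_dmap[OF f(5)] dpoint_dmap[OF g(5)]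
        dpoint_restrict)
  then have "definable M m {x \<in> cart_space m. x \<in> A \<and> ext_map A n f x = ext_map A n g x}"
    by (rule dpred_imp_definable)
  moreover have "{x \<in> cart_space m. x \<in> A \<and> ext_map A n f x = ext_map A n g x} = {x \<in> A. f x = g x}"
    using definable_subset[OF f(1)] by (auto simp: ext_map_in)
  ultimately show ?thesis by simp
qed

lemma fibre_bundleD:
  assumes "definable_fibre_bundle M E"
  shows "definable M (fdim E) (fibre E)" "definable M (tdim E) (total E)" "definable M (bdim E) (base E)"
    "definable_map M (tdim E) (total E) (bdim E) (base E) (proj E)" "proj E ` total E = base E"
  using assms unfolding definable_fibre_bundle_def definable_map_def by auto

lemma definable_total_over:
  assumes "definable_fibre_bundle M E" "definable M (bdim E) U"
  shows "definable M (tdim E) (total_over E U)"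
  using definable_preimage[OF fibre_bundleD(4)[OF assms(1)] assms(2)] by (simp add: total_over_def)

text \<open>As \<phi> commutes with the projections, its inverse \<psi> has \<open>proj E\<close> as
  base component; only its fibre component carries new information.\<close>

lemma homeo_trivialisation:
  assumes E: "definable_fibre_bundle M E" and U: "definable M (bdim E) U"
    and \<phi>: "definable_homeo M (bdim E + fdim E) (join_prod (bdim E) U (fibre E)) (tdim E) (total_over E U) \<phi>"
    and pr: "\<forall>x\<in>U. \<forall>v\<in>fibre E. proj E (\<phi> (join (bdim E) x v)) = x"
  obtains \<psi> where
    "definable_map M (bdim E + fdim E) (join_prod (bdim E) U (fibre E)) (tdim E) (total_over E U) \<phi>"
    "definable_map M (tdim E) (total_over E U) (bdim E + fdim E) (join_prod (bdim E) U (fibre E)) \<psi>"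
    "\<And>x v. x \<in> U \<Longrightarrow> v \<in> fibre E \<Longrightarrow> \<psi> (\<phi> (join (bdim E) x v)) = join (bdim E) x v"
    "\<And>c. c \<in> total_over E U \<Longrightarrow> \<phi> (\<psi> c) = c"
    "\<And>c. c \<in> total_over E U \<Longrightarrow> right_part (bdim E) (fdim E) (\<psi> c) \<in> fibre E"
    "\<And>c. c \<in> total_over E U \<Longrightarrow> \<psi> c = join (bdim E) (proj E c) (right_part (bdim E) (fdim E) (\<psi> c))"
proof -
  have dm: "definable_map M (bdim E + fdim E) (join_prod (bdim E) U (fibre E)) (tdim E) (total_over E U) \<phi>"
    and h: "homeomorphic_map (sub_top (bdim E + fdim E) (join_prod (bdim E) U (fibre E)))
      (sub_top (tdim E) (total_over E U)) \<phi>"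
    using \<phi> by (auto simp: definable_homeo_def)
  obtain \<psi> where \<psi>: "definable_map M (tdim E) (total_over E U) (bdim E + fdim E) (join_prod (bdim E) U (fibre E)) \<psi>"
    "\<And>z. z \<in> join_prod (bdim E) U (fibre E) \<Longrightarrow> \<psi> (\<phi> z) = z" "\<And>c. c \<in> total_over E U \<Longrightarrow> \<phi> (\<psi> c) = c"
    by (rule definable_map_inverse[OF dm h]) blast
  note sub = definable_subset[OF U] definable_subset[OF fibre_bundleD(1)[OF E]]
  have r: "right_part (bdim E) (fdim E) (\<psi> c) \<in> fibre E"
    "\<psi> c = join (bdim E) (proj E c) (right_part (bdim E) (fdim E) (\<psi> c))" if c: "c \<in> total_over E U" for c
  proof -
    note j = join_prodD[OF definable_mapE(3)[OF \<psi>(1) c] sub]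
    show "right_part (bdim E) (fdim E) (\<psi> c) \<in> fibre E" by (rule j(2))
    have "proj E c = left_part (bdim E) (\<psi> c)"
      using pr j \<psi>(3)[OF c] by metis
    then show "\<psi> c = join (bdim E) (proj E c) (right_part (bdim E) (fdim E) (\<psi> c))" using j(3) by simp
  qed
  show ?thesis
    by (rule that[OF dm \<psi>(1) \<psi>(2)[OF join_prodI] \<psi>(3) r])
qed

lemma fibre_bundle_trivialisation:
  assumes E: "definable_fibre_bundle M E" and x: "x \<in> base E"
  obtains U \<phi> \<psi> where "x \<in> U" "U \<subseteq> base E" "definable M (bdim E) U" "openin (sub_top (bdim E) (base E)) U"
    "definable_map M (bdim E + fdim E) (join_prod (bdim E) U (fibre E)) (tdim E) (total_over E U) \<phi>"
    "definable_map M (tdim E) (total_over E U) (bdim E + fdim E) (join_prod (bdim E) U (fibre E)) \<psi>"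
    "\<And>x v. x \<in> U \<Longrightarrow> v \<in> fibre E \<Longrightarrow> proj E (\<phi> (join (bdim E) x v)) = x"
    "\<And>x v. x \<in> U \<Longrightarrow> v \<in> fibre E \<Longrightarrow> \<psi> (\<phi> (join (bdim E) x v)) = join (bdim E) x v"
    "\<And>c. c \<in> total_over E U \<Longrightarrow> \<phi> (\<psi> c) = c"
    "\<And>c. c \<in> total_over E U \<Longrightarrow> right_part (bdim E) (fdim E) (\<psi> c) \<in> fibre E"
    "\<And>c. c \<in> total_over E U \<Longrightarrow> \<psi> c = join (bdim E) (proj E c) (right_part (bdim E) (fdim E) (\<psi> c))"
proof -
  obtain \<U> where \<U>0: "\<Union>\<U> = base E" and \<U>: "\<forall>U\<in>\<U>. definable M (bdim E) U \<and> openin (sub_top (bdim E) (base E)) U \<and>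
           (\<exists>\<phi>. definable_homeo M (bdim E + fdim E) (join_prod (bdim E) U (fibre E))
                  (tdim E) (total_over E U) \<phi> \<and>
                (\<forall>x\<in>U. \<forall>v\<in>fibre E. proj E (\<phi> (join (bdim E) x v)) = x))"
    using E unfolding definable_fibre_bundle_def by (elim conjE exE) (rule that; assumption)
  obtain U where U: "x \<in> U" "U \<in> \<U>" "U \<subseteq> base E" using x \<U>0 by blast
  obtain \<phi> where dU: "definable M (bdim E) U" "openin (sub_top (bdim E) (base E)) U" and \<phi>:
    "definable_homeo M (bdim E + fdim E) (join_prod (bdim E) U (fibre E)) (tdim E) (total_over E U) \<phi>"
    "\<forall>x\<in>U. \<forall>v\<in>fibre E. proj E (\<phi> (join (bdim E) x v)) = x"
    using bspec[OF \<U> U(2)] by (elim conjE exE) (rule that; assumption)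
  show ?thesis
    by (rule homeo_trivialisation[OF E dU(1) \<phi>], rule that[OF U(1,3) dU])
      (assumption | rule \<phi>(2)[rule_format])+
qed

section \<open>The induced bundle\<close>

lemma induced_bundle_simps:
  "tdim (induced_bundle E n Y h) = tdim E + n"
  "bdim (induced_bundle E n Y h) = n"
  "base (induced_bundle E n Y h) = Y"
  "proj (induced_bundle E n Y h) = right_part (tdim E) n"
  "fdim (induced_bundle E n Y h) = fdim E"
  "fibre (induced_bundle E n Y h) = fibre E"
  by (simp_all add: induced_bundle_def)

lemma join_in_total_induced:
  assumes "total E \<subseteq> cart_space (tdim E)" "Y \<subseteq> cart_space n" "x \<in> cart_space (tdim E)" "y \<in> cart_space n"
  shows "join (tdim E) x y \<in> total (induced_bundle E n Y h) \<longleftrightarrow> x \<in> total E \<and> y \<in> Y \<and> proj E x = h y"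
proof
  assume "join (tdim E) x y \<in> total (induced_bundle E n Y h)"
  then obtain x' y' where j: "x' \<in> total E" "y' \<in> Y" "proj E x' = h y'" "join (tdim E) x y = join (tdim E) x' y'"
    by (auto simp: induced_bundle_def)
  then have "x = x'" "y = y'"
    using left_part_join[of x "tdim E" y] left_part_join[of x' "tdim E" y'] right_part_join[of y n "tdim E" x]
      right_part_join[of y' n "tdim E" x'] assms by auto
  with j show "x \<in> total E \<and> y \<in> Y \<and> proj E x = h y" by simp
qed (auto simp: induced_bundle_def)

lemma total_induced_eq:
  assumes "total E \<subseteq> cart_space (tdim E)" "Y \<subseteq> cart_space n"
  shows "total (induced_bundle E n Y h) =
    {z \<in> join_prod (tdim E) (total E) Y. proj E (left_part (tdim E) z) = h (right_part (tdim E) n z)}"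
  using assms by (auto simp: induced_bundle_def join_prod_def left_part_join right_part_join subset_iff) blast

lemma definable_total_induced:
  assumes E: "definable_fibre_bundle M E" and h: "definable_map M n Y (bdim E) (base E) h"
  shows "definable M (tdim E + n) (total (induced_bundle E n Y h))"
proof -
  note d = fibre_bundleD[OF E] and Y = definable_mapE(1)[OF h]
  show ?thesis
    unfolding total_induced_eq[OF definable_subset[OF d(2)] definable_subset[OF Y]]
    by (rule definable_equalizer[OF definable_map_comp[OF definable_map_left_part[OF d(2) Y] d(4)]
          definable_map_comp[OF definable_map_right_part[OF d(2) Y] h]])
qed

text \<open>Charts are pulled back: over the preimage of \<open>U\<close> under \<open>h\<close>
  take \<open>(y, v) \<mapsto> (\<phi> (h y, v), y)\<close>. Its inverse sends \<open>(c, y)\<close>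
  to \<open>y\<close> and the fibre component of \<open>\<psi> c\<close>; the base component of
  \<open>\<psi> c\<close> is \<open>h y\<close> by the equation that defines the total
  space.\<close>

lemma induced_bundle_is_bundle:
  assumes E: "definable_fibre_bundle M E" and h: "definable_map M n Y (bdim E) (base E) h"
  shows "definable_fibre_bundle M (induced_bundle E n Y h)"
proof -
  note d = fibre_bundleD[OF E] and hm = definable_mapE[OF h]
  note Y = hm(1)
  note subs = definable_subset[OF d(2)] definable_subset[OF Y]
  let ?I = "induced_bundle E n Y h"
  let ?t = "tdim E" and ?m = "bdim E" and ?k = "fdim E" and ?F = "fibre E"
  note T = definable_total_induced[OF E h]
  have TD: "left_part ?t z \<in> total E" "right_part ?t n z \<in> Y"
    "proj E (left_part ?t z) = h (right_part ?t n z)" "join ?t (left_part ?t z) (right_part ?t n z) = z"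
    "z \<in> join_prod ?t (total E) Y" if "z \<in> total ?I" for z
    using that join_prodD[of z ?t "total E" Y n] subs by (auto simp: total_induced_eq[OF subs])
  have pr: "definable_map M (?t + n) (total ?I) n Y (right_part ?t n)"
    by (rule definable_map_restrict[OF definable_map_right_part[OF d(2) Y] T _ Y]) (use TD in auto)
  have "right_part ?t n ` total ?I = Y"
  proof
    show "right_part ?t n ` total ?I \<subseteq> Y" using TD by auto
    show "Y \<subseteq> right_part ?t n ` total ?I"
    proof
      fix y assume y: "y \<in> Y"
      then obtain x where x: "x \<in> total E" "proj E x = h y"
        using hm(3)[OF y] d(5) by (metis imageE)
      then have "join ?t x y \<in> total ?I" using y by (auto simp: induced_bundle_def)
      then show "y \<in> right_part ?t n ` total ?I"
        using right_part_join[of y n ?t x] subs y by (intro image_eqI[of _ _ "join ?t x y"]) auto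
    qed
  qed
  moreover obtain \<U> where \<U>: "finite \<U>" "\<Union>\<U> = base E" "\<forall>U\<in>\<U>. definable M ?m U \<and> openin (sub_top ?m (base E)) U \<and>
           (\<exists>\<phi>. definable_homeo M (?m + ?k) (join_prod ?m U ?F) ?t (total_over E U) \<phi> \<and>
                (\<forall>x\<in>U. \<forall>v\<in>?F. proj E (\<phi> (join ?m x v)) = x))"
    using E unfolding definable_fibre_bundle_def by (elim conjE exE) (rule that; assumption)
  define pre where "pre U = {y \<in> Y. h y \<in> U}" for U
  have "\<exists>\<theta>. definable_homeo M (n + ?k) (join_prod n (pre U) ?F) (?t + n) (total_over ?I (pre U)) \<theta> \<and>
      (\<forall>y\<in>pre U. \<forall>v\<in>?F. right_part ?t n (\<theta> (join n y v)) = y)" if UU: "U \<in> \<U>" for U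
  proof -
    obtain \<phi> where U: "definable M ?m U" and \<phi>h: "definable_homeo M (?m + ?k) (join_prod ?m U ?F) ?t (total_over E U) \<phi>"
      and \<phi>p: "\<forall>x\<in>U. \<forall>v\<in>?F. proj E (\<phi> (join ?m x v)) = x"
      using bspec[OF \<U>(3) UU] by (elim conjE exE) (rule that; assumption)
    obtain \<psi> where \<phi>: "definable_map M (?m + ?k) (join_prod ?m U ?F) ?t (total_over E U) \<phi>"
      and \<psi>: "definable_map M ?t (total_over E U) (?m + ?k) (join_prod ?m U ?F) \<psi>"
      and \<psi>\<phi>: "\<And>x v. x \<in> U \<Longrightarrow> v \<in> ?F \<Longrightarrow> \<psi> (\<phi> (join ?m x v)) = join ?m x v"
      and \<phi>\<psi>: "\<And>c. c \<in> total_over E U \<Longrightarrow> \<phi> (\<psi> c) = c"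
      and \<psi>F: "\<And>c. c \<in> total_over E U \<Longrightarrow> right_part ?m ?k (\<psi> c) \<in> ?F"
      and \<psi>eq: "\<And>c. c \<in> total_over E U \<Longrightarrow> \<psi> c = join ?m (proj E c) (right_part ?m ?k (\<psi> c))"
      by (rule homeo_trivialisation[OF E U \<phi>h \<phi>p]) blast
    have V: "definable M n (pre U)"
      unfolding pre_def by (rule definable_preimage[OF h U])
    have VY: "pre U \<subseteq> Y" by (auto simp: pre_def)
    note Vs = definable_subset[OF V] and Fs = definable_subset[OF d(1)] and Us = definable_subset[OF U]
    have TV: "definable M (?t + n) (total_over ?I (pre U))"
      using definable_preimage[OF pr V] by (simp add: total_over_def induced_bundle_simps)
    have EU: "definable M ?t (total_over E U)" by (rule definable_total_over[OF E U])
    note EUs = definable_subset[OF EU]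
    have hV: "definable_map M n (pre U) ?m U h"
      by (rule definable_map_restrict[OF h V VY U]) (auto simp: pre_def)
    define \<theta> where "\<theta> z = join ?t (\<phi> (join ?m (h (left_part n z)) (right_part n ?k z))) (left_part n z)" for z
    define \<omega> where "\<omega> z = join n (right_part ?t n z) (right_part ?m ?k (\<psi> (left_part ?t z)))" for z
    have \<theta>_join: "\<theta> (join n y v) = join ?t (\<phi> (join ?m (h y) v)) y"
      "\<phi> (join ?m (h y) v) \<in> total_over E U" "proj E (\<phi> (join ?m (h y) v)) = h y"
      "\<phi> (join ?m (h y) v) \<in> cart_space ?t" "y \<in> cart_space n" "v \<in> cart_space ?k" "h y \<in> U"
      if "y \<in> pre U" "v \<in> ?F" for y v
    proof -
      show c: "y \<in> cart_space n" "v \<in> cart_space ?k" "h y \<in> U" using that Vs Fs by (auto simp: pre_def)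
      then show "\<theta> (join n y v) = join ?t (\<phi> (join ?m (h y) v)) y"
        by (simp add: \<theta>_def left_part_join right_part_join)
      show "\<phi> (join ?m (h y) v) \<in> total_over E U"
        by (rule definable_mapE(3)[OF \<phi> join_prodI]) (use c that in auto)
      then show "\<phi> (join ?m (h y) v) \<in> cart_space ?t" using EUs by blast
      show "proj E (\<phi> (join ?m (h y) v)) = h y" using \<phi>p c that by blast
    qed
    have \<theta>_in: "\<theta> (join n y v) \<in> total_over ?I (pre U)" if "y \<in> pre U" "v \<in> ?F" for y v
      using \<theta>_join[OF that] that VY subs
      by (auto simp: total_over_def induced_bundle_simps right_part_join join_in_total_induced)
    have over: "left_part ?t z \<in> total_over E U" "right_part ?t n z \<in> pre U" "z \<in> total ?I"
      if "z \<in> total_over ?I (pre U)" for z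
      using that TD[of z] by (auto simp: total_over_def induced_bundle_simps pre_def)
    have d\<theta>: "definable_map M (n + ?k) (join_prod n (pre U) ?F) (?t + n) (total_over ?I (pre U)) \<theta>"
    proof -
      note l = definable_map_left_part[OF V d(1)] and r = definable_map_right_part[OF V d(1)]
      have "definable_map M (n + ?k) (join_prod n (pre U) ?F) (?t + n) (join_prod ?t (total_over E U) (pre U)) \<theta>"
        unfolding \<theta>_def
        by (rule definable_map_join[OF definable_map_comp[OF definable_map_join[OF definable_map_comp[OF l hV] r] \<phi>] l])
      then show ?thesis
        by (rule definable_map_restrict[OF _ definable_join_prod[OF V d(1)] order_refl TV])
          (use \<theta>_in in \<open>auto simp: join_prod_def\<close>)
    qed
    have d\<omega>: "definable_map M (?t + n) (total_over ?I (pre U)) (n + ?k) (join_prod n (pre U) ?F) \<omega>"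
    proof -
      have l: "definable_map M (?t + n) (total_over ?I (pre U)) ?t (total_over E U) (left_part ?t)"
        by (rule definable_map_restrict[OF definable_map_left_part[OF d(2) Y] TV _ EU])
          (use over TD in blast)+
      have r: "definable_map M (?t + n) (total_over ?I (pre U)) n (pre U) (right_part ?t n)"
        by (rule definable_map_restrict[OF definable_map_right_part[OF d(2) Y] TV _ V])
          (use over TD in blast)+
      show ?thesis
        unfolding \<omega>_def
        by (rule definable_map_join[OF r definable_map_comp[OF definable_map_comp[OF l \<psi>] definable_map_right_part[OF U d(1)]]])
    qed
    have "definable_homeo M (n + ?k) (join_prod n (pre U) ?F) (?t + n) (total_over ?I (pre U)) \<theta>"
    proof (rule definable_homeoI[OF d\<theta> d\<omega>])
      fix z assume "z \<in> join_prod n (pre U) ?F"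
      then obtain y v where z: "z = join n y v" "y \<in> pre U" "v \<in> ?F" by (auto simp: join_prod_def)
      note c = \<theta>_join[OF z(2,3)]
      show "\<omega> (\<theta> z) = z"
        unfolding z(1) c(1) using c \<psi>\<phi>[OF c(7) z(3)]
        by (simp add: \<omega>_def left_part_join right_part_join)
    next
      fix z assume z: "z \<in> total_over ?I (pre U)"
      note o = over[OF z]
      have "right_part ?m ?k (\<psi> (left_part ?t z)) \<in> ?F" by (rule \<psi>F[OF o(1)])
      then have "\<theta> (\<omega> z) = join ?t (\<phi> (join ?m (h (right_part ?t n z)) (right_part ?m ?k (\<psi> (left_part ?t z)))))
          (right_part ?t n z)"
        unfolding \<omega>_def by (rule \<theta>_join(1)[OF o(2)])
      also have "join ?m (h (right_part ?t n z)) (right_part ?m ?k (\<psi> (left_part ?t z))) = \<psi> (left_part ?t z)"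
        using \<psi>eq[OF o(1)] TD(3)[OF o(3)] by simp
      finally show "\<theta> (\<omega> z) = z" using \<phi>\<psi>[OF o(1)] TD(4)[OF o(3)] by simp
    qed
    moreover have "\<forall>y\<in>pre U. \<forall>v\<in>?F. right_part ?t n (\<theta> (join n y v)) = y"
      using \<theta>_join by (simp add: right_part_join)
    ultimately show ?thesis by blast
  qed
  moreover have "definable M n (pre U)" "openin (sub_top n Y) (pre U)" if UU: "U \<in> \<U>" for U
  proof -
    have U: "definable M ?m U" "openin (sub_top ?m (base E)) U" using bspec[OF \<U>(3) UU] by simp_all
    show "definable M n (pre U)" unfolding pre_def by (rule definable_preimage[OF h U(1)])
    have "continuous_map (sub_top n Y) (sub_top ?m (base E)) h"
      using h by (simp add: definable_map_def)
    from openin_continuous_map_preimage[OF this U(2)] show "openin (sub_top n Y) (pre U)"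
      unfolding topspace_sub_top[OF subs(2)] pre_def .
  qed
  moreover have "\<Union>(pre ` \<U>) = Y"
    using \<U>(2) hm(3) by (auto simp: pre_def)
  moreover have "finite (pre ` \<U>)" using \<U>(1) by simp
  ultimately have "\<exists>\<V>. finite \<V> \<and> \<Union>\<V> = Y \<and> (\<forall>V\<in>\<V>. definable M n V \<and> openin (sub_top n Y) V \<and>
      (\<exists>\<theta>. definable_homeo M (n + ?k) (join_prod n V ?F) (?t + n) (total_over ?I V) \<theta> \<and>
        (\<forall>y\<in>V. \<forall>v\<in>?F. right_part ?t n (\<theta> (join n y v)) = y)))"
    by (intro exI[of _ "pre ` \<U>"]) blast
  then show ?thesis
    unfolding definable_fibre_bundle_def induced_bundle_simps
    using d(1) pr \<open>right_part ?t n ` total ?I = Y\<close> by blast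
qed

text \<open>This is continuity of the inverse of \<open>b \<mapsto> (f b, proj E b)\<close>. In
  charts around \<open>x0\<close> and \<open>fb x0\<close> the map \<open>f\<close> becomes a family
  \<Phi> of self-maps of the fibre, to which \<open>fibrewise_inverse_continuous\<close> applies;
  the base component is controlled by the second distance.\<close>

lemma bundle_map_inverse_continuous:
  assumes om: "o_minimal M" and lc: "locally_definably_compact M (fdim E) (fibre E)"
    and bm: "definable_bundle_map_over M E E' f fb"
    and b0: "b0 \<in> total E" and \<epsilon>: "0 < \<epsilon>"
  shows "\<exists>\<delta>>0. \<forall>c\<in>total E. near (tdim E') \<delta> (f b0) (f c) \<and> near (bdim E) \<delta> (proj E b0) (proj E c) \<longrightarrow>
    near (tdim E) \<epsilon> b0 c"
proof -
  let ?t = "tdim E" and ?m = "bdim E" and ?k = "fdim E" and ?F = "fibre E" and ?t' = "tdim E'" and ?m' = "bdim E'"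
  have E: "definable_fibre_bundle M E" and E': "definable_fibre_bundle M E'"
    and k: "fdim E' = ?k" and F: "fibre E' = ?F"
    and f: "definable_map M ?t (total E) ?t' (total E') f"
    and fb: "definable_map M ?m (base E) ?m' (base E') fb"
    and comm: "\<And>b. b \<in> total E \<Longrightarrow> proj E' (f b) = fb (proj E b)"
    and fh: "\<And>x. x \<in> base E \<Longrightarrow> homeomorphic_map (sub_top ?t (total_over E {x})) (sub_top ?t' (total_over E' {fb x})) f"
    using bm unfolding definable_bundle_map_over_def by auto
  note d = fibre_bundleD[OF E] and d' = fibre_bundleD[OF E', unfolded F k]
  note ts = definable_subset[OF d(2)] definable_subset[OF d'(2)] and Xs = definable_subset[OF d(3)]
    and Xs' = definable_subset[OF d'(3)] and Fs = definable_subset[OF d(1)]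
  define x0 where "x0 = proj E b0"
  have x0: "x0 \<in> base E" using d(5) b0 by (auto simp: x0_def)
  then have fbx0: "fb x0 \<in> base E'" by (rule definable_mapE(3)[OF fb])
  obtain U \<phi> \<psi> where U: "x0 \<in> U" "U \<subseteq> base E" "definable M ?m U" "openin (sub_top ?m (base E)) U"
    and \<phi>: "definable_map M (?m + ?k) (join_prod ?m U ?F) ?t (total_over E U) \<phi>"
    and \<psi>: "definable_map M ?t (total_over E U) (?m + ?k) (join_prod ?m U ?F) \<psi>"
    and \<phi>p: "\<And>x v. x \<in> U \<Longrightarrow> v \<in> ?F \<Longrightarrow> proj E (\<phi> (join ?m x v)) = x"
    and \<psi>\<phi>: "\<And>x v. x \<in> U \<Longrightarrow> v \<in> ?F \<Longrightarrow> \<psi> (\<phi> (join ?m x v)) = join ?m x v"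
    and \<phi>\<psi>: "\<And>c. c \<in> total_over E U \<Longrightarrow> \<phi> (\<psi> c) = c"
    and \<psi>F: "\<And>c. c \<in> total_over E U \<Longrightarrow> right_part ?m ?k (\<psi> c) \<in> ?F"
    and \<psi>eq: "\<And>c. c \<in> total_over E U \<Longrightarrow> \<psi> c = join ?m (proj E c) (right_part ?m ?k (\<psi> c))"
    by (rule fibre_bundle_trivialisation[OF E x0]) blast
  obtain U' \<phi>' \<psi>' where U': "fb x0 \<in> U'" "U' \<subseteq> base E'" "definable M ?m' U'" "openin (sub_top ?m' (base E')) U'"
    and \<phi>': "definable_map M (?m' + ?k) (join_prod ?m' U' ?F) ?t' (total_over E' U') \<phi>'"
    and \<psi>': "definable_map M ?t' (total_over E' U') (?m' + ?k) (join_prod ?m' U' ?F) \<psi>'"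
    and \<phi>p': "\<And>x v. x \<in> U' \<Longrightarrow> v \<in> ?F \<Longrightarrow> proj E' (\<phi>' (join ?m' x v)) = x"
    and \<psi>\<phi>': "\<And>x v. x \<in> U' \<Longrightarrow> v \<in> ?F \<Longrightarrow> \<psi>' (\<phi>' (join ?m' x v)) = join ?m' x v"
    and \<phi>\<psi>': "\<And>c. c \<in> total_over E' U' \<Longrightarrow> \<phi>' (\<psi>' c) = c"
    and \<psi>F': "\<And>c. c \<in> total_over E' U' \<Longrightarrow> right_part ?m' ?k (\<psi>' c) \<in> ?F"
    and \<psi>eq': "\<And>c. c \<in> total_over E' U' \<Longrightarrow> \<psi>' c = join ?m' (proj E' c) (right_part ?m' ?k (\<psi>' c))"
    by (rule fibre_bundle_trivialisation[OF E' fbx0, unfolded F k]) blast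
  define W where "W = {x \<in> U. fb x \<in> U'}"
  have fbU: "definable_map M ?m U ?m' (base E') fb"
    by (rule definable_map_restrict[OF fb U(3,2) d'(3)]) (use definable_mapE(3)[OF fb] U(2) in blast)
  have W: "definable M ?m W" unfolding W_def by (rule definable_preimage[OF fbU U'(3)])
  have WU: "W \<subseteq> U" by (auto simp: W_def)
  note Ws = definable_subset[OF W] and Us = definable_subset[OF U(3)] and Us' = definable_subset[OF U'(3)]
  define \<Phi> where "\<Phi> z = right_part ?m' ?k (\<psi>' (f (\<phi> z)))" for z
  have EU: "definable M ?t (total_over E U)" by (rule definable_total_over[OF E U(3)])
  have EW: "definable M ?t (total_over E W)" by (rule definable_total_over[OF E W])
  have EU': "definable M ?t' (total_over E' U')" by (rule definable_total_over[OF E' U'(3)])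
  have \<phi>_in: "\<phi> (join ?m x v) \<in> total_over E {x}" "\<phi> (join ?m x v) \<in> total_over E W"
    "\<phi> (join ?m x v) \<in> total E"
    if "x \<in> W" "v \<in> ?F" for x v
  proof -
    have "\<phi> (join ?m x v) \<in> total_over E U"
      by (rule definable_mapE(3)[OF \<phi> join_prodI]) (use that WU in auto)
    then show "\<phi> (join ?m x v) \<in> total_over E {x}" "\<phi> (join ?m x v) \<in> total_over E W" "\<phi> (join ?m x v) \<in> total E"
      using \<phi>p[of x v] that WU by (auto simp: total_over_def)
  qed
  have f_in: "f c \<in> total_over E' U'" "f c \<in> total E'" if "c \<in> total_over E W" for c
    using that comm[of c] definable_mapE(3)[OF f, of c] by (auto simp: total_over_def W_def)
  have d\<Phi>: "definable_map M (?m + ?k) (join_prod ?m W ?F) ?k ?F \<Phi>"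
  proof -
    have "join_prod ?m W ?F \<subseteq> join_prod ?m U ?F" using WU unfolding join_prod_def by blast
    then have 1: "definable_map M (?m + ?k) (join_prod ?m W ?F) ?t (total_over E W) \<phi>"
      by (rule definable_map_restrict[OF \<phi> definable_join_prod[OF W d(1)] _ EW])
        (use \<phi>_in in \<open>auto simp: join_prod_def\<close>)
    have 2: "definable_map M ?t (total_over E W) ?t' (total_over E' U') f"
      by (rule definable_map_restrict[OF f EW _ EU']) (use f_in in \<open>auto simp: total_over_def\<close>)
    show ?thesis unfolding \<Phi>_def
      by (rule definable_map_comp[OF definable_map_comp[OF definable_map_comp[OF 1 2] \<psi>'] definable_map_right_part[OF U'(3) d(1)]])
  qed
  have \<psi>'f: "\<psi>' (f (\<phi> (join ?m x v))) = join ?m' (fb x) (\<Phi> (join ?m x v))" if "x \<in> W" "v \<in> ?F" for x v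
  proof -
    note p = \<phi>_in[OF that]
    have "proj E' (f (\<phi> (join ?m x v))) = fb x"
      using comm[OF p(3)] \<phi>p[of x v] that WU by auto
    then show ?thesis using \<psi>eq'[OF f_in(1)[OF p(2)]] by (simp add: \<Phi>_def)
  qed
  have inj: "v = v'" if "x \<in> W" "v \<in> ?F" "v' \<in> ?F" "\<Phi> (join ?m x v) = \<Phi> (join ?m x v')" for x v v'
  proof -
    note p = \<phi>_in[OF that(1,2)] and p' = \<phi>_in[OF that(1,3)]
    have "\<psi>' (f (\<phi> (join ?m x v))) = \<psi>' (f (\<phi> (join ?m x v')))"
      using \<psi>'f[OF that(1,2)] \<psi>'f[OF that(1,3)] that(4) by simp
    then have "f (\<phi> (join ?m x v)) = f (\<phi> (join ?m x v'))"
      using \<phi>\<psi>'[OF f_in(1)[OF p(2)]] \<phi>\<psi>'[OF f_in(1)[OF p'(2)]] by metis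
    moreover have "inj_on f (total_over E {x})"
    proof -
      have "x \<in> base E" "total_over E {x} \<subseteq> cart_space ?t"
        using that(1) WU U(2) ts by (auto simp: total_over_def)
      then show ?thesis
        using homeomorphic_imp_injective_map[OF fh] topspace_sub_top by metis
    qed
    ultimately have "\<phi> (join ?m x v) = \<phi> (join ?m x v')"
      using p(1) p'(1) by (auto dest: inj_onD)
    then have "join ?m x v = join ?m x v'"
      using \<psi>\<phi>[OF subsetD[OF WU that(1)] that(2)] \<psi>\<phi>[OF subsetD[OF WU that(1)] that(3)] by metis
    then show "v = v'"
      using right_part_join[OF subsetD[OF Fs that(2)]] right_part_join[OF subsetD[OF Fs that(3)]] by metis
  qed
  \<comment> \<open>\<open>G\<close> follows the chart over \<open>fb x\<close> into the fibre, the
    inverse \<open>h\<close> of \<open>f\<close> on this one fibre, and the fibre component of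
    \<psi>. Continuity of \<open>h\<close> within the fibre suffices.\<close>
  have inv: "\<exists>G. G ` ?F \<subseteq> ?F \<and> cont ?k ?F ?k G \<and> (\<forall>w\<in>?F. \<Phi> (join ?m x (G w)) = w)" if x: "x \<in> W" for x
  proof -
    have xX: "x \<in> U" "x \<in> base E" "fb x \<in> U'" using x U(2) by (auto simp: W_def)
    have sub: "total_over E {x} \<subseteq> cart_space ?t" "total_over E' {fb x} \<subseteq> cart_space ?t'"
      using ts by (auto simp: total_over_def)
    obtain h where h: "h ` total_over E' {fb x} \<subseteq> total_over E {x}" "cont ?t' (total_over E' {fb x}) ?t h"
      "\<And>y. y \<in> total_over E' {fb x} \<Longrightarrow> f (h y) = y"
      using fh[OF xX(2)] unfolding homeomorphic_map_iff_cont[OF sub] by blast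
    define y where "y w = \<phi>' (join ?m' (fb x) w)" for w
    define G where "G w = right_part ?m ?k (\<psi> (h (y w)))" for w
    have y: "y w \<in> total_over E' {fb x}" if "w \<in> ?F" for w
    proof -
      have "y w \<in> total_over E' U'"
        unfolding y_def by (rule definable_mapE(3)[OF \<phi>' join_prodI[OF xX(3) that]])
      then show ?thesis using \<phi>p'[OF xX(3) that] by (simp add: total_over_def y_def)
    qed
    have hy: "h (y w) \<in> total_over E {x}" "h (y w) \<in> total_over E U" if "w \<in> ?F" for w
      using h(1) y[OF that] xX(1) by (auto simp: total_over_def)
    have "cont ?k ?F (?m' + ?k) (\<lambda>w. join ?m' (fb x) w)"
      unfolding cont_def near_join using near_refl by blast
    then have "cont ?k ?F ?t' y"
      unfolding y_def by (rule cont_comp[OF _ definable_mapE(4)[OF \<phi>']]) (use xX join_prodI in auto)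
    then have "cont ?k ?F ?t (\<lambda>w. h (y w))"
      by (rule cont_comp[OF _ h(2)]) (use y in auto)
    then have "cont ?k ?F (?m + ?k) (\<lambda>w. \<psi> (h (y w)))"
      by (rule cont_comp[OF _ definable_mapE(4)[OF \<psi>]]) (use hy in auto)
    then have "cont ?k ?F ?k G"
      unfolding G_def by (rule cont_comp[OF _ cont_right_part[of _ _ UNIV]]) simp
    moreover have GF: "G w \<in> ?F" if "w \<in> ?F" for w
      unfolding G_def by (rule \<psi>F[OF hy(2)[OF that]])
    moreover have "\<Phi> (join ?m x (G w)) = w" if w: "w \<in> ?F" for w
    proof -
      have "\<psi> (h (y w)) = join ?m x (G w)"
        using \<psi>eq[OF hy(2)[OF w]] hy(1)[OF w] by (simp add: G_def total_over_def)
      then have "f (\<phi> (join ?m x (G w))) = y w"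
        using \<phi>\<psi>[OF hy(2)[OF w]] h(3)[OF y[OF w]] by simp
      then show ?thesis
        using \<psi>\<phi>'[OF xX(3) w] right_part_join[of w ?k ?m' "fb x"] w Fs by (auto simp: \<Phi>_def y_def)
    qed
    ultimately show ?thesis by blast
  qed
  have x0W: "x0 \<in> W" using U(1) U'(1) by (simp add: W_def)
  have over: "c \<in> total_over E U" "c \<in> total_over E W" if "c \<in> total E" "proj E c \<in> W" for c
    using that WU by (auto simp: total_over_def)
  define v where "v c = right_part ?m ?k (\<psi> c)" for c
  have v: "v c \<in> ?F" "\<phi> (join ?m (proj E c) (v c)) = c" "\<Phi> (join ?m (proj E c) (v c)) = right_part ?m' ?k (\<psi>' (f c))"
    if "c \<in> total E" "proj E c \<in> W" for c
  proof -
    note o = over[OF that]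
    show "v c \<in> ?F" unfolding v_def by (rule \<psi>F[OF o(1)])
    have "join ?m (proj E c) (v c) = \<psi> c" unfolding v_def by (rule \<psi>eq[OF o(1), symmetric])
    then show "\<phi> (join ?m (proj E c) (v c)) = c" using \<phi>\<psi>[OF o(1)] by simp
    then show "\<Phi> (join ?m (proj E c) (v c)) = right_part ?m' ?k (\<psi>' (f c))" by (simp add: \<Phi>_def)
  qed
  note v0 = v[OF b0, folded x0_def, OF x0W]
  have fb0: "f b0 \<in> total_over E' U'" using f_in(1) over(2)[OF b0] x0W x0_def by blast
  obtain \<epsilon>1 where \<epsilon>1: "0 < \<epsilon>1" "\<And>z. z \<in> join_prod ?m U ?F \<Longrightarrow> near (?m + ?k) \<epsilon>1 (join ?m x0 (v b0)) z \<Longrightarrow>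
      near ?t \<epsilon> b0 (\<phi> z)"
    by (rule contD[OF definable_mapE(4)[OF \<phi>] join_prodI[OF U(1) v0(1)] \<epsilon>]) (use v0(2) in auto)
  have "\<exists>\<delta>>0. \<forall>x\<in>W. \<forall>u\<in>?F. near ?m \<delta> x0 x \<and>
      near ?k \<delta> (\<Phi> (join ?m x0 (v b0))) (\<Phi> (join ?m x u)) \<longrightarrow> near ?k \<epsilon>1 (v b0) u"
    by (rule fibrewise_inverse_continuous[OF om lc W d(1) d\<Phi> _ _ x0W v0(1) \<epsilon>1(1)])
      (erule (3) inj, erule inv)
  then obtain \<delta>1 where \<delta>1: "0 < \<delta>1" "\<And>x u. x \<in> W \<Longrightarrow> u \<in> ?F \<Longrightarrow> near ?m \<delta>1 x0 x \<Longrightarrow>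
      near ?k \<delta>1 (\<Phi> (join ?m x0 (v b0))) (\<Phi> (join ?m x u)) \<Longrightarrow> near ?k \<epsilon>1 (v b0) u"
    by blast
  obtain \<delta>2 where \<delta>2: "0 < \<delta>2" "\<And>y. y \<in> total_over E' U' \<Longrightarrow> near ?t' \<delta>2 (f b0) y \<Longrightarrow>
      near (?m' + ?k) \<delta>1 (\<psi>' (f b0)) (\<psi>' y)"
    by (rule contD[OF definable_mapE(4)[OF \<psi>'] fb0 \<delta>1(1)]) blast
  obtain \<delta>3 where \<delta>3: "0 < \<delta>3" "\<And>x. x \<in> base E \<Longrightarrow> near ?m \<delta>3 x0 x \<Longrightarrow> x \<in> U"
    by (rule openin_definable_mem[OF Xs U(4,1)]) blast
  obtain e where e: "0 < e" "\<And>x. x \<in> base E' \<Longrightarrow> near ?m' e (fb x0) x \<Longrightarrow> x \<in> U'"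
    by (rule openin_definable_mem[OF Xs' U'(4,1)]) blast
  obtain \<delta>4 where \<delta>4: "0 < \<delta>4" "\<And>x. x \<in> base E \<Longrightarrow> near ?m \<delta>4 x0 x \<Longrightarrow> near ?m' e (fb x0) (fb x)"
    by (rule contD[OF definable_mapE(4)[OF fb] x0 e(1)]) blast
  \<comment> \<open>\<open>\<delta>3\<close> and \<open>\<delta>4\<close> keep the base point in
    \<open>W\<close>; \<open>\<delta>2\<close> passes from \<open>f c\<close> to its chart
    coordinates, \<open>\<delta>1\<close> inverts the family \<Phi>, and \<open>\<epsilon>1\<close>
    passes back from chart coordinates to \<open>c\<close>.\<close>
  define \<delta> where "\<delta> = Min {\<epsilon>1, \<delta>1, \<delta>2, \<delta>3, \<delta>4}"
  have \<delta>: "0 < \<delta>" "\<delta> \<le> \<epsilon>1" "\<delta> \<le> \<delta>1" "\<delta> \<le> \<delta>2" "\<delta> \<le> \<delta>3" "\<delta> \<le> \<delta>4"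
    using \<epsilon>1(1) \<delta>1(1) \<delta>2(1) \<delta>3(1) \<delta>4(1) by (auto simp: \<delta>_def)
  have "near ?t \<epsilon> b0 c" if c: "c \<in> total E" "near ?t' \<delta> (f b0) (f c)" "near ?m \<delta> x0 (proj E c)" for c
  proof -
    let ?x = "proj E c"
    have xX: "?x \<in> base E" using c(1) d(5) by blast
    have n: "near ?m \<epsilon>1 x0 ?x" "near ?m \<delta>1 x0 ?x" "near ?m \<delta>3 x0 ?x" "near ?m \<delta>4 x0 ?x" "near ?t' \<delta>2 (f b0) (f c)"
      using c \<delta> near_mono by blast+
    have xW: "?x \<in> W"
      using \<delta>3(2)[OF xX n(3)] e(2)[OF definable_mapE(3)[OF fb xX] \<delta>4(2)[OF xX n(4)]] by (simp add: W_def)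
    note vc = v[OF c(1) xW]
    have "near (?m' + ?k) \<delta>1 (\<psi>' (f b0)) (\<psi>' (f c))"
      by (rule \<delta>2(2)[OF f_in(1)[OF over(2)[OF c(1) xW]] n(5)])
    then have "near ?k \<delta>1 (\<Phi> (join ?m x0 (v b0))) (\<Phi> (join ?m ?x (v c)))"
      unfolding v0(3) vc(3) by (rule near_right_part)
    then have "near ?k \<epsilon>1 (v b0) (v c)" by (rule \<delta>1(2)[OF xW vc(1) n(2)])
    with n(1) have "near (?m + ?k) \<epsilon>1 (join ?m x0 (v b0)) (join ?m ?x (v c))" by (simp add: near_join)
    then show ?thesis
      using \<epsilon>1(2)[OF join_prodI] WU xW vc(1,2) by (metis subsetD)
  qed
  with \<delta>(1) show ?thesis unfolding x0_def by blast
qed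

text \<open>Two mutually inverse maps that respect the projections restrict to mutually inverse maps
  of fibres, so \<open>g\<close> is a bundle map over the identity. The lemma serves both for the
  map from \<open>E\<close> to the induced bundle and for its inverse.\<close>

lemma bundle_iso_over_base:
  assumes E: "definable_fibre_bundle M E" "definable_fibre_bundle M E'"
    and same: "bdim E = bdim E'" "base E = base E'" "fdim E = fdim E'" "fibre E = fibre E'"
    and g: "definable_map M (tdim E) (total E) (tdim E') (total E') g"
    and h: "definable_map M (tdim E') (total E') (tdim E) (total E) h"
    and inv: "\<And>b. b \<in> total E \<Longrightarrow> h (g b) = b" "\<And>c. c \<in> total E' \<Longrightarrow> g (h c) = c"
    and pr: "\<And>b. b \<in> total E \<Longrightarrow> proj E' (g b) = proj E b"
  shows "definable_bundle_iso M E E' g"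
proof -
  have hom: "homeomorphic_map (sub_top (tdim E) (total E)) (sub_top (tdim E') (total E')) g"
    using definable_homeoI[OF g h inv] by (simp add: definable_homeo_def)
  have "homeomorphic_map (sub_top (tdim E) (total_over E {x})) (sub_top (tdim E') (total_over E' {x})) g" for x
  proof -
    have sub: "total_over E {x} \<subseteq> cart_space (tdim E)" "total_over E' {x} \<subseteq> cart_space (tdim E')"
      using definable_subset[OF definable_mapE(1)[OF g]] definable_subset[OF definable_mapE(2)[OF g]]
      by (auto simp: total_over_def)
    have pr': "proj E (h c) = proj E' c" if "c \<in> total E'" for c
      using pr[OF definable_mapE(3)[OF h that]] inv(2)[OF that] by simp
    show ?thesis
      unfolding homeomorphic_map_iff_cont[OF sub]
    proof (intro conjI exI[of _ h])
      show "g ` total_over E {x} \<subseteq> total_over E' {x}" "h ` total_over E' {x} \<subseteq> total_over E {x}"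
        using pr pr' definable_mapE(3)[OF g] definable_mapE(3)[OF h] by (auto simp: total_over_def)
      show "cont (tdim E) (total_over E {x}) (tdim E') g" "cont (tdim E') (total_over E' {x}) (tdim E) h"
        by (auto intro!: cont_subset[OF definable_mapE(4)[OF g]] cont_subset[OF definable_mapE(4)[OF h]]
            simp: total_over_def)
    qed (use inv in \<open>auto simp: total_over_def\<close>)
  qed
  then have "definable_bundle_map_over M E E' g (\<lambda>x. x)"
    unfolding definable_bundle_map_over_def
    using E same g pr definable_map_id[OF fibre_bundleD(3)[OF E(1)]] by auto
  with hom show ?thesis unfolding definable_bundle_iso_def definable_bundle_map_def by blast
qed

theorem theorem2p11:
  fixes M :: "('a::real_closed_field, 'f, 'r) expansion"
    and E E' :: "'a fibre_bundle"
    and f fb :: "(nat \<Rightarrow> 'a) \<Rightarrow> nat \<Rightarrow> 'a"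
  assumes "o_minimal M"
    and "definable_fibre_bundle M E"
    and "definable_fibre_bundle M E'"
    and "fdim E = fdim E'" and "fibre E = fibre E'"
    and "locally_definably_compact M (fdim E) (fibre E)"
    and "definable_bundle_map_over M E E' f fb"
  shows "isomorphic_bundles M (induced_bundle E' (bdim E) (base E) fb) E \<and>
         (\<exists>g. definable_bundle_iso M E (induced_bundle E' (bdim E) (base E) fb) g \<and>
              (\<forall>b\<in>total E. induced_bundle_map E' (g b) = f b))"
proof -
  let ?t = "tdim E" and ?m = "bdim E" and ?t' = "tdim E'"
  let ?I = "induced_bundle E' ?m (base E) fb"
  have f: "definable_map M ?t (total E) ?t' (total E') f"
    and fb: "definable_map M ?m (base E) (bdim E') (base E') fb"
    and comm: "\<And>b. b \<in> total E \<Longrightarrow> proj E' (f b) = fb (proj E b)"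
    and fh: "\<And>x. x \<in> base E \<Longrightarrow> homeomorphic_map (sub_top ?t (total_over E {x})) (sub_top ?t' (total_over E' {fb x})) f"
    using assms(7) unfolding definable_bundle_map_over_def by auto
  note d = fibre_bundleD[OF assms(2)] and d' = fibre_bundleD[OF assms(3)]
  note sub = definable_subset[OF d(2)] definable_subset[OF d'(2)] definable_subset[OF d(3)]
  have I: "definable_fibre_bundle M ?I" by (rule induced_bundle_is_bundle[OF assms(3) fb])
  note T = definable_total_induced[OF assms(3) fb]
  note Ts = definable_subset[OF T]
  define g where "g b = join ?t' (f b) (proj E b)" for b
  have cs: "f b \<in> cart_space ?t'" "proj E b \<in> cart_space ?m" "f b \<in> total E'" "proj E b \<in> base E"
    if "b \<in> total E" for b
    using definable_mapE(3)[OF f that] definable_mapE(3)[OF d(4) that] sub by auto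
  have gT: "g b \<in> total ?I" if "b \<in> total E" for b
    unfolding g_def join_in_total_induced[OF sub(2,3) cs(1,2)[OF that]] using cs[OF that] comm[OF that] by blast
  have dg: "definable_map M ?t (total E) (?t' + ?m) (total ?I) g"
    unfolding g_def
    by (rule definable_map_restrict[OF definable_map_join[OF f d(4)] d(2) order_refl T]) (use gT g_def in auto)
  have gl: "left_part ?t' (g b) = f b" "right_part ?t' ?m (g b) = proj E b" if "b \<in> total E" for b
    using cs[OF that] by (simp_all add: g_def left_part_join right_part_join)
  \<comment> \<open>The image under \<open>g\<close> records the base point, so bijectivity of
    \<open>g\<close> reduces to bijectivity of \<open>f\<close> on each fibre.\<close>
  have fibre_bij: "bij_betw f (total_over E {x}) (total_over E' {fb x})" if "x \<in> base E" for x
  proof -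
    have "total_over E {x} \<subseteq> cart_space ?t" "total_over E' {fb x} \<subseteq> cart_space ?t'"
      using sub by (auto simp: total_over_def)
    then show ?thesis
      using fh[OF that]
      by (metis bij_betw_def homeomorphic_imp_injective_map homeomorphic_imp_surjective_map topspace_sub_top)
  qed
  have inj: "inj_on g (total E)"
  proof (rule inj_onI)
    fix b c assume bc: "b \<in> total E" "c \<in> total E" "g b = g c"
    then have "f b = f c" "proj E b = proj E c" using gl by metis+
    moreover have "inj_on f (total_over E {proj E b})"
      using fibre_bij[OF cs(4)[OF bc(1)]] by (rule bij_betw_imp_inj_on)
    ultimately show "b = c" using bc by (auto simp: total_over_def dest: inj_onD)
  qed
  have surj: "g ` total E = total ?I"
  proof
    show "g ` total E \<subseteq> total ?I" using gT by blast
    show "total ?I \<subseteq> g ` total E"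
    proof
      fix z assume "z \<in> total ?I"
      then obtain y x where z: "z = join ?t' y x" "y \<in> total E'" "x \<in> base E" "proj E' y = fb x"
        by (auto simp: induced_bundle_def)
      then have "y \<in> f ` total_over E {x}"
        using fibre_bij[OF z(3)] by (simp add: bij_betw_def total_over_def)
      then show "z \<in> g ` total E" using z(1) by (auto simp: g_def total_over_def)
    qed
  qed
  \<comment> \<open>A purely set-theoretic inverse, used to establish that \<open>g\<close> is a
    homeomorphism. The definable inverse \<open>k\<close> is then obtained from the swapped
    graph.\<close>
  define h where "h = the_inv_into (total E) g"
  have hg: "h (g b) = b" if "b \<in> total E" for b
    unfolding h_def by (rule the_inv_into_f_f[OF inj that])
  have hT: "h z \<in> total E" "g (h z) = z" if "z \<in> total ?I" for z
    using that hg unfolding surj[symmetric] by auto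
  have "cont (?t' + ?m) (total ?I) ?t h"
    unfolding cont_def
  proof (intro ballI allI impI)
    fix z and \<epsilon> :: 'a assume z: "z \<in> total ?I" and "0 < \<epsilon>"
    obtain \<delta> where \<delta>: "0 < \<delta>" "\<And>c. c \<in> total E \<Longrightarrow> near ?t' \<delta> (f (h z)) (f c) \<Longrightarrow>
        near ?m \<delta> (proj E (h z)) (proj E c) \<Longrightarrow> near ?t \<epsilon> (h z) c"
      using bundle_map_inverse_continuous[OF assms(1,6,7) hT(1)[OF z] \<open>0 < \<epsilon>\<close>] by blast
    have "near ?t \<epsilon> (h z) (h y)" if "y \<in> total ?I" "near (?t' + ?m) \<delta> z y" for y
    proof (rule \<delta>(2)[OF hT(1)[OF that(1)]])
      have "near (?t' + ?m) \<delta> (g (h z)) (g (h y))" using hT(2) z that by simp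
      then show "near ?t' \<delta> (f (h z)) (f (h y))" "near ?m \<delta> (proj E (h z)) (proj E (h y))"
        by (simp_all add: g_def near_join)
    qed
    with \<delta>(1) show "\<exists>\<delta>>0. \<forall>y\<in>total ?I. near (?t' + ?m) \<delta> z y \<longrightarrow> near ?t \<epsilon> (h z) (h y)" by blast
  qed
  then have "homeomorphic_map (sub_top ?t (total E)) (sub_top (?t' + ?m) (total ?I)) g"
    unfolding homeomorphic_map_iff_cont[OF sub(1) Ts]
    using definable_mapE(4)[OF dg] gT hT hg by blast
  from definable_map_inverse[OF dg this] obtain k where
    k: "definable_map M (?t' + ?m) (total ?I) ?t (total E) k"
    "\<And>b. b \<in> total E \<Longrightarrow> k (g b) = b" "\<And>z. z \<in> total ?I \<Longrightarrow> g (k z) = z"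
    by blast
  have kp: "proj E (k z) = right_part ?t' ?m z" if "z \<in> total ?I" for z
    using gl(2)[OF definable_mapE(3)[OF k(1) that]] k(3)[OF that] by simp
  have "definable_bundle_iso M E ?I g"
    by (rule bundle_iso_over_base[OF assms(2) I, of g k])
      (use assms(4,5) dg k gl in \<open>simp_all add: induced_bundle_simps\<close>)
  moreover have "definable_bundle_iso M ?I E k"
    by (rule bundle_iso_over_base[OF I assms(2), of k g])
      (use assms(4,5) dg k kp in \<open>simp_all add: induced_bundle_simps\<close>)
  moreover have "induced_bundle_map E' (g b) = f b" if "b \<in> total E" for b
    using gl(1)[OF that] by (simp add: induced_bundle_map_def)
  ultimately show ?thesis unfolding isomorphic_bundles_def by blast
qed

end
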